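(* Let $\alpha_{\mathbf i},\alpha_{\mathbf j}$ be the contact forms on $S^3$ and $\omega^\theta$ the symplectic forms on $T^*S^2\setminus S^2$ described in the context. There is an $S^1$-action $(\psi_\theta)_{\theta\in\mathbb{R}/4\pi\mathbb{Z}}$ on $S^3$, given by left multiplication with a circle of unit quaternions, which sends (by push-forward) $\alpha_{\mathbf i}$ to the contact forms $$\alpha^{\theta}=(\psi_\theta)_*\alpha_{\mathbf i}=\cos\theta\,\alpha_{\mathbf i}+\sin\theta\,\alpha_{\mathbf j},\qquad \theta\in\mathbb{R}/2\pi\mathbb{Z},$$ such that the Reeb flow of $\alpha^\theta$, which has all orbits periodic of the same period $4\pi$, doubly covers the Hamiltonian flow of $\omega^\theta$ on $ST^*S^2$. Moreover, there is a deformation $\alpha_{\mathbf i,\varepsilon}$, $\varepsilon\in[0,1)$, of $\alpha_{\mathbf i}=\alpha_{\mathbf i,0}$ through contact forms on $S^3$, mapped to a family of contact forms $\alpha^\theta_\varepsilon=(\psi_\theta)_*\alpha_{\mathbf i,\varepsilon}$, $\theta\in\mathbb{R}/2\pi\mathbb{Z}$, under the $S^1$-action, with the following properties: (i) The Reeb flow of $\alpha^\theta_\varepsilon$ doubly covers the Hamiltonian flow of $\omega^\theta$ on a level set of a suitably perturbed Hamiltonian function $H^\theta_\varepsilon$ on $T^*S^2\setminus S^2$. (ii) For any irrational value of the parameter $\varepsilon$, this Hamiltonian flow (on the level set in (i)) has precisely two periodic orbits. (iii) For $\theta\equiv\pi/2$ mod $\pi$ and $\varepsilon$ sufficiently small,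 the Hamiltonian flow of $H^\theta_\varepsilon$ is the geodesic flow of a Finsler metric on $S^2$.
   Context: Contact forms on $S^3$: Regard $S^3$ as the unit sphere in the quaternions $\mathbb{H}\cong\mathbb{R}^4$ with standard units $\mathbf i,\mathbf j,\mathbf k$ and let $r$ be the radial function on $\mathbb{H}$. Left multiplication by $\mathbf i,\mathbf j,\mathbf k$ defines complex bundle structures on $T\mathbb{H}$. Set $\alpha_{\mathbf i}=-2\,\mathrm{d}r\circ\mathbf i|_{TS^3}$ and $\alpha_{\mathbf j}=-2\,\mathrm{d}r\circ\mathbf j|_{TS^3}$; explicitly $(\alpha_{\mathbf c})_{\mathbf u}(\dot{\mathbf u})=-2\langle\mathbf u,\mathbf c\dot{\mathbf u}\rangle$ for $\mathbf c\in\{\mathbf i,\mathbf j\}$. The Reeb vector field $R$ of a contact form $\beta$ is defined by $\beta(R)=1$, $\mathrm{d}\beta(R,\cdot)=0$. Forms on the cotangent bundle: Let $S^2\subset\mathbb{R}^3$ carry the round metric $g_0$ of Gauss curvature $1$, with area form $\sigma_0$ (total area $4\pi$). Let $\pi\colon T^*S^2\to S^2$ be the projection, $\lambda$ the canonical Liouville $1$-form on $T^*S^2$ ($\lambda_{\mathbf v^*}=\mathbf v^*\circ T\pi$), and $\lambda_1$ its restriction to the unit cotangent bundle $ST^*S^2$. Identify $ST^*S^2=\{(\mathbf x,\mathbf y)\in\mathbb{R}^3\times\mathbb{R}^3: |\mathbf x|=|\mathbf y|=1,\ \langle\mathbf x,\mathbf y\rangle=0\}$, where $(\mathbf x,\mathbf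 y)$ is the covector $\dot{\mathbf x}\mapsto\langle\mathbf y,\dot{\mathbf x}\rangle$ on $T_{\mathbf x}S^2$. Then $(\lambda_1)_{(\mathbf x,\mathbf y)}(\dot{\mathbf x},\dot{\mathbf y})=\langle\mathbf y,\dot{\mathbf x}\rangle$; put $(\lambda_2)_{(\mathbf x,\mathbf y)}(\dot{\mathbf x},\dot{\mathbf y})=\langle\mathbf x\times\mathbf y,\dot{\mathbf x}\rangle$. The connection $1$-form $\alpha$ on $ST^*S^2$ is the unique $1$-form with $\mathrm{d}\lambda_1=\lambda_2\wedge\alpha$ and $\mathrm{d}\lambda_2=\alpha\wedge\lambda_1$; it satisfies $\mathrm{d}\alpha=\lambda_1\wedge\lambda_2=\pi^*\sigma_0$. Write $T^*S^2\setminus S^2$ for the complement of the zero section and identify it with $\mathbb{R}^+\times ST^*S^2$ (with $\mathbb{R}^+$-coordinate $\rho$) via $(\rho,\mathbf v^* )\mapsto\rho\mathbf v^*$. Under this identification $\lambda$ becomes $\rho\lambda_1$. Define symplectic forms on $T^*S^2\setminus S^2$ by $$\omega^\theta=\sin\theta\,\mathrm{d}\lambda+\cos\theta\,\mathrm{d}(\rho\alpha),\qquad\theta\in\mathbb{R}/2\pi\mathbb{Z}.$$ Hamiltonian flows: For a symplectic form $\omega$ and a function $G$, the Hamiltonian vector field $X_G$ is defined by $\omega(X_G,\cdot)=-\mathrm{d}G$. "The Hamiltonian flow of $\omega^\theta$ on $ST^*S^2$", with no function named, means the flow with respect to $\omega^\theta$ of $H(\mathbf v^* )=\frac12\|\mathbf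 v^*\|_*^2$, where $\|\cdot\|_*$ is the norm dual to $g_0$, on $ST^*S^2=H^{-1}(1/2)$. A "perturbed Hamiltonian function" $H^\theta_\varepsilon$ means a smooth family in $\varepsilon$ of functions whose relevant level set for $\varepsilon=0$ is $ST^*S^2$ with the same Hamiltonian vector field along it as that of $H$. A Reeb flow on $S^3$ "doubly covers" a Hamiltonian flow on a hypersurface $N$ if there is a smooth two-sheeted covering map $S^3\to N$ whose differential sends the Reeb vector field to the Hamiltonian vector field. A Finsler metric is a function on $TS^2$, smooth away from the zero section, positive there, positively homogeneous of degree $1$ on fibres and with fibrewise strictly convex square (positive definite fibrewise Hessian); it need not be reversible. That a Hamiltonian flow is the geodesic flow of a Finsler metric is meant for the flow on the level set in (i): the flow lines project to $S^2$ as precisely the constant-speed parametrised Finsler geodesics. *)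

theory Defs
  imports "HOL-Analysis.Analysis"
begin

text \<open>
  All manifolds are embedded submanifolds of Euclidean spaces and are represented by their
  underlying sets. A vector field on \<open>M\<close> is a function on the ambient space of which only the
  values on \<open>M\<close> matter; a 1-form is a function \<open>\<beta> p v\<close> of which only the values at \<open>p \<in> M\<close>,
  \<open>v \<in> tangent_space M p\<close> matter.
\<close>

subsection \<open>Calculus on submanifolds of Euclidean space\<close>

text \<open>For open \<open>S\<close>: all iterated directional derivatives up to order \<open>k\<close> exist and are continuous.\<close>

primrec Ck_on :: "nat \<Rightarrow> 'a::euclidean_space set \<Rightarrow> ('a \<Rightarrow> 'b::real_normed_vector) \<Rightarrow> bool" where
  "Ck_on 0 S f \<longleftrightarrow> continuous_on S f"
| "Ck_on (Suc k) S f \<longleftrightarrow> (\<forall>x\<in>S. f differentiable at x) \<and>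
     (\<forall>v. Ck_on k S (\<lambda>x. frechet_derivative f (at x) v))"

definition smooth_on :: "'a::euclidean_space set \<Rightarrow> ('a \<Rightarrow> 'b::real_normed_vector) \<Rightarrow> bool" where
  "smooth_on U f \<longleftrightarrow> open U \<and> (\<forall>k. Ck_on k U f)"

definition local_extension ::
  "'a::euclidean_space set \<Rightarrow> ('a \<Rightarrow> 'b::real_normed_vector) \<Rightarrow> 'a \<Rightarrow> ('a \<Rightarrow> 'b) \<Rightarrow> bool" where
  "local_extension M f p g \<longleftrightarrow> (\<exists>U. p \<in> U \<and> smooth_on U g \<and> (\<forall>q\<in>M \<inter> U. g q = f q))"

definition smooth_map :: "'a::euclidean_space set \<Rightarrow> ('a \<Rightarrow> 'b::real_normed_vector) \<Rightarrow> bool" where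
  "smooth_map M f \<longleftrightarrow> (\<forall>p\<in>M. \<exists>g. local_extension M f p g)"

definition tangent_space :: "'a::euclidean_space set \<Rightarrow> 'a \<Rightarrow> 'a set" where
  "tangent_space M p = {v. \<exists>\<gamma> \<delta>. \<delta> > 0 \<and> smooth_on {-\<delta><..<\<delta>} \<gamma> \<and> \<gamma> ` {-\<delta><..<\<delta>} \<subseteq> M \<and>
     \<gamma> (0::real) = p \<and> (\<gamma> has_vector_derivative v) (at 0)}"

text \<open>The differential of a smooth map on \<open>M\<close>. On tangent vectors of \<open>M\<close> the value does not
  depend on the chosen extension.\<close>

definition tdiff ::
  "'a::euclidean_space set \<Rightarrow> ('a \<Rightarrow> 'b::real_normed_vector) \<Rightarrow> 'a \<Rightarrow> 'a \<Rightarrow> 'b" where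
  "tdiff M f p v = frechet_derivative (SOME g. local_extension M f p g) (at p) v"

type_synonym 'a form1 = "'a \<Rightarrow> 'a \<Rightarrow> real"
type_synonym 'a form2 = "'a \<Rightarrow> 'a \<Rightarrow> 'a \<Rightarrow> real"

text \<open>\<open>B\<close> is a vector field on an open neighbourhood of \<open>p\<close> in the ambient space; the ambient
  1-form \<open>v \<mapsto> B q \<bullet> v\<close> restricts to \<open>\<beta>\<close> on \<open>M\<close>.\<close>

definition form_extension ::
  "'a::euclidean_space set \<Rightarrow> 'a form1 \<Rightarrow> 'a \<Rightarrow> ('a \<Rightarrow> 'a) \<Rightarrow> bool" where
  "form_extension M \<beta> p B \<longleftrightarrow> (\<exists>U. p \<in> U \<and> smooth_on U B \<and>
     (\<forall>q\<in>M \<inter> U. \<forall>v\<in>tangent_space M q. \<beta> q v = B q \<bullet> v))"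

definition smooth_form :: "'a::euclidean_space set \<Rightarrow> 'a form1 \<Rightarrow> bool" where
  "smooth_form M \<beta> \<longleftrightarrow> (\<forall>p\<in>M. \<exists>B. form_extension M \<beta> p B)"

text \<open>Smooth dependence of a family of 1-forms on \<open>M\<close> on the parameter in \<open>I\<close>, jointly with the
  point of \<open>M\<close>.\<close>

definition smooth_form_family ::
  "real set \<Rightarrow> 'a::euclidean_space set \<Rightarrow> (real \<Rightarrow> 'a form1) \<Rightarrow> bool" where
  "smooth_form_family I M \<beta> \<longleftrightarrow> (\<forall>z\<in>I \<times> M. \<exists>U B. z \<in> U \<and> smooth_on U B \<and>
     (\<forall>(e, q)\<in>(I \<times> M) \<inter> U. \<forall>v\<in>tangent_space M q. \<beta> e q v = (B (e, q) :: 'a) \<bullet> v))"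

text \<open>Exterior derivative of a 1-form on \<open>M\<close>, computed with an extension to the ambient space. On
  tangent vectors of \<open>M\<close> the value does not depend on the chosen extension.\<close>

definition ext_d :: "'a::euclidean_space set \<Rightarrow> 'a form1 \<Rightarrow> 'a form2" where
  "ext_d M \<beta> p v w = (let B = (SOME B. form_extension M \<beta> p B) in
     frechet_derivative B (at p) v \<bullet> w - frechet_derivative B (at p) w \<bullet> v)"

definition wedge :: "'a form1 \<Rightarrow> 'a form1 \<Rightarrow> 'a form2" where
  "wedge \<beta> \<eta> p v w = \<beta> p v * \<eta> p w - \<beta> p w * \<eta> p v"

definition form1_eq :: "'a::euclidean_space set \<Rightarrow> 'a form1 \<Rightarrow> 'a form1 \<Rightarrow> bool" where
  "form1_eq M \<beta> \<eta> \<longleftrightarrow> (\<forall>p\<in>M. \<forall>v\<in>tangent_space M p. \<beta> p v = \<eta> p v)"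

definition form2_eq :: "'a::euclidean_space set \<Rightarrow> 'a form2 \<Rightarrow> 'a form2 \<Rightarrow> bool" where
  "form2_eq M \<mu> \<nu> \<longleftrightarrow>
     (\<forall>p\<in>M. \<forall>v\<in>tangent_space M p. \<forall>w\<in>tangent_space M p. \<mu> p v w = \<nu> p v w)"

definition pullback ::
  "'a::euclidean_space set \<Rightarrow> ('a \<Rightarrow> 'b::euclidean_space) \<Rightarrow> 'b form1 \<Rightarrow> 'a form1" where
  "pullback M f \<beta> p v = \<beta> (f p) (tdiff M f p v)"

text \<open>For a diffeomorphism \<open>f\<close> of \<open>M\<close>.\<close>

definition pushforward ::
  "'a::euclidean_space set \<Rightarrow> ('a \<Rightarrow> 'a) \<Rightarrow> 'a form1 \<Rightarrow> 'a form1" where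
  "pushforward M f \<beta> = pullback M (inv_into M f) \<beta>"

subsection \<open>Contact forms, Hamiltonian vector fields, flows\<close>

text \<open>Contact forms on a 3-dimensional \<open>M\<close>: the 3-form \<open>\<beta> \<and> d\<beta>\<close>, written out as a cyclic sum,
  vanishes on no basis of a tangent space.\<close>

definition contact_form :: "'a::euclidean_space set \<Rightarrow> 'a form1 \<Rightarrow> bool" where
  "contact_form M \<beta> \<longleftrightarrow> smooth_form M \<beta> \<and>
     (\<forall>p\<in>M. \<forall>u\<in>tangent_space M p. \<forall>v\<in>tangent_space M p. \<forall>w\<in>tangent_space M p.
        u \<noteq> v \<and> v \<noteq> w \<and> u \<noteq> w \<and> independent {u, v, w} \<longrightarrow>
        \<beta> p u * ext_d M \<beta> p v w + \<beta> p v * ext_d M \<beta> p w u + \<beta> p w * ext_d M \<beta> p u v \<noteq> 0)"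

definition reeb_field :: "'a::euclidean_space set \<Rightarrow> 'a form1 \<Rightarrow> 'a \<Rightarrow> 'a" where
  "reeb_field M \<beta> p = (THE r. r \<in> tangent_space M p \<and> \<beta> p r = 1 \<and>
     (\<forall>w\<in>tangent_space M p. ext_d M \<beta> p r w = 0))"

definition ham_field ::
  "'a::euclidean_space set \<Rightarrow> 'a form2 \<Rightarrow> ('a \<Rightarrow> real) \<Rightarrow> 'a \<Rightarrow> 'a" where
  "ham_field M \<omega> G p = (THE x. x \<in> tangent_space M p \<and>
     (\<forall>w\<in>tangent_space M p. \<omega> p x w = - tdiff M G p w))"

definition integral_curve ::
  "'a::euclidean_space set \<Rightarrow> ('a \<Rightarrow> 'a) \<Rightarrow> (real \<Rightarrow> 'a) \<Rightarrow> bool" where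
  "integral_curve M X \<gamma> \<longleftrightarrow> (\<forall>t. \<gamma> t \<in> M \<and> (\<gamma> has_vector_derivative X (\<gamma> t)) (at t))"

definition has_minimal_period :: "(real \<Rightarrow> 'a) \<Rightarrow> real \<Rightarrow> bool" where
  "has_minimal_period \<gamma> T \<longleftrightarrow> T > 0 \<and> (\<forall>t. \<gamma> (t + T) = \<gamma> t) \<and>
     (\<forall>S. 0 < S \<and> S < T \<longrightarrow> \<not> (\<forall>t. \<gamma> (t + S) = \<gamma> t))"

definition periodic_orbits :: "'a::euclidean_space set \<Rightarrow> ('a \<Rightarrow> 'a) \<Rightarrow> 'a set set" where
  "periodic_orbits M X =
     {range \<gamma> | \<gamma>. integral_curve M X \<gamma> \<and> (\<exists>T>0. \<forall>t. \<gamma> (t + T) = \<gamma> t)}"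

definition smooth_double_cover ::
  "'a::euclidean_space set \<Rightarrow> ('a \<Rightarrow> 'b::euclidean_space) \<Rightarrow> 'b set \<Rightarrow> bool" where
  "smooth_double_cover M f N \<longleftrightarrow> covering_space M f N \<and> smooth_map M f \<and>
     (\<forall>p\<in>M. bij_betw (tdiff M f p) (tangent_space M p) (tangent_space N (f p))) \<and>
     (\<forall>z\<in>N. card {p\<in>M. f p = z} = 2)"

definition reeb_flow_doubly_covers ::
  "'a::euclidean_space set \<Rightarrow> 'a form1 \<Rightarrow> 'b::euclidean_space set \<Rightarrow> ('b \<Rightarrow> 'b) \<Rightarrow> bool" where
  "reeb_flow_doubly_covers M \<beta> N X \<longleftrightarrow> (\<exists>f. smooth_double_cover M f N \<and>
     (\<forall>p\<in>M. tdiff M f p (reeb_field M \<beta> p) = X (f p)))"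

subsection \<open>Quaternions and forms on the 3-sphere\<close>

text \<open>A quaternion is the pair of its real and its imaginary part.\<close>

type_synonym quat = "real \<times> (real^3)"

definition qmult :: "quat \<Rightarrow> quat \<Rightarrow> quat" where
  "qmult p q = (fst p * fst q - snd p \<bullet> snd q,
     fst p *\<^sub>R snd q + fst q *\<^sub>R snd p + cross3 (snd p) (snd q))"

definition q_one :: quat where "q_one = (1, 0)"
definition q_i :: quat where "q_i = (0, axis 1 1)"
definition q_j :: quat where "q_j = (0, axis 2 1)"

definition S3 :: "quat set" where "S3 = sphere 0 1"

definition alpha_form :: "quat \<Rightarrow> quat form1" where
  "alpha_form c u u' = - 2 * (u \<bullet> qmult c u')"

text \<open>A parametrisation \<open>q\<close> of a circle of unit quaternions by \<open>\<real>/4\<pi>\<int>\<close>, as a group homomorphism,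
  so that \<open>\<theta> \<mapsto> (u \<mapsto> qmult (q \<theta>) u)\<close> is an action of \<open>\<real>/4\<pi>\<int>\<close> on the 3-sphere.\<close>

definition circle_of_unit_quaternions :: "(real \<Rightarrow> quat) \<Rightarrow> bool" where
  "circle_of_unit_quaternions q \<longleftrightarrow> smooth_on UNIV q \<and> (\<forall>t. norm (q t) = 1) \<and>
     (\<forall>s t. q (s + t) = qmult (q s) (q t)) \<and>
     (\<forall>t. q t = q_one \<longleftrightarrow> (\<exists>n::int. t = 4 * pi * of_int n))"

subsection \<open>The cotangent bundle of the 2-sphere\<close>

type_synonym phase = "(real^3) \<times> (real^3)"

definition S2 :: "(real^3) set" where "S2 = sphere 0 1"

text \<open>The pair \<open>(x, y)\<close> with \<open>x \<bullet> y = 0\<close> stands for the covector \<open>x' \<mapsto> y \<bullet> x'\<close> at \<open>x\<close>; its dual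
  norm is \<open>norm y\<close>.\<close>

definition ST_cot :: "phase set" where
  "ST_cot = {(x, y). norm x = 1 \<and> norm y = 1 \<and> x \<bullet> y = 0}"

definition T_cot_minus_zero :: "phase set" where
  "T_cot_minus_zero = {(x, y). norm x = 1 \<and> x \<bullet> y = 0 \<and> y \<noteq> 0}"

text \<open>The Liouville form: the covector applied to the projection of the tangent vector.\<close>

definition liouville :: "phase form1" where
  "liouville z z' = snd z \<bullet> fst z'"

definition lambda1 :: "phase form1" where
  "lambda1 z z' = snd z \<bullet> fst z'"

definition lambda2 :: "phase form1" where
  "lambda2 z z' = cross3 (fst z) (snd z) \<bullet> fst z'"

definition connection_form :: "phase form1 \<Rightarrow> bool" where
  "connection_form \<alpha> \<longleftrightarrow> smooth_form ST_cot \<alpha> \<and>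
     form2_eq ST_cot (ext_d ST_cot lambda1) (wedge lambda2 \<alpha>) \<and>
     form2_eq ST_cot (ext_d ST_cot lambda2) (wedge \<alpha> lambda1)"

text \<open>The two components of the inverse of \<open>(\<rho>, v) \<mapsto> \<rho> v\<close>.\<close>

definition rho :: "phase \<Rightarrow> real" where "rho z = norm (snd z)"

definition unit_covector :: "phase \<Rightarrow> phase" where
  "unit_covector z = (fst z, snd z /\<^sub>R rho z)"

definition rho_times :: "phase form1 \<Rightarrow> phase form1" where
  "rho_times \<alpha> z z' = rho z * pullback T_cot_minus_zero unit_covector \<alpha> z z'"

definition omega :: "phase form1 \<Rightarrow> real \<Rightarrow> phase form2" where
  "omega \<alpha> \<theta> z v w = sin \<theta> * ext_d T_cot_minus_zero liouville z v w
     + cos \<theta> * ext_d T_cot_minus_zero (rho_times \<alpha>) z v w"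

definition kinetic :: "phase \<Rightarrow> real" where
  "kinetic z = (norm (snd z))\<^sup>2 / 2"

abbreviation X_ham :: "phase form1 \<Rightarrow> real \<Rightarrow> (phase \<Rightarrow> real) \<Rightarrow> phase \<Rightarrow> phase" where
  "X_ham \<alpha> \<theta> \<equiv> ham_field T_cot_minus_zero (omega \<alpha> \<theta>)"

definition level :: "(phase \<Rightarrow> real) \<Rightarrow> real \<Rightarrow> phase set" where
  "level G c = {z\<in>T_cot_minus_zero. G z = c}"

text \<open>A family \<open>G\<close> of functions, smooth in \<open>\<epsilon> \<in> [0, 1)\<close>, perturbing the kinetic Hamiltonian, with
  relevant level \<open>c\<close>.\<close>

definition perturbed_hamiltonian ::
  "phase form1 \<Rightarrow> real \<Rightarrow> (real \<Rightarrow> phase \<Rightarrow> real) \<Rightarrow> real \<Rightarrow> bool" where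
  "perturbed_hamiltonian \<alpha> \<theta> G c \<longleftrightarrow>
     smooth_map ({0..<1} \<times> T_cot_minus_zero) (\<lambda>(e, z). G e z) \<and>
     level (G 0) c = ST_cot \<and>
     (\<forall>z\<in>ST_cot. X_ham \<alpha> \<theta> (G 0) z = X_ham \<alpha> \<theta> kinetic z)"

subsection \<open>Finsler metrics on the 2-sphere\<close>

definition TS2 :: "((real^3) \<times> (real^3)) set" where
  "TS2 = {(x, v). norm x = 1 \<and> x \<bullet> v = 0}"

text \<open>The last clause is positive definiteness of the fibrewise Hessian of \<open>F\<^sup>2\<close>, as a quadratic
  form in \<open>w\<close>.\<close>

definition finsler_metric :: "((real^3) \<times> (real^3) \<Rightarrow> real) \<Rightarrow> bool" where
  "finsler_metric F \<longleftrightarrow>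
     smooth_map {(x, v)\<in>TS2. v \<noteq> 0} F \<and>
     (\<forall>(x, v)\<in>TS2. v \<noteq> 0 \<longrightarrow> F (x, v) > 0) \<and>
     (\<forall>(x, v)\<in>TS2. \<forall>t>0. F (x, t *\<^sub>R v) = t * F (x, v)) \<and>
     (\<forall>x v w. (x, v) \<in> TS2 \<and> (x, w) \<in> TS2 \<and> v \<noteq> 0 \<and> w \<noteq> 0 \<longrightarrow>
        deriv (deriv (\<lambda>t. (F (x, v + t *\<^sub>R w))\<^sup>2)) 0 > 0)"

definition finsler_length ::
  "((real^3) \<times> (real^3) \<Rightarrow> real) \<Rightarrow> real \<Rightarrow> real \<Rightarrow> (real \<Rightarrow> real^3) \<Rightarrow> real" where
  "finsler_length F a b \<gamma> = integral {a..b} (\<lambda>t. F (\<gamma> t, vector_derivative \<gamma> (at t)))"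

text \<open>Geodesics parametrised with constant speed \<open>c > 0\<close>: every segment is a critical point of the
  length functional under smooth variations with fixed end points.\<close>

definition finsler_geodesic ::
  "((real^3) \<times> (real^3) \<Rightarrow> real) \<Rightarrow> real \<Rightarrow> (real \<Rightarrow> real^3) \<Rightarrow> bool" where
  "finsler_geodesic F c \<gamma> \<longleftrightarrow> c > 0 \<and> smooth_on UNIV \<gamma> \<and> range \<gamma> \<subseteq> S2 \<and>
     (\<forall>t. F (\<gamma> t, vector_derivative \<gamma> (at t)) = c) \<and>
     (\<forall>a b \<delta> \<Gamma>. a < b \<and> \<delta> > 0 \<and> smooth_on ({-\<delta><..<\<delta>} \<times> UNIV) \<Gamma> \<and>
        \<Gamma> ` ({-\<delta><..<\<delta>} \<times> UNIV) \<subseteq> S2 \<and> (\<forall>t. \<Gamma> (0, t) = \<gamma> t) \<and>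
        (\<forall>s\<in>{-\<delta><..<\<delta>}. \<Gamma> (s, a) = \<gamma> a \<and> \<Gamma> (s, b) = \<gamma> b) \<longrightarrow>
        ((\<lambda>s::real. finsler_length F a b (\<lambda>t. \<Gamma> (s, t))) has_real_derivative 0) (at 0))"

text \<open>The flow lines on \<open>N\<close> project to precisely the Finsler geodesics of one constant speed.\<close>

definition is_finsler_geodesic_flow :: "phase set \<Rightarrow> (phase \<Rightarrow> phase) \<Rightarrow> bool" where
  "is_finsler_geodesic_flow N X \<longleftrightarrow> (\<exists>F c. finsler_metric F \<and> c > 0 \<and>
     {fst \<circ> \<zeta> | \<zeta>. integral_curve N X \<zeta>} = {\<gamma>. finsler_geodesic F c \<gamma>})"

end

theory Submission
  imports Defs
begin

text \<open>
  On the unit quaternions the field \<open>u \<mapsto> c u / 2\<close>, for a unit imaginary \<open>c\<close>, is the Reeb field of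
  \<open>alpha_form c\<close>, and left multiplication by \<open>q\<close> turns \<open>c\<close> into the conjugate of \<open>c\<close> by \<open>q\<close>. The unit
  quaternions \<open>cos (\<theta>/2) + sin (\<theta>/2) k\<close> therefore rotate \<open>i\<close> into \<open>c = cos \<theta> i + sin \<theta> j\<close>
  (\<open>axis_at\<close>), which is the family of contact forms in the theorem. A unit quaternion \<open>u\<close> also acts on
  imaginary quaternions by \<open>a \<mapsto> rot u a\<close>; the images \<open>x, m, y\<close> of \<open>i, j, k\<close> form a positive
  orthonormal frame, and \<open>u \<mapsto> (x, y)\<close> is a double cover of the unit cotangent bundle. Moving \<open>u\<close>
  along \<open>i u / 2\<close> rotates the frame about \<open>x\<close>, which is the flow in the fibre generated by the
  connection form, while moving along \<open>j u / 2\<close> is the geodesic flow. One map thus handles all \<open>\<theta>\<close>.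

  The deformation comes from the commuting circle action by right multiplication. The field
  \<open>(c u + \<epsilon> u i) / 2\<close> (\<open>tilted_reeb\<close>) preserves \<open>alpha_form c\<close>, so it becomes the Reeb field after
  dividing this form by its value \<open>tilt\<close> on the field (\<open>tilted_reeb_field\<close>). Right multiplication
  by \<open>i\<close> turns into the rotation of the 2-sphere about a fixed axis. Rescaling the covector by
  \<open>1 / tilt\<close> turns the double cover into one of a level set of \<open>katok_ham\<close>, half the square of
  a function that is homogeneous of degree 1, namely the norm plus \<open>\<epsilon>\<close> times the Hamiltonian of
  this rotation. On the level set its Hamiltonian field is \<open>katok_field\<close> for every \<open>\<theta>\<close> (\<open>ham_field_katok\<close>), and the cover maps
  Reeb field to Hamiltonian field (\<open>tilted_reeb_flow_doubly_covers\<close>).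

  All flow lines are images of the explicit curves \<open>exp (c t/2) u exp (\<epsilon> i t/2)\<close>. Such an image closes up
  after time \<open>T\<close> if and only if \<open>exp (n T/2) = \<plusminus> exp (- \<epsilon> i T/2)\<close> where \<open>n = rot u c\<close>. For irrational \<open>\<epsilon>\<close>
  the sines do not vanish, hence \<open>n = \<plusminus> i\<close>, and each of the two signs gives exactly one orbit
  (\<open>two_periodic_orbits\<close>).

  For \<open>cos \<theta> = 0\<close> the homogeneous function is dual, up to the sign \<open>sin \<theta>\<close> of the covector, to the
  Finsler metric that solves Zermelo's navigation problem for the wind \<open>\<epsilon> x \<times> i\<close>, Katok's metric:
  unit vectors are those that differ from the wind by a vector of length 1. Implicit differentiation of this characterisation gives the
  first variation of length (\<open>first_variation\<close>). Its vanishing forces the factor between momentum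
  and velocity relative to the wind to be constant, and what remains is the equation of the flow lines
  (\<open>geodesic_navigation_pair\<close>, \<open>flow_lines_navigation_pairs\<close>).

  The notions of differential and exterior derivative in the statement choose arbitrary
  extensions to the ambient space. The differential is computed along curves; the exterior derivative
  is independent of the extension because fields normal to a level set are combinations of gradients
  (\<open>ext_d_eq\<close>).
\<close>

section \<open>Smooth functions on open sets\<close>

lemma frechet_derivative_at_eq: "(f has_derivative f') (at x) \<Longrightarrow> frechet_derivative f (at x) = f'"
  by (rule frechet_derivative_at[symmetric])

lemma Ck_on_SucD:
  assumes "Ck_on (Suc k) S f"
  shows "x \<in> S \<Longrightarrow> f differentiable (at x)"
    and "Ck_on k S (\<lambda>x. frechet_derivative f (at x) v)"
    and "x \<in> S \<Longrightarrow> (f has_derivative frechet_derivative f (at x)) (at x)"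
  using assms unfolding Ck_on.simps frechet_derivative_works by blast+

declare Ck_on.simps(2) [simp del]

lemma Ck_on_cong:
  assumes "open S" and "Ck_on k S h" and "\<And>x. x \<in> S \<Longrightarrow> g x = h x"
  shows "Ck_on k S g"
  using assms(2,3)
proof (induction k arbitrary: g h)
  case 0
  then show ?case using continuous_on_cong[of S S g h] by simp
next
  case (Suc k)
  have h: "(h has_derivative frechet_derivative h (at x)) (at x)" if "x \<in> S" for x
    using Suc.prems(1) that by (rule Ck_on_SucD)
  have g: "(g has_derivative frechet_derivative h (at x)) (at x)" if "x \<in> S" for x
    using has_derivative_transform_within_open[OF h[OF that] \<open>open S\<close> that] Suc.prems(2) by simp
  have eq: "frechet_derivative g (at x) v = frechet_derivative h (at x) v" if "x \<in> S" for x v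
    using frechet_derivative_at[OF g[OF that]] by simp
  have "Ck_on k S (\<lambda>x. frechet_derivative g (at x) v)" for v
    by (rule Suc.IH[OF Ck_on_SucD(2)[OF Suc.prems(1), of v] eq])
  moreover have "g differentiable (at x)" if "x \<in> S" for x
    using g[OF that] unfolding differentiable_def by blast
  ultimately show ?case unfolding Ck_on.simps by blast
qed

lemma Ck_on_SucI:
  assumes "\<And>x. x \<in> S \<Longrightarrow> (f has_derivative f' x) (at x)"
    and "\<And>v. Ck_on k S (\<lambda>x. f' x v)" and "open S"
  shows "Ck_on (Suc k) S f"
proof -
  have eq: "frechet_derivative f (at x) v = f' x v" if "x \<in> S" for x v
    using frechet_derivative_at[OF assms(1)[OF that]] by simp
  have "Ck_on k S (\<lambda>x. frechet_derivative f (at x) v)" for v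
    by (rule Ck_on_cong[OF assms(3) assms(2)[of v] eq])
  moreover have "f differentiable (at x)" if "x \<in> S" for x
    using assms(1)[OF that] unfolding differentiable_def by blast
  ultimately show ?thesis unfolding Ck_on.simps by blast
qed

lemma Ck_on_Suc_imp: "Ck_on (Suc k) S f \<Longrightarrow> Ck_on k S f"
proof (induction k arbitrary: f)
  case 0
  then show ?case
    by (auto intro!: continuous_at_imp_continuous_on differentiable_imp_continuous_within
        dest: Ck_on_SucD(1))
next
  case (Suc k)
  have "Ck_on k S (\<lambda>x. frechet_derivative f (at x) v)" for v
    by (rule Suc.IH[OF Ck_on_SucD(2)[OF Suc.prems]])
  moreover have "\<forall>x\<in>S. f differentiable (at x)"
    using Ck_on_SucD(1)[OF Suc.prems] by blast
  ultimately show ?case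
    unfolding Ck_on.simps by blast
qed

lemma Ck_on_subset: "Ck_on k S f \<Longrightarrow> T \<subseteq> S \<Longrightarrow> Ck_on k T f"
proof (induction k arbitrary: f)
  case (Suc k)
  have "Ck_on k T (\<lambda>x. frechet_derivative f (at x) v)" for v
    by (rule Suc.IH[OF Ck_on_SucD(2)[OF Suc.prems(1)] Suc.prems(2)])
  moreover have "\<forall>x\<in>T. f differentiable (at x)"
    using Ck_on_SucD(1)[OF Suc.prems(1)] Suc.prems(2) by blast
  ultimately show ?case
    unfolding Ck_on.simps by blast
qed (auto intro: continuous_on_subset)

lemma Ck_on_const: "open S \<Longrightarrow> Ck_on k S (\<lambda>x. c)"
proof (induction k arbitrary: c)
  case (Suc k)
  then show ?case by (intro Ck_on_SucI[where f' = "\<lambda>x v. 0"]) auto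
qed auto

lemma Ck_on_linear: "open S \<Longrightarrow> bounded_linear f \<Longrightarrow> Ck_on k S f"
proof (cases k)
  case (Suc n)
  assume "open S" "bounded_linear f"
  then show ?thesis unfolding Suc
    by (intro Ck_on_SucI[where f' = "\<lambda>x. f"])
      (auto intro: Ck_on_const bounded_linear_imp_has_derivative)
qed (auto intro: linear_continuous_on)

lemma Ck_on_add:
  assumes "open S"
  shows "Ck_on k S f \<Longrightarrow> Ck_on k S g \<Longrightarrow> Ck_on k S (\<lambda>x. f x + g x)"
proof (induction k arbitrary: f g)
  case (Suc k)
  show ?case
  proof (rule Ck_on_SucI[OF _ _ assms])
    show "((\<lambda>x. f x + g x) has_derivative
        (\<lambda>v. frechet_derivative f (at x) v + frechet_derivative g (at x) v)) (at x)" if "x \<in> S" for x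
      using that Suc.prems by (intro has_derivative_add Ck_on_SucD(3))
    show "Ck_on k S (\<lambda>x. frechet_derivative f (at x) v + frechet_derivative g (at x) v)" for v
      using Suc.prems by (intro Suc.IH Ck_on_SucD(2))
  qed
qed (auto intro: continuous_intros)

lemma Ck_on_bilinear:
  assumes "open S" and "bounded_bilinear h"
  shows "Ck_on k S f \<Longrightarrow> Ck_on k S g \<Longrightarrow> Ck_on k S (\<lambda>x. h (f x) (g x))"
proof (induction k arbitrary: f g)
  case 0
  then show ?case by (simp add: bounded_bilinear.continuous_on[OF assms(2)])
next
  case (Suc k)
  show ?case
  proof (rule Ck_on_SucI[OF _ _ assms(1)])
    show "((\<lambda>x. h (f x) (g x)) has_derivative (\<lambda>v. h (f x) (frechet_derivative g (at x) v) +
        h (frechet_derivative f (at x) v) (g x))) (at x)" if "x \<in> S" for x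
      using that Suc.prems by (intro bounded_bilinear.FDERIV[OF assms(2)] Ck_on_SucD(3))
    show "Ck_on k S (\<lambda>x. h (f x) (frechet_derivative g (at x) v) +
        h (frechet_derivative f (at x) v) (g x))" for v
      by (rule Ck_on_add[OF assms(1)
            Suc.IH[OF Ck_on_Suc_imp[OF Suc.prems(1)] Ck_on_SucD(2)[OF Suc.prems(2)]]
            Suc.IH[OF Ck_on_SucD(2)[OF Suc.prems(1)] Ck_on_Suc_imp[OF Suc.prems(2)]]])
  qed
qed

lemma Ck_on_sum:
  "open S \<Longrightarrow> (\<And>i. i \<in> A \<Longrightarrow> Ck_on k S (f i)) \<Longrightarrow> Ck_on k S (\<lambda>x. \<Sum>i\<in>A. f i x)"
  by (induction A rule: infinite_finite_induct) (auto intro: Ck_on_const Ck_on_add)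

text \<open>The directional derivatives of a composition are expanded in the standard basis of the middle
  space, so that they become finite sums of products to which the induction hypothesis applies.\<close>

lemma Ck_on_compose:
  fixes f :: "'a::euclidean_space \<Rightarrow> 'b::euclidean_space" and g :: "'b \<Rightarrow> 'c::real_normed_vector"
  assumes S: "open S" and T: "open T" and "f ` S \<subseteq> T"
  shows "Ck_on k S f \<Longrightarrow> Ck_on k T g \<Longrightarrow> Ck_on k S (\<lambda>x. g (f x))"
  using assms(3)
proof (induction k arbitrary: f g)
  case 0
  then show ?case by (auto intro: continuous_on_compose2)
next
  case (Suc k)
  let ?f' = "\<lambda>x. frechet_derivative f (at x)" and ?g' = "\<lambda>x. frechet_derivative g (at x)"
  have df: "(f has_derivative ?f' x) (at x)" if "x \<in> S" for x
    using Suc.prems(1) that by (rule Ck_on_SucD(3))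
  have dg: "(g has_derivative ?g' (f x)) (at (f x))" if "x \<in> S" for x
    using Ck_on_SucD(3)[OF Suc.prems(2)] Suc.prems(3) that by blast
  have "(\<lambda>x. g (f x)) = g \<circ> f" by auto
  then have d: "((\<lambda>x. g (f x)) has_derivative (\<lambda>v. ?g' (f x) (?f' x v))) (at x)" if "x \<in> S" for x
    using diff_chain_at[OF df[OF that] dg[OF that]] by (simp add: o_def)
  have exp: "?g' (f x) (?f' x v) = (\<Sum>b\<in>Basis. (?f' x v \<bullet> b) *\<^sub>R ?g' (f x) b)" if "x \<in> S" for x v
  proof -
    have "?g' (f x) (?f' x v) = ?g' (f x) (\<Sum>b\<in>Basis. (?f' x v \<bullet> b) *\<^sub>R b)"
      by (simp add: euclidean_representation)
    also have "\<dots> = (\<Sum>b\<in>Basis. (?f' x v \<bullet> b) *\<^sub>R ?g' (f x) b)"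
      using has_derivative_bounded_linear[OF dg[OF that], THEN bounded_linear.linear]
      by (simp add: linear_sum linear_scale)
    finally show ?thesis .
  qed
  have "Ck_on k S (\<lambda>x. \<Sum>b\<in>Basis. (?f' x v \<bullet> b) *\<^sub>R ?g' (f x) b)" for v
  proof (intro Ck_on_sum S Ck_on_bilinear[OF S bounded_bilinear_scaleR]
      Ck_on_bilinear[OF S bounded_bilinear_inner] Ck_on_const)
    show "Ck_on k S (\<lambda>x. ?f' x v)"
      using Suc.prems(1) by (rule Ck_on_SucD)
    show "Ck_on k S (\<lambda>x. ?g' (f x) b)" for b
      by (rule Suc.IH[OF Ck_on_Suc_imp[OF Suc.prems(1)] Ck_on_SucD(2)[OF Suc.prems(2)] Suc.prems(3)])
  qed
  then have "Ck_on k S (\<lambda>x. ?g' (f x) (?f' x v))" for v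
    by (rule Ck_on_cong[OF S, of _ "\<lambda>x. \<Sum>b\<in>Basis. (?f' x v \<bullet> b) *\<^sub>R ?g' (f x) b"])
      (simp_all add: exp)
  from Ck_on_SucI[OF d this S] show ?case .
qed

lemma smooth_onI: "open U \<Longrightarrow> (\<And>k. Ck_on k U f) \<Longrightarrow> smooth_on U f"
  by (simp add: smooth_on_def)

lemma smooth_on_open: "smooth_on U f \<Longrightarrow> open U"
  and smooth_on_Ck: "smooth_on U f \<Longrightarrow> Ck_on k U f"
  by (simp_all add: smooth_on_def)

named_theorems smooth_intros

lemma smooth_on_const [smooth_intros]: "open U \<Longrightarrow> smooth_on U (\<lambda>x. c)"
  and smooth_on_linear: "open U \<Longrightarrow> bounded_linear f \<Longrightarrow> smooth_on U f"
  and smooth_on_add [smooth_intros]: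
    "smooth_on U f \<Longrightarrow> smooth_on U g \<Longrightarrow> smooth_on U (\<lambda>x. f x + g x)"
  and smooth_on_subset: "smooth_on U f \<Longrightarrow> open V \<Longrightarrow> V \<subseteq> U \<Longrightarrow> smooth_on V f"
  by (auto simp: smooth_on_def intro: Ck_on_const Ck_on_linear Ck_on_add
      Ck_on_subset)

lemma smooth_on_bilinear:
  assumes "bounded_bilinear h" "smooth_on U f" "smooth_on U g"
  shows "smooth_on U (\<lambda>x. h (f x) (g x))"
  by (rule smooth_onI[OF smooth_on_open[OF assms(2)]
        Ck_on_bilinear[OF smooth_on_open[OF assms(2)] assms(1) smooth_on_Ck[OF assms(2)] smooth_on_Ck[OF assms(3)]]])

lemma smooth_on_compose:
  fixes f :: "'a::euclidean_space \<Rightarrow> 'b::euclidean_space" and g :: "'b \<Rightarrow> 'c::real_normed_vector"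
  assumes "smooth_on T g" "smooth_on S f" "\<And>x. x \<in> S \<Longrightarrow> f x \<in> T"
  shows "smooth_on S (\<lambda>x. g (f x))"
  by (intro smooth_onI Ck_on_compose[OF smooth_on_open[OF assms(2)] smooth_on_open[OF assms(1)]
        _ smooth_on_Ck[OF assms(2)] smooth_on_Ck[OF assms(1)]] smooth_on_open[OF assms(2)])
    (use assms(3) in blast)

lemma smooth_on_compose_linear:
  fixes f :: "'a::euclidean_space \<Rightarrow> 'b::euclidean_space" and g :: "'b \<Rightarrow> 'c::real_normed_vector"
  shows "bounded_linear g \<Longrightarrow> smooth_on S f \<Longrightarrow> smooth_on S (\<lambda>x. g (f x))"
  by (rule smooth_on_compose[OF smooth_on_linear[OF open_UNIV]]) simp_all

lemma smooth_on_has_derivative: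
  "smooth_on U f \<Longrightarrow> x \<in> U \<Longrightarrow> (f has_derivative frechet_derivative f (at x)) (at x)"
  by (rule Ck_on_SucD(3)[OF smooth_on_Ck])

lemma smooth_on_imp_continuous_on: "smooth_on U f \<Longrightarrow> continuous_on U f"
  using smooth_on_Ck[of U f 0] by simp

lemma smooth_on_frechet_derivative:
  assumes "smooth_on U f" shows "smooth_on U (\<lambda>x. frechet_derivative f (at x) v)"
  by (intro smooth_onI smooth_on_open[OF assms] Ck_on_SucD(2) smooth_on_Ck[OF assms])

lemma smooth_on_id [smooth_intros]: "open U \<Longrightarrow> smooth_on U (\<lambda>x. x)"
  by (rule smooth_on_linear[OF _ bounded_linear_ident])

lemma smooth_on_minus [smooth_intros]:
  fixes f :: "'a::euclidean_space \<Rightarrow> 'b::euclidean_space"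
  shows "smooth_on U f \<Longrightarrow> smooth_on U (\<lambda>x. - f x)"
  by (rule smooth_on_compose_linear[OF bounded_linear_minus[OF bounded_linear_ident]])

lemma smooth_on_diff [smooth_intros]:
  fixes f :: "'a::euclidean_space \<Rightarrow> 'b::euclidean_space"
  shows "smooth_on U f \<Longrightarrow> smooth_on U g \<Longrightarrow> smooth_on U (\<lambda>x. f x - g x)"
  using smooth_on_add[OF _ smooth_on_minus, of U f g] by simp

lemma smooth_on_fst [smooth_intros]:
  fixes f :: "'a::euclidean_space \<Rightarrow> 'b::euclidean_space \<times> 'c::euclidean_space"
  shows "smooth_on U f \<Longrightarrow> smooth_on U (\<lambda>x. fst (f x))"
  by (rule smooth_on_compose_linear[OF bounded_linear_fst])

lemma smooth_on_snd [smooth_intros]: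
  fixes f :: "'a::euclidean_space \<Rightarrow> 'b::euclidean_space \<times> 'c::euclidean_space"
  shows "smooth_on U f \<Longrightarrow> smooth_on U (\<lambda>x. snd (f x))"
  by (rule smooth_on_compose_linear[OF bounded_linear_snd])

lemma smooth_on_Pair [smooth_intros]:
  fixes f :: "'a::euclidean_space \<Rightarrow> 'b::euclidean_space" and g :: "'a \<Rightarrow> 'c::euclidean_space"
  assumes "smooth_on U f" "smooth_on U g"
  shows "smooth_on U (\<lambda>x. (f x, g x))"
proof -
  have "smooth_on U (\<lambda>x. (f x, 0::'c))"
    by (rule smooth_on_compose_linear[OF _ assms(1), of "\<lambda>y. (y, 0)"])
      (intro bounded_linear_Pair bounded_linear_ident bounded_linear_zero)
  moreover have "smooth_on U (\<lambda>x. (0::'b, g x))"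
    by (rule smooth_on_compose_linear[OF _ assms(2), of "\<lambda>y. (0, y)"])
      (intro bounded_linear_Pair bounded_linear_ident bounded_linear_zero)
  ultimately show ?thesis
    using smooth_on_add by fastforce
qed

lemmas smooth_on_mult [smooth_intros] =
    smooth_on_bilinear[OF bounded_bilinear_mult]
  and smooth_on_scaleR [smooth_intros] = smooth_on_bilinear[OF bounded_bilinear_scaleR]
  and smooth_on_inner [smooth_intros] = smooth_on_bilinear[OF bounded_bilinear_inner]

lemma bounded_bilinear_cross3: "bounded_bilinear cross3"
  using bilinear_cross by (simp add: bilinear_conv_bounded_bilinear)

lemmas smooth_on_cross3 [smooth_intros] = smooth_on_bilinear[OF bounded_bilinear_cross3]

lemma smooth_on_power [smooth_intros]:
  fixes f :: "'a::euclidean_space \<Rightarrow> real"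
  shows "smooth_on U f \<Longrightarrow> smooth_on U (\<lambda>x. f x ^ n)"
  by (induction n) (auto intro!: smooth_intros dest: smooth_on_open)

text \<open>The derivative of the reciprocal is a polynomial in the reciprocal, which makes the induction
  work.\<close>

lemma Ck_on_inverse: "Ck_on k (- {0}) (inverse :: real \<Rightarrow> real)"
proof (induction k)
  case (Suc k)
  have op: "open (- {0::real})" by auto
  show ?case
  proof (rule Ck_on_SucI[OF _ _ op])
    show "(inverse has_derivative (\<lambda>v. - v * inverse x * inverse x)) (at x)"
      if "x \<in> - {0}" for x :: real
      using that by (auto intro!: derivative_eq_intros)
    show "Ck_on k (- {0}) (\<lambda>x::real. - v * inverse x * inverse x)" for v
      by (rule Ck_on_bilinear[OF op bounded_bilinear_mult
            Ck_on_bilinear[OF op bounded_bilinear_mult Ck_on_const[OF op] Suc] Suc])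
  qed
qed (auto intro!: continuous_intros)

lemma smooth_on_inverse [smooth_intros]:
  fixes f :: "'a::euclidean_space \<Rightarrow> real"
  assumes "smooth_on U f" "\<And>x. x \<in> U \<Longrightarrow> f x \<noteq> 0"
  shows "smooth_on U (\<lambda>x. inverse (f x))"
  by (rule smooth_on_compose[OF smooth_onI[OF _ Ck_on_inverse] assms(1)]) (use assms(2) in auto)

lemma smooth_on_divide [smooth_intros]:
  fixes f g :: "'a::euclidean_space \<Rightarrow> real"
  assumes "smooth_on U f" "smooth_on U g" "\<And>x. x \<in> U \<Longrightarrow> g x \<noteq> 0"
  shows "smooth_on U (\<lambda>x. f x / g x)"
  using assms unfolding divide_inverse by (intro smooth_intros) auto

lemma Ck_on_sqrt: "Ck_on k {0<..} sqrt"
proof (induction k)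
  case (Suc k)
  have op: "open {0::real<..}" by auto
  show ?case
  proof (rule Ck_on_SucI[OF _ _ op])
    show "(sqrt has_derivative (\<lambda>v. v / 2 * inverse (sqrt x))) (at x)" if "x \<in> {0<..}" for x :: real
      using that by (auto intro!: derivative_eq_intros simp: field_simps)
    have "Ck_on k {0<..} (\<lambda>x::real. inverse (sqrt x))"
      by (rule Ck_on_compose[OF op _ _ Suc Ck_on_inverse]) auto
    then show "Ck_on k {0<..} (\<lambda>x::real. v / 2 * inverse (sqrt x))" for v
      by (rule Ck_on_bilinear[OF op bounded_bilinear_mult Ck_on_const[OF op]])
  qed
qed (auto intro!: continuous_intros)

lemma smooth_on_sqrt [smooth_intros]:
  fixes f :: "'a::euclidean_space \<Rightarrow> real"
  assumes "smooth_on U f" "\<And>x. x \<in> U \<Longrightarrow> f x > 0"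
  shows "smooth_on U (\<lambda>x. sqrt (f x))"
  by (rule smooth_on_compose[OF smooth_onI[OF _ Ck_on_sqrt] assms(1)]) (use assms(2) in auto)

lemma smooth_on_norm [smooth_intros]:
  fixes f :: "'a::euclidean_space \<Rightarrow> 'b::euclidean_space"
  assumes "smooth_on U f" "\<And>x. x \<in> U \<Longrightarrow> f x \<noteq> 0"
  shows "smooth_on U (\<lambda>x. norm (f x))"
  using assms unfolding norm_eq_sqrt_inner by (intro smooth_intros) auto

text \<open>Each derivative of a solution is a linear image of the solution. This gives the smoothness
  of the circle of quaternions and of the geodesics.\<close>

lemma smooth_on_linear_ode:
  fixes \<gamma> :: "real \<Rightarrow> 'a::euclidean_space"
  assumes A: "bounded_linear A" and \<gamma>: "\<And>t. (\<gamma> has_vector_derivative A (\<gamma> t)) (at t)"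
  shows "smooth_on UNIV \<gamma>"
proof (rule smooth_onI)
  show "Ck_on k UNIV \<gamma>" for k
  proof (induction k)
    case 0
    then show ?case
      using \<gamma> by (auto intro!: continuous_at_imp_continuous_on has_vector_derivative_continuous)
  next
    case (Suc k)
    show ?case
    proof (rule Ck_on_SucI[OF _ _ open_UNIV])
      show "(\<gamma> has_derivative (\<lambda>h. h *\<^sub>R A (\<gamma> t))) (at t)" for t
        using \<gamma> by (simp add: has_vector_derivative_def)
      have "Ck_on k UNIV (\<lambda>t. A (\<gamma> t))"
        by (rule Ck_on_compose[OF open_UNIV open_UNIV _ Suc Ck_on_linear[OF open_UNIV A]]) simp
      then show "Ck_on k UNIV (\<lambda>t. h *\<^sub>R A (\<gamma> t))" for h
        by (rule Ck_on_bilinear[OF open_UNIV bounded_bilinear_scaleR Ck_on_const[OF open_UNIV]])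
    qed
  qed
qed auto

text \<open>The difference of two solutions has constant norm.\<close>

lemma skew_linear_ode_unique:
  fixes \<gamma> \<eta> :: "real \<Rightarrow> 'a::real_inner"
  assumes lin: "linear A" and skew: "\<And>v. v \<bullet> A v = 0"
    and \<gamma>: "\<And>t. (\<gamma> has_vector_derivative A (\<gamma> t)) (at t)"
    and \<eta>: "\<And>t. (\<eta> has_vector_derivative A (\<eta> t)) (at t)"
    and "\<gamma> 0 = \<eta> 0"
  shows "\<gamma> t = \<eta> t"
proof -
  define \<delta> where "\<delta> t = \<gamma> t - \<eta> t" for t
  have "(\<delta> has_vector_derivative A (\<delta> t)) (at t)" for t
    using has_vector_derivative_diff[OF \<gamma> \<eta>] linear_diff[OF lin] unfolding \<delta>_def by metis
  then have "((\<lambda>t. \<delta> t \<bullet> \<delta> t) has_real_derivative 0) (at t)" for t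
    by (auto simp: has_real_derivative_iff_has_vector_derivative has_vector_derivative_def
        intro!: derivative_eq_intros) (auto simp: skew inner_commute fun_eq_iff)
  then have "\<delta> t \<bullet> \<delta> t = \<delta> 0 \<bullet> \<delta> 0"
    by (rule DERIV_isconst_all[rule_format, of "\<lambda>t. \<delta> t \<bullet> \<delta> t"])
  then show ?thesis
    using \<open>\<gamma> 0 = \<eta> 0\<close> by (simp add: \<delta>_def)
qed

section \<open>Calculus on submanifolds\<close>

lemma tangent_spaceI:
  fixes \<gamma> :: "real \<Rightarrow> 'a::euclidean_space"
  assumes "smooth_on S \<gamma>" "0 \<in> S" "\<And>t. t \<in> S \<Longrightarrow> \<gamma> t \<in> M" "\<gamma> 0 = p"
    and "(\<gamma> has_vector_derivative v) (at 0)"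
  shows "v \<in> tangent_space M p"
proof -
  obtain \<delta> where "\<delta> > 0" and \<delta>: "ball 0 \<delta> \<subseteq> S"
    using smooth_on_open[OF assms(1)] assms(2) open_contains_ball by blast
  have b: "{-\<delta><..<\<delta>} = ball 0 \<delta>"
    by (auto simp: ball_def dist_real_def)
  then have "smooth_on {-\<delta><..<\<delta>} \<gamma>" "\<gamma> ` {-\<delta><..<\<delta>} \<subseteq> M"
    using smooth_on_subset[OF assms(1) _ \<delta>] assms(3) \<delta> by auto
  then show ?thesis
    unfolding tangent_space_def using \<open>\<delta> > 0\<close> assms(4,5) by blast
qed

lemma tangent_spaceE:
  assumes "v \<in> tangent_space M p"
  obtains S \<gamma> where "smooth_on S \<gamma>" "0 \<in> S" "\<And>t. t \<in> S \<Longrightarrow> \<gamma> t \<in> M" "\<gamma> 0 = p"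
    "(\<gamma> has_vector_derivative v) (at (0::real))"
proof -
  obtain \<gamma> \<delta> where "\<delta> > 0" "smooth_on {-\<delta><..<\<delta>} \<gamma>" "\<gamma> ` {-\<delta><..<\<delta>} \<subseteq> M"
    "\<gamma> (0::real) = p" "(\<gamma> has_vector_derivative v) (at 0)"
    using assms unfolding tangent_space_def by blast
  then show ?thesis
    by (intro that[of "{-\<delta><..<\<delta>}" \<gamma>]) auto
qed

lemma tangent_space_base: "v \<in> tangent_space M p \<Longrightarrow> p \<in> M"
  by (elim tangent_spaceE) auto

lemma tangent_space_open:
  assumes "open U" "p \<in> U" shows "v \<in> tangent_space U p"
proof (rule tangent_spaceI)
  let ?S = "(\<lambda>t. p + t *\<^sub>R v) -` U"
  have "open ?S"
    by (rule open_vimage[OF assms(1)]) (intro continuous_intros)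
  then show "smooth_on ?S (\<lambda>t. p + t *\<^sub>R v)"
    by (intro smooth_intros)
  show "((\<lambda>t. p + t *\<^sub>R v) has_vector_derivative v) (at 0)"
    by (auto intro!: derivative_eq_intros)
qed (use assms in auto)

lemma curve_compose_derivative:
  assumes "(\<gamma> has_vector_derivative v) (at t)" "(g has_derivative D) (at (\<gamma> t))"
  shows "((\<lambda>s. g (\<gamma> s)) has_vector_derivative D v) (at t)"
proof -
  have "((\<lambda>s. g (\<gamma> s)) has_derivative (\<lambda>h. D (h *\<^sub>R v))) (at t)"
    using diff_chain_at[OF assms(1)[unfolded has_vector_derivative_def] assms(2)] by (simp add: o_def)
  then show ?thesis
    using linear_scale[OF has_derivative_linear[OF assms(2)]] by (simp add: has_vector_derivative_def)
qed

text \<open>A smooth map carries the curves that define tangent vectors to such curves. Applied to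
  retractions onto \<open>N\<close> this also produces tangent vectors.\<close>

lemma smooth_map_tangent:
  fixes g :: "'a::euclidean_space \<Rightarrow> 'b::euclidean_space"
  assumes "smooth_on U g" "p \<in> U" "\<And>q. q \<in> M \<Longrightarrow> q \<in> U \<Longrightarrow> g q \<in> N"
    and D: "(g has_derivative D) (at p)" and "v \<in> tangent_space M p"
  shows "D v \<in> tangent_space N (g p)"
proof -
  obtain S \<gamma> where \<gamma>: "smooth_on S \<gamma>" "0 \<in> S" "\<And>t. t \<in> S \<Longrightarrow> \<gamma> t \<in> M" "\<gamma> 0 = p"
    "(\<gamma> has_vector_derivative v) (at (0::real))"
    using assms(5) by (rule tangent_spaceE) blast
  let ?S = "S \<inter> \<gamma> -` U"
  have op: "open ?S"
    using continuous_open_preimage[OF smooth_on_imp_continuous_on[OF \<gamma>(1)] smooth_on_open[OF \<gamma>(1)]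
        smooth_on_open[OF assms(1)]] .
  show ?thesis
  proof (rule tangent_spaceI)
    show "smooth_on ?S (\<lambda>t. g (\<gamma> t))"
      by (rule smooth_on_compose[OF assms(1) smooth_on_subset[OF \<gamma>(1) op]]) auto
    show "((\<lambda>t. g (\<gamma> t)) has_vector_derivative D v) (at 0)"
      by (rule curve_compose_derivative[OF \<gamma>(5)]) (simp add: \<gamma>(4) D)
  qed (use \<gamma> assms in auto)
qed

text \<open>Tangent vectors are velocities of curves in \<open>M\<close>, along which the two maps agree.\<close>

lemma derivative_on_tangent_unique:
  fixes g h :: "'a::euclidean_space \<Rightarrow> 'b::real_normed_vector"
  assumes "open U" "p \<in> U" "\<And>q. q \<in> M \<Longrightarrow> q \<in> U \<Longrightarrow> g q = h q"
    and "(g has_derivative D) (at p)" "(h has_derivative E) (at p)" and "v \<in> tangent_space M p"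
  shows "D v = E v"
proof -
  obtain S \<gamma> where \<gamma>: "smooth_on S \<gamma>" "0 \<in> S" "\<And>t. t \<in> S \<Longrightarrow> \<gamma> t \<in> M" "\<gamma> 0 = p"
    "(\<gamma> has_vector_derivative v) (at (0::real))"
    using assms(6) by (rule tangent_spaceE) blast
  let ?S = "S \<inter> \<gamma> -` U"
  have op: "open ?S"
    using continuous_open_preimage[OF smooth_on_imp_continuous_on[OF \<gamma>(1)] smooth_on_open[OF \<gamma>(1)] assms(1)] .
  have g: "((\<lambda>t. g (\<gamma> t)) has_vector_derivative D v) (at 0)"
    by (rule curve_compose_derivative[OF \<gamma>(5)]) (simp add: \<gamma>(4) assms(4))
  have "((\<lambda>t. h (\<gamma> t)) has_vector_derivative E v) (at 0)"
    by (rule curve_compose_derivative[OF \<gamma>(5)]) (simp add: \<gamma>(4) assms(5))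
  moreover have "((\<lambda>t. h (\<gamma> t)) has_vector_derivative D v) (at 0)"
    using op by (rule has_vector_derivative_transform_within_open[OF g]) (use \<gamma> assms(2,3) in auto)
  ultimately show ?thesis
    using vector_derivative_unique_at by metis
qed

lemma local_extensionI:
  "smooth_on U g \<Longrightarrow> p \<in> U \<Longrightarrow> (\<And>q. q \<in> M \<Longrightarrow> q \<in> U \<Longrightarrow> g q = f q) \<Longrightarrow> local_extension M f p g"
  by (auto simp: local_extension_def)

lemma tdiff_eq:
  assumes "smooth_on U g" "p \<in> U" "\<And>q. q \<in> M \<Longrightarrow> q \<in> U \<Longrightarrow> g q = f q"
    and "(g has_derivative D) (at p)" and "v \<in> tangent_space M p"
  shows "tdiff M f p v = D v"
proof -
  define h where "h = (SOME g. local_extension M f p g)"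
  have "local_extension M f p h"
    unfolding h_def by (rule someI[of _ g]) (rule local_extensionI[OF assms(1,2)], rule assms(3))
  then obtain V where V: "p \<in> V" "smooth_on V h" "\<And>q. q \<in> M \<Longrightarrow> q \<in> V \<Longrightarrow> h q = f q"
    by (auto simp: local_extension_def)
  have "frechet_derivative h (at p) v = D v"
  proof (rule derivative_on_tangent_unique[of "U \<inter> V"])
    show "open (U \<inter> V)"
      using smooth_on_open V(2) assms(1) by blast
    show "(h has_derivative frechet_derivative h (at p)) (at p)"
      using V by (intro smooth_on_has_derivative)
  qed (use V assms in auto)
  then show ?thesis
    by (simp add: tdiff_def h_def)
qed

lemma smooth_mapI:
  assumes "\<And>p. p \<in> M \<Longrightarrow> p \<in> U" "smooth_on U g" "\<And>q. q \<in> M \<Longrightarrow> g q = f q"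
  shows "smooth_map M f"
  using assms by (auto simp: smooth_map_def intro!: local_extensionI)

text \<open>A smooth local inverse makes the differential bijective on tangent spaces, without
  computing either tangent space.\<close>

lemma tdiff_bij_of_local_inverse:
  fixes f :: "'a::euclidean_space \<Rightarrow> 'b::euclidean_space"
  assumes F: "smooth_on U F" "p \<in> U" "\<And>q. q \<in> M \<Longrightarrow> q \<in> U \<Longrightarrow> F q = f q"
    and fN: "\<And>q. q \<in> M \<Longrightarrow> f q \<in> N"
    and G: "smooth_on V G" "f p \<in> V" "\<And>z. z \<in> N \<Longrightarrow> z \<in> V \<Longrightarrow> G z \<in> M"
    and fG: "\<And>z. z \<in> N \<Longrightarrow> z \<in> V \<Longrightarrow> f (G z) = z"
    and W: "open W" "p \<in> W" "\<And>q. q \<in> M \<Longrightarrow> q \<in> W \<Longrightarrow> f q \<in> V \<and> G (f q) = q"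
    and p: "p \<in> M"
  shows "bij_betw (tdiff M f p) (tangent_space M p) (tangent_space N (f p))"
proof -
  define D E where "D = frechet_derivative F (at p)" and "E = frechet_derivative G (at (f p))"
  have D: "(F has_derivative D) (at p)" and E: "(G has_derivative E) (at (f p))"
    unfolding D_def E_def using F G by (auto intro: smooth_on_has_derivative)
  have Fp: "F p = f p" and Gp: "G (f p) = p"
    using F W p by auto
  have td: "tdiff M f p v = D v" if "v \<in> tangent_space M p" for v
    using F D that by (intro tdiff_eq[of U F])
  have DT: "D v \<in> tangent_space N (f p)" if "v \<in> tangent_space M p" for v
    using smooth_map_tangent[OF F(1,2) _ D that, of N] F(3) fN Fp by simp
  have ET: "E w \<in> tangent_space M p" if "w \<in> tangent_space N (f p)" for w
    using smooth_map_tangent[OF G(1,2) _ E that, of M] G(3) Gp by simp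
  have ED: "E (D v) = v" if "v \<in> tangent_space M p" for v
  proof (rule derivative_on_tangent_unique[of "U \<inter> W" p M "\<lambda>x. G (F x)" "\<lambda>x. x" "\<lambda>v. E (D v)" "\<lambda>v. v"])
    show "((\<lambda>x. G (F x)) has_derivative (\<lambda>v. E (D v))) (at p)"
      using diff_chain_at[OF D] E Fp by (simp add: o_def)
  qed (use F W smooth_on_open[OF F(1)] that in auto)
  have DE: "D (E w) = w" if "w \<in> tangent_space N (f p)" for w
  proof (rule derivative_on_tangent_unique[of "V \<inter> G -` U" "f p" N "\<lambda>z. F (G z)" "\<lambda>x. x" "\<lambda>v. D (E v)" "\<lambda>v. v"])
    show "open (V \<inter> G -` U)"
      using continuous_open_preimage[OF smooth_on_imp_continuous_on[OF G(1)] smooth_on_open[OF G(1)] smooth_on_open[OF F(1)]] .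
    show "((\<lambda>x. F (G x)) has_derivative (\<lambda>v. D (E v))) (at (f p))"
      using diff_chain_at[OF E] D Gp by (simp add: o_def)
    show "F (G q) = q" if "q \<in> N" "q \<in> V \<inter> G -` U" for q
      using that F(3)[OF G(3)] fG by auto
  qed (use F G W Gp that in auto)
  show ?thesis
    by (rule bij_betw_byWitness[where f' = E]) (use td DT ET ED DE in auto)
qed

lemma form_extension_cong: "form1_eq M \<beta> \<eta> \<Longrightarrow> form_extension M \<beta> p = form_extension M \<eta> p"
  unfolding form1_eq_def form_extension_def fun_eq_iff by (metis IntD1)

lemma form1_eq_sym: "form1_eq M \<beta> \<eta> \<Longrightarrow> form1_eq M \<eta> \<beta>"
  and form1_eq_trans: "form1_eq M \<beta> \<eta> \<Longrightarrow> form1_eq M \<eta> \<mu> \<Longrightarrow> form1_eq M \<beta> \<mu>"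
  by (auto simp: form1_eq_def)

lemma ext_d_cong: "form1_eq M \<beta> \<eta> \<Longrightarrow> ext_d M \<beta> p = ext_d M \<eta> p"
  by (simp add: ext_d_def fun_eq_iff form_extension_cong)

lemma smooth_form_cong: "form1_eq M \<beta> \<eta> \<Longrightarrow> smooth_form M \<beta> = smooth_form M \<eta>"
  by (simp add: smooth_form_def form_extension_cong)

lemma contact_form_cong:
  assumes "form1_eq M \<beta> \<eta>" "contact_form M \<eta>" shows "contact_form M \<beta>"
proof -
  have "smooth_form M \<beta>" and d: "ext_d M \<beta> p = ext_d M \<eta> p" for p
    using assms smooth_form_cong ext_d_cong by (auto simp: contact_form_def)
  moreover have "\<beta> p u = \<eta> p u" if "u \<in> tangent_space M p" for p u
    using assms(1) that tangent_space_base by (auto simp: form1_eq_def)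
  ultimately show ?thesis
    using assms(2) unfolding contact_form_def d by simp
qed

lemma reeb_field_cong:
  assumes "form1_eq M \<beta> \<eta>" shows "reeb_field M \<beta> p = reeb_field M \<eta> p"
proof -
  have "\<beta> p u = \<eta> p u" if "u \<in> tangent_space M p" for u
    using assms that tangent_space_base by (auto simp: form1_eq_def)
  then show ?thesis
    unfolding reeb_field_def ext_d_cong[OF assms] by (intro arg_cong[where f = The]) (auto simp: fun_eq_iff)
qed

text \<open>Two extensions of a form differ by a field normal to \<open>M\<close>, so the exterior derivative may be
  computed with any of them as soon as normal fields have a derivative that is symmetric on tangent
  vectors. This holds if along \<open>M\<close> they are combinations of gradients of functions that define
  \<open>M\<close>, since Hessians are symmetric.\<close>

definition normal_fields_curl_free :: "'a::euclidean_space set \<Rightarrow> 'a \<Rightarrow> bool" where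
  "normal_fields_curl_free M p \<longleftrightarrow> (\<forall>U C. p \<in> U \<and> smooth_on U C \<and>
     (\<forall>q\<in>M \<inter> U. \<forall>v\<in>tangent_space M q. C q \<bullet> v = 0) \<longrightarrow>
     (\<forall>v\<in>tangent_space M p. \<forall>w\<in>tangent_space M p.
        frechet_derivative C (at p) v \<bullet> w = frechet_derivative C (at p) w \<bullet> v))"

lemma form_extensionI:
  "smooth_on U B \<Longrightarrow> p \<in> U \<Longrightarrow>
    (\<And>q v. q \<in> M \<Longrightarrow> q \<in> U \<Longrightarrow> v \<in> tangent_space M q \<Longrightarrow> \<beta> q v = B q \<bullet> v) \<Longrightarrow>
    form_extension M \<beta> p B"
  by (auto simp: form_extension_def)

lemma ext_d_eq:
  assumes M: "normal_fields_curl_free M p"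
    and B: "smooth_on U B" "p \<in> U"
      "\<And>q v. q \<in> M \<Longrightarrow> q \<in> U \<Longrightarrow> v \<in> tangent_space M q \<Longrightarrow> \<beta> q v = B q \<bullet> v"
    and D: "(B has_derivative D) (at p)"
    and v: "v \<in> tangent_space M p" and w: "w \<in> tangent_space M p"
  shows "ext_d M \<beta> p v w = D v \<bullet> w - D w \<bullet> v"
proof -
  define A where "A = (SOME B. form_extension M \<beta> p B)"
  have "form_extension M \<beta> p A"
    unfolding A_def by (rule someI[of _ B]) (rule form_extensionI[OF B(1,2)], rule B(3))
  then obtain V where V: "p \<in> V" "smooth_on V A"
    "\<And>q v. q \<in> M \<Longrightarrow> q \<in> V \<Longrightarrow> v \<in> tangent_space M q \<Longrightarrow> \<beta> q v = A q \<bullet> v"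
    by (auto simp: form_extension_def)
  define E where "E = frechet_derivative A (at p)"
  have E: "(A has_derivative E) (at p)"
    unfolding E_def using V by (intro smooth_on_has_derivative)
  have sm: "smooth_on (U \<inter> V) (\<lambda>q. A q - B q)"
    using V(2) B(1) by (intro smooth_intros; auto intro: smooth_on_subset dest: smooth_on_open)
  have "frechet_derivative (\<lambda>q. A q - B q) (at p) = (\<lambda>v. E v - D v)"
    using has_derivative_diff[OF E D] by (rule frechet_derivative_at_eq)
  moreover have "\<forall>q\<in>M \<inter> (U \<inter> V). \<forall>v\<in>tangent_space M q. (A q - B q) \<bullet> v = 0"
  proof (intro ballI)
    fix q v assume q: "q \<in> M \<inter> (U \<inter> V)" and v: "v \<in> tangent_space M q"
    then have "A q \<bullet> v = B q \<bullet> v"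
      using V(3)[of q v] B(3)[of q v] by auto
    then show "(A q - B q) \<bullet> v = 0"
      by (simp add: inner_diff_left)
  qed
  ultimately have "(E v - D v) \<bullet> w = (E w - D w) \<bullet> v"
    using M[unfolded normal_fields_curl_free_def, rule_format, of "U \<inter> V" "\<lambda>q. A q - B q" v w]
      sm V(1) B(2) v w by auto
  then show ?thesis
    by (simp add: ext_d_def A_def[symmetric] E_def[symmetric] inner_diff_left)
qed

section \<open>Quaternions and rotations\<close>

notation qmult (infixl \<open>\<star>\<close> 70)

definition qconj :: "quat \<Rightarrow> quat" where "qconj p = (fst p, - snd p)"

definition pure :: "real^3 \<Rightarrow> quat" where "pure a = (0, a)"

abbreviation e1 :: "real^3" where "e1 \<equiv> axis 1 1"
abbreviation e2 :: "real^3" where "e2 \<equiv> axis 2 1"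
abbreviation e3 :: "real^3" where "e3 \<equiv> axis 3 1"

lemmas quat_components = qmult_def qconj_def pure_def prod_eq_iff vec_eq_iff forall_3
  cross_components inner_vec_def sum_3 inner_prod_def axis_def

lemma qmult_assoc: "(p \<star> q) \<star> r = p \<star> (q \<star> r)"
  by (simp add: quat_components algebra_simps)

lemma bounded_bilinear_qmult: "bounded_bilinear (\<star>)"
proof -
  have "bilinear (\<star>)"
    by (auto simp: bilinear_def linear_iff quat_components algebra_simps)
  then show ?thesis
    by (simp add: bilinear_conv_bounded_bilinear)
qed

interpretation qmult: bounded_bilinear "(\<star>)"
  by (rule bounded_bilinear_qmult)

declare qmult.zero_left [simp] qmult.zero_right [simp]

lemmas qmult_distribs = qmult.add_left qmult.add_right qmult.diff_left qmult.diff_right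
  qmult.scaleR_left qmult.scaleR_right qmult.minus_left qmult.minus_right

lemmas smooth_on_qmult [smooth_intros] = smooth_on_bilinear[OF bounded_bilinear_qmult]

lemma qmult_one [simp]: "q_one \<star> p = p" "p \<star> q_one = p"
  by (simp_all add: quat_components q_one_def)

lemma qconj_simps [simp]: "qconj (p \<star> q) = qconj q \<star> qconj p" "qconj (qconj p) = p"
  "qconj (r *\<^sub>R p) = r *\<^sub>R qconj p" "qconj (pure a) = - pure a" "norm (qconj p) = norm p"
  "qconj q_one = q_one"
  by (simp_all add: quat_components algebra_simps norm_prod_def q_one_def)

lemma bounded_linear_qconj: "bounded_linear qconj"
  unfolding qconj_def [abs_def]
  by (intro bounded_linear_Pair bounded_linear_fst bounded_linear_minus bounded_linear_snd)

lemma smooth_on_qconj [smooth_intros]: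
  fixes f :: "'a::euclidean_space \<Rightarrow> quat"
  shows "smooth_on U f \<Longrightarrow> smooth_on U (\<lambda>x. qconj (f x))"
  by (rule smooth_on_compose_linear[OF bounded_linear_qconj])

lemma qmult_qconj: "p \<star> qconj p = (p \<bullet> p) *\<^sub>R q_one" "qconj p \<star> p = (p \<bullet> p) *\<^sub>R q_one"
  by (simp_all add: quat_components algebra_simps q_one_def)

lemma qmult_qconj_unit:
  assumes "norm p = 1"
  shows "p \<star> qconj p = q_one" "qconj p \<star> p = q_one"
    "p \<star> (qconj p \<star> q) = q" "qconj p \<star> (p \<star> q) = q"
proof -
  have "p \<bullet> p = 1"
    using assms by (simp add: norm_eq_1)
  then show 1: "p \<star> qconj p = q_one" "qconj p \<star> p = q_one"
    by (simp_all add: qmult_qconj)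
  show "p \<star> (qconj p \<star> q) = q" "qconj p \<star> (p \<star> q) = q"
    using 1 by (simp_all add: qmult_assoc[symmetric])
qed

lemma inner_qmult_left: "(p \<star> q) \<bullet> r = q \<bullet> (qconj p \<star> r)"
  and inner_qmult_right: "(p \<star> q) \<bullet> r = p \<bullet> (r \<star> qconj q)"
  by (simp_all add: quat_components algebra_simps)

lemma inner_qmult_same: "(p \<star> q) \<bullet> (p \<star> r) = (p \<bullet> p) * (q \<bullet> r)"
  by (simp add: inner_qmult_left qmult_assoc[symmetric] qmult_qconj qmult_distribs)

lemma norm_qmult: "norm (p \<star> q) = norm p * norm q"
  by (simp add: norm_eq_sqrt_inner inner_qmult_same real_sqrt_mult)

lemma inner_pure_left: "(pure a \<star> p) \<bullet> q = - (p \<bullet> (pure a \<star> q))"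
  and inner_pure_right: "(p \<star> pure a) \<bullet> q = - (p \<bullet> (q \<star> pure a))"
  by (simp add: inner_qmult_left qmult_distribs, simp add: inner_qmult_right[of p] qmult_distribs)

lemma inner_pure_self: "p \<bullet> (pure a \<star> p) = 0" "p \<bullet> (p \<star> pure a) = 0"
  using inner_pure_left[of a p p] inner_pure_right[of p a p] by (simp_all add: inner_commute)

lemma pure_mult_pure: "pure a \<star> pure b = pure (cross3 a b) - (a \<bullet> b) *\<^sub>R q_one"
  by (simp add: quat_components q_one_def)

lemma pure_linear: "pure (a + b) = pure a + pure b" "pure (r *\<^sub>R a) = r *\<^sub>R pure a"
  "pure (- a) = - pure a" "pure (a - b) = pure a - pure b" "pure 0 = 0"
  by (simp_all add: pure_def prod_eq_iff)

lemma pure_inject [simp]: "pure a = pure b \<longleftrightarrow> a = b"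
  by (simp add: pure_def)

lemma inner_pure [simp]: "pure a \<bullet> pure b = a \<bullet> b" and norm_pure [simp]: "norm (pure a) = norm a"
  and fst_pure [simp]: "fst (pure a) = 0" and snd_pure [simp]: "snd (pure a) = a"
  by (simp_all add: pure_def norm_prod_def)

lemma inner_pure_one [simp]: "pure a \<bullet> q_one = 0" "q_one \<bullet> pure a = 0" "q_one \<bullet> q_one = 1"
  by (simp_all add: pure_def q_one_def)

lemma pure_square: "norm a = 1 \<Longrightarrow> pure a \<star> pure a = - q_one"
  by (simp add: pure_mult_pure norm_eq_1 pure_linear)

lemma q_i_pure: "q_i = pure e1" and q_j_pure: "q_j = pure e2"
  by (simp_all add: q_i_def q_j_def pure_def)

text \<open>The rotation by which the inverse of \<open>u\<close> acts on imaginary quaternions. For non-unit \<open>u\<close> it is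
  multiplied by the square of the norm of \<open>u\<close>, so that it is polynomial in \<open>u\<close>.\<close>

definition rot :: "quat \<Rightarrow> real^3 \<Rightarrow> real^3" where
  "rot u a = snd (qconj u \<star> pure a \<star> u)"

lemma pure_rot: "pure (rot u a) = qconj u \<star> pure a \<star> u"
  by (simp add: rot_def quat_components algebra_simps)

lemma qmult_rot: "norm u = 1 \<Longrightarrow> u \<star> pure (rot u a) = pure a \<star> u"
  by (simp add: pure_rot qmult_assoc qmult_qconj_unit)

lemma rot_linear: "rot u (a + b) = rot u a + rot u b" "rot u (r *\<^sub>R a) = r *\<^sub>R rot u a"
  "rot u (- a) = - rot u a" "rot u (a - b) = rot u a - rot u b"
  by (simp_all add: rot_def pure_linear qmult_distribs)

lemma rot_minus [simp]: "rot (- u) a = rot u a"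
  by (simp add: rot_def qmult_distribs qconj_simps(3)[of "-1", simplified])

lemma rot_mult: "rot (p \<star> q) a = rot q (rot p a)"
  by (simp add: rot_def[of "p \<star> q"] rot_def[of q] pure_rot qmult_assoc)

text \<open>Both the scalar and the vector product are read off the product of imaginary quaternions,
  which conjugation respects.\<close>

lemma rot_products:
  assumes "norm u = 1"
  shows rot_inner: "rot u a \<bullet> rot u b = a \<bullet> b"
    and rot_cross: "cross3 (rot u a) (rot u b) = rot u (cross3 a b)"
proof -
  have "pure (rot u a) \<star> pure (rot u b) = qconj u \<star> (pure a \<star> pure b) \<star> u"
    using assms by (simp add: pure_rot qmult_assoc qmult_qconj_unit)
  also have "\<dots> = pure (rot u (cross3 a b)) - (a \<bullet> b) *\<^sub>R q_one"
    using assms by (simp add: pure_mult_pure pure_rot qmult_distribs qmult_qconj_unit)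
  finally have "pure (cross3 (rot u a) (rot u b)) - (rot u a \<bullet> rot u b) *\<^sub>R q_one =
      pure (rot u (cross3 a b)) - (a \<bullet> b) *\<^sub>R q_one"
    by (simp add: pure_mult_pure)
  then show "rot u a \<bullet> rot u b = a \<bullet> b" "cross3 (rot u a) (rot u b) = rot u (cross3 a b)"
    by (simp_all add: pure_def q_one_def prod_eq_iff)
qed

lemma norm_rot: "norm u = 1 \<Longrightarrow> norm (rot u a) = norm a"
  by (simp add: norm_eq_sqrt_inner rot_inner)

lemma smooth_on_rot [smooth_intros]:
  fixes f :: "'a::euclidean_space \<Rightarrow> quat"
  assumes "smooth_on U f" shows "smooth_on U (\<lambda>x. rot (f x) a)"
  unfolding rot_def using smooth_on_open[OF assms] by (intro smooth_intros assms)

lemma rot_has_derivative: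
  "((\<lambda>u. rot u a) has_derivative (\<lambda>v. snd (qconj v \<star> pure a \<star> u + qconj u \<star> pure a \<star> v))) (at u)"
proof -
  have c: "(qconj has_derivative qconj) (at u)"
    using bounded_linear_imp_has_derivative[OF bounded_linear_qconj] .
  show ?thesis
    unfolding rot_def
    by (rule has_derivative_eq_rhs, rule has_derivative_snd, rule qmult.FDERIV, rule qmult.FDERIV,
        rule c, rule has_derivative_const, rule has_derivative_ident) (simp add: fun_eq_iff add.commute)
qed

subsection \<open>Recovering a unit quaternion from its rotation\<close>

text \<open>For \<open>x, m, y\<close> the images of \<open>e1, e2, e3\<close> under \<open>rot u\<close> this is the sum of
  \<open>qconj c \<star> (p \<star> qconj u) \<star> c \<star> u\<close> over the standard units \<open>c\<close>, which equals
  \<open>4 (p \<bullet> u) u\<close> because averaging the conjugates of a quaternion by the units gives its real part.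
  Normalising it is a local section of the double cover of the rotation group, given by one
  rational formula for each choice of \<open>p\<close>.\<close>

definition lift_from :: "quat \<Rightarrow> real^3 \<Rightarrow> real^3 \<Rightarrow> quat" where
  "lift_from p x y = p - pure e1 \<star> p \<star> pure x - pure e2 \<star> p \<star> pure (cross3 y x) - pure e3 \<star> p \<star> pure y"

lemma conjugates_by_units_sum:
  "a - pure e1 \<star> a \<star> pure e1 - pure e2 \<star> a \<star> pure e2 - pure e3 \<star> a \<star> pure e3
    = (4 * (a \<bullet> q_one)) *\<^sub>R q_one"
  by (simp add: quat_components q_one_def)

lemma lift_from_rot:
  assumes "norm u = 1"
  shows "lift_from p (rot u e1) (rot u e3) = (4 * (p \<bullet> u)) *\<^sub>R u"
proof -
  let ?a = "p \<star> qconj u"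
  have "lift_from p (rot u e1) (rot u e3) =
      (?a - pure e1 \<star> ?a \<star> pure e1 - pure e2 \<star> ?a \<star> pure e2 - pure e3 \<star> ?a \<star> pure e3) \<star> u"
    using assms by (simp add: lift_from_def rot_cross cross_basis pure_rot qmult_distribs qmult_assoc
        qmult_qconj_unit)
  also have "\<dots> = (4 * (p \<bullet> u)) *\<^sub>R u"
    unfolding conjugates_by_units_sum by (simp add: qmult_distribs inner_qmult_right[of p "qconj u"])
  finally show ?thesis .
qed

text \<open>For orthonormal \<open>x, y\<close> the terms of the sum are permuted when it is multiplied by
  \<open>i\<close> from the left or by \<open>x\<close> from the right. This is what makes the
  normalised sum a preimage of \<open>(x, y)\<close>.\<close>

lemma lift_from_intertwines:
  assumes x: "norm x = 1" and y: "norm y = 1" and xy: "x \<bullet> y = 0"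
  shows "pure e1 \<star> lift_from p x y = lift_from p x y \<star> pure x"
    and "pure e3 \<star> lift_from p x y = lift_from p x y \<star> pure y"
proof -
  let ?m = "cross3 y x"
  have xx: "x \<bullet> x = 1" "y \<bullet> y = 1" "y \<bullet> x = 0"
    using assms by (simp_all add: norm_eq_1 inner_commute)
  have c: "cross3 x ?m = y" "cross3 ?m y = x" "cross3 ?m x = - y" "cross3 y ?m = - x"
    using xx xy cross_skew[of ?m x] cross_skew[of ?m y] by (simp_all add: Lagrange inner_commute)
  have i: "?m \<bullet> x = 0" "?m \<bullet> y = 0"
    by (simp_all add: dot_cross_self)
  have pr: "pure x \<star> pure x = - q_one" "pure y \<star> pure y = - q_one" "pure x \<star> pure y = - pure ?m"
    "pure y \<star> pure x = pure ?m" "pure ?m \<star> pure x = - pure y" "pure ?m \<star> pure y = pure x"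
    using assms xx c i cross_skew[of x y] by (simp_all add: pure_mult_pure pure_linear)
  have u: "pure e1 \<star> pure e1 = - q_one" "pure e3 \<star> pure e3 = - q_one" "pure e1 \<star> pure e3 = - pure e2"
    "pure e3 \<star> pure e1 = pure e2" "pure e1 \<star> pure e2 = pure e3" "pure e3 \<star> pure e2 = - pure e1"
    by (simp_all add: pure_mult_pure cross_basis pure_linear inner_axis_axis)
  have u': "pure e1 \<star> (pure e1 \<star> q) = - q" "pure e3 \<star> (pure e3 \<star> q) = - q" "pure e1 \<star> (pure e3 \<star> q) = - (pure e2 \<star> q)"
    "pure e3 \<star> (pure e1 \<star> q) = pure e2 \<star> q" "pure e1 \<star> (pure e2 \<star> q) = pure e3 \<star> q" "pure e3 \<star> (pure e2 \<star> q) = - (pure e1 \<star> q)" for q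
    by (simp_all add: qmult_assoc[symmetric] u qmult_distribs)
  show "pure e1 \<star> lift_from p x y = lift_from p x y \<star> pure x"
    "pure e3 \<star> lift_from p x y = lift_from p x y \<star> pure y"
    unfolding lift_from_def by (simp_all add: qmult_distribs qmult_assoc u' pr)
qed

text \<open>As a linear map of \<open>p\<close> this has trace 4, because \<open>p \<mapsto> a \<star> p
  \<star> b\<close> has trace 0 for imaginary \<open>a\<close> and \<open>b\<close>.\<close>

lemma lift_from_nonzero: "\<exists>p. lift_from p x y \<noteq> 0"
proof (rule ccontr)
  assume "\<nexists>p. lift_from p x y \<noteq> 0"
  then have "lift_from p x y = 0" for p by blast
  then have "q_one \<bullet> lift_from q_one x y + pure e1 \<bullet> lift_from (pure e1) x y
    + pure e2 \<bullet> lift_from (pure e2) x y + pure e3 \<bullet> lift_from (pure e3) x y = 0"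
    by simp
  moreover have "q_one \<bullet> lift_from q_one x y + pure e1 \<bullet> lift_from (pure e1) x y
    + pure e2 \<bullet> lift_from (pure e2) x y + pure e3 \<bullet> lift_from (pure e3) x y = 4"
    by (simp add: lift_from_def quat_components q_one_def)
  ultimately show False by simp
qed

lemma rot_of_lift:
  assumes "norm x = 1" "norm y = 1" "x \<bullet> y = 0" "lift_from p x y \<noteq> 0"
  defines "u \<equiv> lift_from p x y /\<^sub>R norm (lift_from p x y)"
  shows "norm u = 1" "rot u e1 = x" "rot u e3 = y"
proof -
  show u: "norm u = 1"
    using assms(4) by (simp add: u_def)
  have "pure e1 \<star> u = u \<star> pure x" "pure e3 \<star> u = u \<star> pure y"
    using lift_from_intertwines[OF assms(1-3)] by (simp_all add: u_def qmult_distribs)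
  then have "pure (rot u e1) = pure x" "pure (rot u e3) = pure y"
    using u by (simp_all add: pure_rot qmult_assoc qmult_qconj_unit)
  then show "rot u e1 = x" "rot u e3 = y"
    by simp_all
qed

lemma rot_eq_iff:
  assumes "norm u = 1" "norm v = 1"
  shows "rot u e1 = rot v e1 \<and> rot u e3 = rot v e3 \<longleftrightarrow> v = u \<or> v = - u"
proof
  assume "rot u e1 = rot v e1 \<and> rot u e3 = rot v e3"
  then have "4 *\<^sub>R u = 4 *\<^sub>R ((u \<bullet> v) *\<^sub>R v)"
    using lift_from_rot[OF assms(1), of u] lift_from_rot[OF assms(2), of u] assms
    by (simp add: norm_eq_1)
  then have "u = (u \<bullet> v) *\<^sub>R v"
    by (subst (asm) scaleR_cancel_left) simp
  moreover from this have "\<bar>u \<bullet> v\<bar> = 1"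
    using assms norm_scaleR[of "u \<bullet> v" v] by simp
  ultimately show "v = u \<or> v = - u"
    by (auto simp: abs_if split: if_splits)
qed auto

section \<open>Tangent spaces and exterior derivatives\<close>

lemma has_derivative_norm_compose [derivative_intros]:
  fixes f :: "'a::real_normed_vector \<Rightarrow> 'b::real_inner"
  assumes "(f has_derivative f') (at x)" "f x \<noteq> 0"
  shows "((\<lambda>x. norm (f x)) has_derivative (\<lambda>v. (f x \<bullet> f' v) / norm (f x))) (at x)"
  using diff_chain_at[OF assms(1) has_derivative_norm[OF assms(2)]]
  by (simp add: o_def sgn_div_norm inner_commute divide_inverse mult.commute)

lemma normalize_has_derivative:
  fixes x :: "'a::euclidean_space"
  assumes "norm x = 1"
  shows "((\<lambda>q. q /\<^sub>R norm q) has_derivative (\<lambda>v. v - (x \<bullet> v) *\<^sub>R x)) (at x)"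
proof -
  have "x \<noteq> 0" using assms by auto
  then show ?thesis
    using assms by (auto intro!: derivative_eq_intros simp: sgn_div_norm power2_eq_square inner_commute)
qed

lemma normalize_smooth: "smooth_on (- {0}) (\<lambda>q. (q :: 'a::euclidean_space) /\<^sub>R norm q)"
proof -
  have op: "open (- {0::'a})" by auto
  show ?thesis
    by (intro smooth_intros op) auto
qed

lemma inner_eq_commute: "v \<bullet> w = c \<Longrightarrow> w \<bullet> v = c"
  by (simp add: inner_commute)

lemma constant_on_tangent:
  assumes "v \<in> tangent_space M p" "\<And>q. q \<in> M \<Longrightarrow> g q = c" "(g has_derivative D) (at p)"
  shows "D v = 0"
  by (rule derivative_on_tangent_unique[of UNIV p M g "\<lambda>x. c" D "\<lambda>x. 0"]) (use assms in auto)

subsection \<open>The 3-sphere\<close>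

lemma S3_iff: "u \<in> S3 \<longleftrightarrow> norm u = 1"
  by (simp add: S3_def)

text \<open>Every vector orthogonal to \<open>u\<close> is fixed by the derivative of the radial
  projection onto the sphere.\<close>

lemma tangent_S3:
  assumes "u \<in> S3" shows "v \<in> tangent_space S3 u \<longleftrightarrow> u \<bullet> v = 0"
proof
  assume v: "v \<in> tangent_space S3 u"
  have "((\<lambda>q. q \<bullet> q) has_derivative (\<lambda>v. u \<bullet> v + v \<bullet> u)) (at u)"
    by (auto intro!: derivative_eq_intros)
  from constant_on_tangent[OF v _ this, of 1] show "u \<bullet> v = 0"
    by (simp add: S3_iff norm_eq_1 inner_commute)
next
  assume "u \<bullet> v = 0"
  have n: "norm u = 1" using assms by (simp add: S3_iff)
  have "v - (u \<bullet> v) *\<^sub>R u \<in> tangent_space S3 (u /\<^sub>R norm u)"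
    using n by (intro smooth_map_tangent[OF normalize_smooth _ _ normalize_has_derivative
          tangent_space_open[OF open_UNIV]]) (auto simp: S3_iff)
  then show "v \<in> tangent_space S3 u"
    using \<open>u \<bullet> v = 0\<close> n by simp
qed

text \<open>A field normal to the sphere is a multiple of the identity there, whose derivative is
  symmetric on tangent vectors.\<close>

lemma curl_free_S3:
  assumes p: "p \<in> S3" shows "normal_fields_curl_free S3 p"
  unfolding normal_fields_curl_free_def
proof (intro allI impI ballI; elim conjE)
  fix U C v w
  assume U: "p \<in> U" "smooth_on U C" and C: "\<forall>q\<in>S3 \<inter> U. \<forall>v\<in>tangent_space S3 q. C q \<bullet> v = 0"
    and v: "v \<in> tangent_space S3 p" and w: "w \<in> tangent_space S3 p"
  let ?D = "frechet_derivative C (at p)"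
  have D: "(C has_derivative ?D) (at p)"
    using U by (intro smooth_on_has_derivative)
  have K: "C q = (C q \<bullet> q) *\<^sub>R q" if "q \<in> S3" "q \<in> U" for q
  proof -
    have q: "q \<bullet> q = 1" using that by (simp add: S3_iff norm_eq_1)
    let ?d = "C q - (C q \<bullet> q) *\<^sub>R q"
    have "?d \<bullet> q = 0" using q by (simp add: inner_diff_left)
    then have "?d \<in> tangent_space S3 q"
      using that by (simp add: tangent_S3 inner_commute)
    then have "C q \<bullet> ?d = 0"
      using C that by blast
    then have "?d \<bullet> ?d = 0"
      using \<open>?d \<bullet> q = 0\<close> by (simp add: inner_diff_left inner_commute)
    then show ?thesis by simp
  qed
  have E: "((\<lambda>q. (C q \<bullet> q) *\<^sub>R q) has_derivative
      (\<lambda>v. (C p \<bullet> p) *\<^sub>R v + (C p \<bullet> v + ?D v \<bullet> p) *\<^sub>R p)) (at p)"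
    by (rule derivative_eq_intros D refl)+
  have DE: "?D t = (C p \<bullet> p) *\<^sub>R t + (C p \<bullet> t + ?D t \<bullet> p) *\<^sub>R p" if "t \<in> tangent_space S3 p" for t
    using smooth_on_open[OF U(2)] U(1) K D E that by (rule derivative_on_tangent_unique)
  have o: "p \<bullet> v = 0" "p \<bullet> w = 0"
    using v w p by (simp_all add: tangent_S3)
  show "?D v \<bullet> w = ?D w \<bullet> v"
    by (subst DE[OF v], subst DE[OF w]) (simp add: inner_add_left inner_add_right o o[THEN inner_eq_commute] inner_commute)
qed

subsection \<open>The cotangent bundle and the unit cotangent bundle\<close>

lemma Tcot_iff: "(x, Y) \<in> T_cot_minus_zero \<longleftrightarrow> norm x = 1 \<and> x \<bullet> Y = 0 \<and> Y \<noteq> 0"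
  and STcot_iff: "(x, Y) \<in> ST_cot \<longleftrightarrow> norm x = 1 \<and> norm Y = 1 \<and> x \<bullet> Y = 0"
  by (simp_all add: T_cot_minus_zero_def ST_cot_def)

lemma ST_subset_T: "ST_cot \<subseteq> T_cot_minus_zero"
  by (auto simp: T_cot_minus_zero_def ST_cot_def)

lemma Tcot_tangentD:
  assumes v: "(a, A) \<in> tangent_space M (x, Y)" and M: "M \<subseteq> T_cot_minus_zero"
  shows "x \<bullet> a = 0" "Y \<bullet> a + x \<bullet> A = 0"
proof -
  have d1: "((\<lambda>q::phase. fst q \<bullet> fst q) has_derivative (\<lambda>v. x \<bullet> fst v + fst v \<bullet> x)) (at (x, Y))"
    by (auto intro!: derivative_eq_intros)
  have "fst q \<bullet> fst q = 1" if "q \<in> M" for q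
    using M that by (cases q) (auto simp: Tcot_iff norm_eq_1)
  from constant_on_tangent[OF v this d1] show "x \<bullet> a = 0"
    by (simp add: inner_commute)
  have d2: "((\<lambda>q::phase. fst q \<bullet> snd q) has_derivative (\<lambda>v. x \<bullet> snd v + fst v \<bullet> Y)) (at (x, Y))"
    by (auto intro!: derivative_eq_intros)
  have "fst q \<bullet> snd q = 0" if "q \<in> M" for q
    using M that by (cases q) (auto simp: Tcot_iff)
  from constant_on_tangent[OF v this d2] show "Y \<bullet> a + x \<bullet> A = 0"
    by (simp add: inner_commute)
qed

text \<open>The map \<open>g\<close> below is a local retraction of the ambient space: it normalises
  \<open>x\<close> and makes the covector orthogonal to \<open>x\<close>.\<close>

lemma tangent_Tcot:
  assumes z: "(x, Y) \<in> T_cot_minus_zero"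
  shows "(a, A) \<in> tangent_space T_cot_minus_zero (x, Y) \<longleftrightarrow> x \<bullet> a = 0 \<and> Y \<bullet> a + x \<bullet> A = 0"
proof
  assume "(a, A) \<in> tangent_space T_cot_minus_zero (x, Y)"
  from Tcot_tangentD[OF this] show "x \<bullet> a = 0 \<and> Y \<bullet> a + x \<bullet> A = 0" by simp
next
  assume aA: "x \<bullet> a = 0 \<and> Y \<bullet> a + x \<bullet> A = 0"
  have n: "norm x = 1" "x \<bullet> Y = 0" "Y \<noteq> 0" "x \<bullet> x = 1" "x \<noteq> 0"
    using z by (auto simp: Tcot_iff norm_eq_1)
  define h where "h q = snd q - ((snd q \<bullet> fst q) / (fst q \<bullet> fst q)) *\<^sub>R fst q" for q :: phase
  let ?g = "\<lambda>q::phase. (fst q /\<^sub>R norm (fst q), h q)"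
  let ?V = "(- {0}) \<times> UNIV :: phase set"
  have V: "open ?V" by (intro open_Times) auto
  have sh: "smooth_on ?V h"
    unfolding h_def by (intro smooth_intros V) auto
  let ?U = "?V \<inter> h -` (- {0})"
  have U: "open ?U"
    by (rule continuous_open_preimage[OF smooth_on_imp_continuous_on[OF sh] V]) auto
  have sg: "smooth_on ?U ?g"
    using sh U by (intro smooth_on_Pair) (auto intro!: smooth_intros intro: smooth_on_subset)
  have dh: "(h has_derivative (\<lambda>v. snd v - (x \<bullet> snd v + Y \<bullet> fst v) *\<^sub>R x)) (at (x, Y))"
    unfolding h_def using n
    by (auto intro!: derivative_eq_intros simp: inner_commute algebra_simps)
  have df: "((\<lambda>q::phase. fst q /\<^sub>R norm (fst q)) has_derivative
      (\<lambda>v. fst v - (x \<bullet> fst v) *\<^sub>R x)) (at (x, Y))"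
    by (rule has_derivative_compose[OF has_derivative_fst[OF has_derivative_ident]])
      (simp add: normalize_has_derivative[OF n(1)])
  have "(\<lambda>v. (fst v - (x \<bullet> fst v) *\<^sub>R x, snd v - (x \<bullet> snd v + Y \<bullet> fst v) *\<^sub>R x)) (a, A)
      \<in> tangent_space T_cot_minus_zero (?g (x, Y))"
  proof (rule smooth_map_tangent[OF sg _ _ has_derivative_Pair[OF df dh] tangent_space_open[OF open_UNIV]])
    show "(x, Y) \<in> ?U"
      using n by (simp add: h_def inner_commute)
    show "?g q \<in> T_cot_minus_zero" if "q \<in> ?U" for q
    proof -
      have "h q \<bullet> fst q = 0"
        using that by (auto simp: h_def inner_diff_left)
      then show ?thesis
        using that by (cases q) (auto simp: Tcot_iff inner_commute left_inverse)
    qed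
  qed auto
  then show "(a, A) \<in> tangent_space T_cot_minus_zero (x, Y)"
    using aA n by (simp add: h_def inner_commute add.commute)
qed

lemma unit_covector_smooth: "smooth_on (UNIV \<times> (- {0})) unit_covector"
proof -
  have op: "open (UNIV \<times> (- {0}) :: phase set)" by (intro open_Times) auto
  show ?thesis
    unfolding unit_covector_def [abs_def] rho_def by (intro smooth_intros op) auto
qed

lemma unit_covector_has_derivative:
  assumes "Y \<noteq> 0"
  shows "(unit_covector has_derivative
     (\<lambda>v. (fst v, snd v /\<^sub>R norm Y - ((Y \<bullet> snd v) / norm Y ^ 3) *\<^sub>R Y))) (at (x, Y))"
  unfolding unit_covector_def [abs_def] rho_def
  using assms
  by (auto intro!: derivative_eq_intros simp: sgn_div_norm inner_commute divide_simps power2_eq_square power3_eq_cube)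

lemma unit_covector_in_ST: "z \<in> T_cot_minus_zero \<Longrightarrow> unit_covector z \<in> ST_cot"
  by (cases z) (auto simp: unit_covector_def rho_def STcot_iff Tcot_iff)

lemma tangent_STcot:
  assumes z: "(x, y) \<in> ST_cot"
  shows "(a, A) \<in> tangent_space ST_cot (x, y) \<longleftrightarrow> x \<bullet> a = 0 \<and> y \<bullet> a + x \<bullet> A = 0 \<and> y \<bullet> A = 0"
proof
  assume v: "(a, A) \<in> tangent_space ST_cot (x, y)"
  have d: "((\<lambda>q::phase. snd q \<bullet> snd q) has_derivative (\<lambda>v. y \<bullet> snd v + snd v \<bullet> y)) (at (x, y))"
    by (auto intro!: derivative_eq_intros)
  have "snd q \<bullet> snd q = 1" if "q \<in> ST_cot" for q
    using that by (cases q) (auto simp: STcot_iff norm_eq_1)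
  from constant_on_tangent[OF v this d] Tcot_tangentD[OF v ST_subset_T]
  show "x \<bullet> a = 0 \<and> y \<bullet> a + x \<bullet> A = 0 \<and> y \<bullet> A = 0"
    by (simp add: inner_commute)
next
  assume aA: "x \<bullet> a = 0 \<and> y \<bullet> a + x \<bullet> A = 0 \<and> y \<bullet> A = 0"
  have n: "norm y = 1" "y \<noteq> 0" "(x, y) \<in> T_cot_minus_zero" using z ST_subset_T by (auto simp: STcot_iff)
  have "(\<lambda>v. (fst v, snd v /\<^sub>R norm y - ((y \<bullet> snd v) / norm y ^ 3) *\<^sub>R y)) (a, A)
      \<in> tangent_space ST_cot (unit_covector (x, y))"
    using aA n
    by (intro smooth_map_tangent[OF unit_covector_smooth _ _ unit_covector_has_derivative])
      (auto simp: tangent_Tcot intro!: unit_covector_in_ST)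
  then show "(a, A) \<in> tangent_space ST_cot (x, y)"
    using aA n by (simp add: unit_covector_def rho_def)
qed

text \<open>The normal fields are combinations of \<open>(x, 0)\<close> and \<open>(Y, x)\<close>, the
  gradients of \<open>x \<bullet> x / 2\<close> and \<open>x \<bullet> Y\<close>.\<close>

lemma curl_free_Tcot:
  assumes p: "p \<in> T_cot_minus_zero" shows "normal_fields_curl_free T_cot_minus_zero p"
  unfolding normal_fields_curl_free_def
proof (intro allI impI ballI; elim conjE)
  fix U C v w
  assume U: "p \<in> U" "smooth_on U C"
    and C: "\<forall>q\<in>T_cot_minus_zero \<inter> U. \<forall>v\<in>tangent_space T_cot_minus_zero q. C q \<bullet> v = 0"
    and v: "v \<in> tangent_space T_cot_minus_zero p" and w: "w \<in> tangent_space T_cot_minus_zero p"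
  let ?D = "frechet_derivative C (at p)"
  have D: "(C has_derivative ?D) (at p)"
    using U by (intro smooth_on_has_derivative)
  let ?K = "\<lambda>q. ((snd (C q) \<bullet> fst q) *\<^sub>R snd q + (fst (C q) \<bullet> fst q) *\<^sub>R fst q,
    (snd (C q) \<bullet> fst q) *\<^sub>R fst q)"
  have K: "C q = ?K q" if "q \<in> T_cot_minus_zero" "q \<in> U" for q
  proof -
    obtain x Y where q: "q = (x, Y)" by (cases q)
    have n: "x \<bullet> x = 1" "x \<bullet> Y = 0" and xY: "(x, Y) \<in> T_cot_minus_zero"
      using that by (auto simp: q Tcot_iff norm_eq_1)
    obtain b1 b2 where b: "C (x, Y) = (b1, b2)" by (cases "C (x, Y)")
    have C': "b1 \<bullet> a + b2 \<bullet> A = 0" if "x \<bullet> a = 0" "Y \<bullet> a + x \<bullet> A = 0" for a A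
      using C[rule_format, of q "(a, A)"] that xY \<open>q \<in> U\<close> by (simp add: q b tangent_Tcot)
    let ?d2 = "b2 - (b2 \<bullet> x) *\<^sub>R x"
    have "x \<bullet> ?d2 = 0" using n by (simp add: inner_diff_right inner_commute)
    with C'[of 0 ?d2] have "?d2 \<bullet> ?d2 = 0"
      by (simp add: inner_diff_left)
    then have "?d2 = 0"
      by (simp only: inner_eq_zero_iff)
    then have d2: "b2 = (b2 \<bullet> x) *\<^sub>R x" by simp
    let ?d1 = "b1 - (b2 \<bullet> x) *\<^sub>R Y - (b1 \<bullet> x) *\<^sub>R x"
    have x: "x \<bullet> ?d1 = 0" using n by (simp add: inner_diff_right inner_commute)
    with C'[of ?d1 "- (Y \<bullet> ?d1) *\<^sub>R x"] n have "b1 \<bullet> ?d1 - (Y \<bullet> ?d1) * (b2 \<bullet> x) = 0"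
      by simp
    then have "?d1 \<bullet> ?d1 = 0"
      using x by (subst inner_diff_left)+ (simp add: mult.commute)
    then have "?d1 = 0"
      by (simp only: inner_eq_zero_iff)
    then have d1: "b1 = (b2 \<bullet> x) *\<^sub>R Y + (b1 \<bullet> x) *\<^sub>R x"
      by (simp only: diff_eq_eq diff_diff_eq add_0_left)
    show ?thesis
      by (simp add: q b d1[symmetric] d2[symmetric])
  qed
  have E: "(?K has_derivative (\<lambda>v. (
       ((snd (C p) \<bullet> fst p) *\<^sub>R snd v + (snd (C p) \<bullet> fst v + snd (?D v) \<bullet> fst p) *\<^sub>R snd p)
       + ((fst (C p) \<bullet> fst p) *\<^sub>R fst v + (fst (C p) \<bullet> fst v + fst (?D v) \<bullet> fst p) *\<^sub>R fst p),
       (snd (C p) \<bullet> fst p) *\<^sub>R fst v + (snd (C p) \<bullet> fst v + snd (?D v) \<bullet> fst p) *\<^sub>R fst p))) (at p)"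
    (is "(_ has_derivative ?E) _")
    by (intro has_derivative_Pair has_derivative_add has_derivative_scaleR has_derivative_inner
        has_derivative_fst has_derivative_snd D has_derivative_ident)
  have DE: "?D t = ?E t" if "t \<in> tangent_space T_cot_minus_zero p" for t
    using smooth_on_open[OF U(2)] U(1) K D E that by (rule derivative_on_tangent_unique)
  obtain x Y a A b B where pvw: "p = (x, Y)" "v = (a, A)" "w = (b, B)"
    by (cases p, cases v, cases w)
  have o: "x \<bullet> a = 0" "Y \<bullet> a + x \<bullet> A = 0" "x \<bullet> b = 0" "Y \<bullet> b + x \<bullet> B = 0"
    using v w p unfolding pvw by (simp_all add: tangent_Tcot)
  have o': "x \<bullet> A = - (Y \<bullet> a)" "x \<bullet> B = - (Y \<bullet> b)" using o by simp_all
  show "?D v \<bullet> w = ?D w \<bullet> v"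
    by (subst DE[OF v], subst DE[OF w])
      (simp add: pvw inner_add_left inner_add_right o(1,3) o(1,3)[THEN inner_eq_commute] o' o'[THEN inner_eq_commute] inner_commute algebra_simps)
qed

text \<open>In addition to the two gradients for the full cotangent bundle there is \<open>(0, Y)\<close>,
  the gradient of \<open>Y \<bullet> Y / 2\<close>.\<close>

lemma curl_free_STcot:
  assumes p: "p \<in> ST_cot" shows "normal_fields_curl_free ST_cot p"
  unfolding normal_fields_curl_free_def
proof (intro allI impI ballI; elim conjE)
  fix U C v w
  assume U: "p \<in> U" "smooth_on U C"
    and C: "\<forall>q\<in>ST_cot \<inter> U. \<forall>v\<in>tangent_space ST_cot q. C q \<bullet> v = 0"
    and v: "v \<in> tangent_space ST_cot p" and w: "w \<in> tangent_space ST_cot p"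
  let ?D = "frechet_derivative C (at p)"
  have D: "(C has_derivative ?D) (at p)"
    using U by (intro smooth_on_has_derivative)
  let ?K = "\<lambda>q. ((snd (C q) \<bullet> fst q) *\<^sub>R snd q + (fst (C q) \<bullet> fst q) *\<^sub>R fst q,
    (snd (C q) \<bullet> fst q) *\<^sub>R fst q + (snd (C q) \<bullet> snd q) *\<^sub>R snd q)"
  have K: "C q = ?K q" if "q \<in> ST_cot" "q \<in> U" for q
  proof -
    obtain x Y where q: "q = (x, Y)" by (cases q)
    have n: "x \<bullet> x = 1" "x \<bullet> Y = 0" "Y \<bullet> x = 0" "Y \<bullet> Y = 1" and xY: "(x, Y) \<in> ST_cot"
      using that by (auto simp: q STcot_iff norm_eq_1 inner_commute)
    obtain b1 b2 where b: "C (x, Y) = (b1, b2)" by (cases "C (x, Y)")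
    have C': "b1 \<bullet> a + b2 \<bullet> A = 0" if "x \<bullet> a = 0" "Y \<bullet> a + x \<bullet> A = 0" "Y \<bullet> A = 0" for a A
      using C[rule_format, of q "(a, A)"] that xY \<open>q \<in> U\<close> by (simp add: q b tangent_STcot)
    let ?d2 = "b2 - (b2 \<bullet> x) *\<^sub>R x - (b2 \<bullet> Y) *\<^sub>R Y"
    have x2: "x \<bullet> ?d2 = 0" "Y \<bullet> ?d2 = 0" using n by (simp_all add: inner_diff_right inner_commute)
    with C'[of 0 ?d2] have "b2 \<bullet> ?d2 = 0"
      by simp
    then have "?d2 \<bullet> ?d2 = 0"
      using x2 by (subst inner_diff_left)+ simp
    then have "?d2 = 0"
      by (simp only: inner_eq_zero_iff)
    then have d2: "b2 = (b2 \<bullet> x) *\<^sub>R x + (b2 \<bullet> Y) *\<^sub>R Y"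
      by (simp only: diff_eq_eq diff_diff_eq add_0_left)
    let ?d1 = "b1 - (b2 \<bullet> x) *\<^sub>R Y - (b1 \<bullet> x) *\<^sub>R x"
    have x: "x \<bullet> ?d1 = 0" using n by (simp add: inner_diff_right inner_commute)
    with C'[of ?d1 "- (Y \<bullet> ?d1) *\<^sub>R x"] n have "b1 \<bullet> ?d1 - (Y \<bullet> ?d1) * (b2 \<bullet> x) = 0"
      by simp
    then have "?d1 \<bullet> ?d1 = 0"
      using x by (subst inner_diff_left)+ (simp add: mult.commute)
    then have "?d1 = 0"
      by (simp only: inner_eq_zero_iff)
    then have d1: "b1 = (b2 \<bullet> x) *\<^sub>R Y + (b1 \<bullet> x) *\<^sub>R x"
      by (simp only: diff_eq_eq diff_diff_eq add_0_left)
    show ?thesis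
      by (simp add: q b d1[symmetric] d2[symmetric])
  qed
  have E: "(?K has_derivative (\<lambda>v. (
       ((snd (C p) \<bullet> fst p) *\<^sub>R snd v + (snd (C p) \<bullet> fst v + snd (?D v) \<bullet> fst p) *\<^sub>R snd p)
       + ((fst (C p) \<bullet> fst p) *\<^sub>R fst v + (fst (C p) \<bullet> fst v + fst (?D v) \<bullet> fst p) *\<^sub>R fst p),
       ((snd (C p) \<bullet> fst p) *\<^sub>R fst v + (snd (C p) \<bullet> fst v + snd (?D v) \<bullet> fst p) *\<^sub>R fst p)
       + ((snd (C p) \<bullet> snd p) *\<^sub>R snd v + (snd (C p) \<bullet> snd v + snd (?D v) \<bullet> snd p) *\<^sub>R snd p)))) (at p)"
    (is "(_ has_derivative ?E) _")
    by (intro has_derivative_Pair has_derivative_add has_derivative_scaleR has_derivative_inner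
        has_derivative_fst has_derivative_snd D has_derivative_ident)
  have DE: "?D t = ?E t" if "t \<in> tangent_space ST_cot p" for t
    using smooth_on_open[OF U(2)] U(1) K D E that by (rule derivative_on_tangent_unique)
  obtain x Y a A b B where pvw: "p = (x, Y)" "v = (a, A)" "w = (b, B)"
    by (cases p, cases v, cases w)
  have o: "x \<bullet> a = 0" "Y \<bullet> a + x \<bullet> A = 0" "Y \<bullet> A = 0" "x \<bullet> b = 0" "Y \<bullet> b + x \<bullet> B = 0" "Y \<bullet> B = 0"
    using v w p unfolding pvw by (simp_all add: tangent_STcot)
  have o': "x \<bullet> A = - (Y \<bullet> a)" "x \<bullet> B = - (Y \<bullet> b)" using o by simp_all
  show "?D v \<bullet> w = ?D w \<bullet> v"
    by (subst DE[OF v], subst DE[OF w])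
      (simp add: pvw inner_add_left inner_add_right o(1,3,4,6) o(1,3,4,6)[THEN inner_eq_commute] o' o'[THEN inner_eq_commute] inner_commute algebra_simps)
qed

section \<open>The contact forms on the 3-sphere\<close>

lemmas qmult_has_derivative [derivative_intros] = qmult.FDERIV

subsection \<open>The family of contact forms\<close>

text \<open>\<open>tilt a \<epsilon> u\<close> is the value of the form \<open>alpha_form (pure a)\<close> on the vector field
  \<open>(a u + \<epsilon> u i) / 2\<close>, the sum of two commuting infinitesimal symmetries of this form.\<close>

definition tilt :: "real^3 \<Rightarrow> real \<Rightarrow> quat \<Rightarrow> real" where
  "tilt a \<epsilon> u = 1 + \<epsilon> * ((pure a \<star> u) \<bullet> (u \<star> pure e1))"

definition tilted_form :: "real^3 \<Rightarrow> real \<Rightarrow> quat form1" where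
  "tilted_form a \<epsilon> u v = alpha_form (pure a) u v / tilt a \<epsilon> u"

definition tilted_reeb :: "real^3 \<Rightarrow> real \<Rightarrow> quat \<Rightarrow> quat" where
  "tilted_reeb a \<epsilon> u = (1/2) *\<^sub>R (pure a \<star> u + \<epsilon> *\<^sub>R (u \<star> pure e1))"

lemma tilt_rot: "tilt a \<epsilon> u = 1 + \<epsilon> * (rot u a \<bullet> e1)"
proof -
  have "(pure a \<star> u) \<bullet> (u \<star> pure e1) = (u \<star> pure e1) \<bullet> (pure a \<star> u)"
    by (rule inner_commute)
  also have "\<dots> = pure e1 \<bullet> pure (rot u a)"
    unfolding inner_qmult_left pure_rot qmult_assoc ..
  also have "\<dots> = rot u a \<bullet> e1"
    unfolding inner_pure by (rule inner_commute)
  finally show ?thesis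
    by (simp add: tilt_def)
qed

lemma tilt_pos:
  assumes "norm a = 1" "0 \<le> \<epsilon>" "\<epsilon> < 1" "norm u = 1"
  shows "tilt a \<epsilon> u > 0"
proof -
  have "\<bar>rot u a \<bullet> e1\<bar> \<le> 1"
    using Cauchy_Schwarz_ineq2[of "rot u a" e1] assms by (simp add: norm_rot)
  then have "\<bar>\<epsilon> * (rot u a \<bullet> e1)\<bar> \<le> \<epsilon> * 1"
    unfolding abs_mult using assms by (intro mult_mono) auto
  then show ?thesis
    using assms by (simp add: tilt_rot)
qed

lemma tilt_smooth: "smooth_on UNIV (\<lambda>(\<epsilon>, u). tilt a \<epsilon> u)" "smooth_on UNIV (tilt a \<epsilon>)"
  unfolding tilt_def [abs_def] split_def by (intro smooth_intros open_UNIV)+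

lemma tilt_has_derivative:
  "(tilt a \<epsilon> has_derivative
     (\<lambda>v. \<epsilon> * ((pure a \<star> v) \<bullet> (u \<star> pure e1) + (pure a \<star> u) \<bullet> (v \<star> pure e1)))) (at u)"
  unfolding tilt_def [abs_def] by (auto intro!: derivative_eq_intros simp: algebra_simps)

lemma alpha_form_pure: "alpha_form (pure a) u v = 2 * ((pure a \<star> u) \<bullet> v)"
  by (simp add: alpha_form_def inner_pure_left)

lemma tilted_form_0: "tilted_form a 0 = alpha_form (pure a)"
  by (simp add: tilted_form_def tilt_def fun_eq_iff)

text \<open>The vector field that represents the form by the scalar product of the ambient space.\<close>

definition tilted_dual :: "real^3 \<Rightarrow> real \<Rightarrow> quat \<Rightarrow> quat" where
  "tilted_dual a \<epsilon> u = (2 / tilt a \<epsilon> u) *\<^sub>R (pure a \<star> u)"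

lemma tilted_form_dual: "tilted_form a \<epsilon> u v = tilted_dual a \<epsilon> u \<bullet> v"
  by (simp add: tilted_form_def tilted_dual_def alpha_form_pure)

lemma tilt_domain_open: "open {u. tilt a \<epsilon> u \<noteq> 0}" "open {(\<epsilon>, u). tilt a \<epsilon> u \<noteq> 0}"
proof -
  have "open (tilt a \<epsilon> -` (- {0}))" "open ((\<lambda>(\<epsilon>, u). tilt a \<epsilon> u) -` (- {0}))"
    using tilt_smooth[THEN smooth_on_imp_continuous_on]
    by (auto intro!: open_vimage)
  then show "open {u. tilt a \<epsilon> u \<noteq> 0}" "open {(\<epsilon>, u). tilt a \<epsilon> u \<noteq> 0}"
    by (simp_all add: vimage_def split_def)
qed

lemma tilted_dual_smooth:
  "smooth_on {(\<epsilon>, u). tilt a \<epsilon> u \<noteq> 0} (\<lambda>(\<epsilon>, u). tilted_dual a \<epsilon> u)"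
  "smooth_on {u. tilt a \<epsilon> u \<noteq> 0} (tilted_dual a \<epsilon>)"
proof -
  show "smooth_on {(\<epsilon>, u). tilt a \<epsilon> u \<noteq> 0} (\<lambda>(\<epsilon>, u). tilted_dual a \<epsilon> u)"
    using tilt_smooth(1)[of a] tilt_domain_open(2)[of a]
    unfolding tilted_dual_def split_def
    by (intro smooth_intros) (auto intro: smooth_on_subset)
  show "smooth_on {u. tilt a \<epsilon> u \<noteq> 0} (tilted_dual a \<epsilon>)"
    using tilt_smooth(2)[of a] tilt_domain_open(1)[of a]
    unfolding tilted_dual_def [abs_def]
    by (intro smooth_intros) (auto intro: smooth_on_subset)
qed

text \<open>The first term comes from the exterior derivative of \<open>alpha_form\<close>, the second
  from the derivative of the factor \<open>1 / tilt\<close>.\<close>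

lemma ext_d_tilted:
  assumes u: "u \<in> S3" and t: "tilt a \<epsilon> u \<noteq> 0"
    and v: "v \<in> tangent_space S3 u" and w: "w \<in> tangent_space S3 u"
  defines "d \<equiv> \<lambda>v. \<epsilon> * ((pure a \<star> v) \<bullet> (u \<star> pure e1) + (pure a \<star> u) \<bullet> (v \<star> pure e1))"
  shows "ext_d S3 (tilted_form a \<epsilon>) u v w =
    4 / tilt a \<epsilon> u * ((pure a \<star> v) \<bullet> w)
    - 2 / (tilt a \<epsilon> u)\<^sup>2 * (d v * ((pure a \<star> u) \<bullet> w) - d w * ((pure a \<star> u) \<bullet> v))"
proof -
  have D: "(tilted_dual a \<epsilon> has_derivative (\<lambda>v. (2 / tilt a \<epsilon> u) *\<^sub>R (pure a \<star> v)
      - (2 * d v / (tilt a \<epsilon> u)\<^sup>2) *\<^sub>R (pure a \<star> u))) (at u)"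
    unfolding tilted_dual_def [abs_def] d_def
    using t by (auto intro!: derivative_eq_intros tilt_has_derivative simp: power2_eq_square)
  have sw: "(pure a \<star> w) \<bullet> v = - ((pure a \<star> v) \<bullet> w)"
    using inner_pure_left[of a v w] by (simp add: inner_commute)
  have "ext_d S3 (tilted_form a \<epsilon>) u v w =
    ((2 / tilt a \<epsilon> u) *\<^sub>R (pure a \<star> v) - (2 * d v / (tilt a \<epsilon> u)\<^sup>2) *\<^sub>R (pure a \<star> u)) \<bullet> w
    - ((2 / tilt a \<epsilon> u) *\<^sub>R (pure a \<star> w) - (2 * d w / (tilt a \<epsilon> u)\<^sup>2) *\<^sub>R (pure a \<star> u)) \<bullet> v"
    by (rule ext_d_eq[OF curl_free_S3[OF u] tilted_dual_smooth(2) _ tilted_form_dual D v w]) (use t in auto)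
  also have "\<dots> = 4 / tilt a \<epsilon> u * ((pure a \<star> v) \<bullet> w)
    - 2 / (tilt a \<epsilon> u)\<^sup>2 * (d v * ((pure a \<star> u) \<bullet> w) - d w * ((pure a \<star> u) \<bullet> v))"
    by (simp add: inner_diff_left sw algebra_simps add_divide_distrib diff_divide_distrib)
  finally show ?thesis .
qed

text \<open>If the triple product vanished, \<open>v \<times> w\<close> would be orthogonal to a basis, hence
  zero, and \<open>v\<close> and \<open>w\<close> would be parallel.\<close>

lemma triple_product_nonzero:
  fixes u v w :: "real^3"
  assumes ind: "independent {u, v, w}" and dist: "u \<noteq> v" "v \<noteq> w" "u \<noteq> w"
  shows "u \<bullet> cross3 v w \<noteq> 0"
proof
  assume 0: "u \<bullet> cross3 v w = 0"
  have "dim {u, v, w} = 3"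
    using dim_eq_card_independent[OF ind] dist by simp
  then have span: "span {u, v, w} = UNIV"
    by (simp add: dim_eq_full[symmetric])
  have "orthogonal (cross3 v w) x" for x
  proof (rule orthogonal_to_span[of x "{u, v, w}"])
    show "x \<in> span {u, v, w}"
      by (simp add: span)
    show "orthogonal (cross3 v w) y" if "y \<in> {u, v, w}" for y
      using that 0 by (auto simp: orthogonal_def inner_commute dot_cross_self)
  qed
  then have "cross3 v w = 0"
    by (meson orthogonal_self)
  then have "v = 0 \<or> w = 0 \<or> (\<exists>c. w = c *\<^sub>R v)"
    by (simp add: cross_eq_0 collinear_lemma)
  moreover have "0 \<notin> {u, v, w}"
    using dependent_zero[of "{u, v, w}"] ind by argo
  moreover have "w \<noteq> c *\<^sub>R v" for c
  proof
    assume "w = c *\<^sub>R v"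
    moreover have "v \<in> span ({u, v, w} - {w})"
      using dist by (intro span_base) auto
    ultimately have "w \<in> span ({u, v, w} - {w})"
      using span_scale by metis
    then show False
      using ind unfolding dependent_def by blast
  qed
  ultimately show False by auto
qed

text \<open>In the product of the form with its exterior derivative the term with the derivative of
  \<open>1 / tilt\<close> cancels. What remains is a multiple of the determinant of the three
  vectors, read in the imaginary quaternions.\<close>

lemma tilted_contact_form:
  assumes a: "norm a = 1" and \<epsilon>: "0 \<le> \<epsilon>" "\<epsilon> < 1"
  shows "contact_form S3 (tilted_form a \<epsilon>)"
  unfolding contact_form_def
proof (intro conjI ballI impI)
  show "smooth_form S3 (tilted_form a \<epsilon>)"
    unfolding smooth_form_def
  proof
    fix p assume "p \<in> S3"
    then have "tilt a \<epsilon> p \<noteq> 0"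
      using tilt_pos[OF a \<epsilon>, of p] by (simp add: S3_iff)
    then have "form_extension S3 (tilted_form a \<epsilon>) p (tilted_dual a \<epsilon>)"
      by (intro form_extensionI[OF tilted_dual_smooth(2)] tilted_form_dual) simp
    then show "\<exists>B. form_extension S3 (tilted_form a \<epsilon>) p B"
      by (rule exI[where x = "tilted_dual a \<epsilon>"])
  qed
next
  fix p u v w
  assume p: "p \<in> S3" and u: "u \<in> tangent_space S3 p" and v: "v \<in> tangent_space S3 p"
    and w: "w \<in> tangent_space S3 p" and ind: "u \<noteq> v \<and> v \<noteq> w \<and> u \<noteq> w \<and> independent {u, v, w}"
  have n: "norm p = 1" using p by (simp add: S3_iff)
  have t: "tilt a \<epsilon> p > 0"
    using tilt_pos[OF a \<epsilon> n] .
  \<comment> \<open>right translation by \<open>p\<close> identifies the tangent space with the imaginary quaternions\<close>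
  define I where "I v = snd (v \<star> qconj p)" for v
  have I: "pure (I v) \<star> p = v" if "v \<in> tangent_space S3 p" for v
  proof -
    have "fst (v \<star> qconj p) = (v \<star> qconj p) \<bullet> q_one"
      by (simp add: q_one_def inner_prod_def)
    also have "\<dots> = v \<bullet> p"
      by (simp add: inner_qmult_right)
    finally have "pure (I v) = v \<star> qconj p"
      using that p by (simp add: I_def pure_def prod_eq_iff tangent_S3 inner_commute)
    then show ?thesis
      using n by (simp add: qmult_assoc qmult_qconj_unit)
  qed
  have linI: "linear I"
    unfolding I_def by (auto simp: linear_iff qmult_distribs)
  have "subspace {v. p \<bullet> v = 0}"
    by (rule subspace_hyperplane)
  moreover have T: "tangent_space S3 p = {v. p \<bullet> v = 0}"
    using tangent_S3[OF p] by blast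
  ultimately have "span {u, v, w} \<subseteq> tangent_space S3 p"
    using u v w by (intro span_minimal) simp_all
  then have inj: "inj_on I (span {u, v, w})"
    using I by (intro inj_on_inverseI[where g = "\<lambda>x. pure x \<star> p"]) blast
  then have "independent (I ` {u, v, w})"
    using linear_independent_injective_image[OF linI] ind by blast
  moreover have "I u \<noteq> I v" "I v \<noteq> I w" "I u \<noteq> I w"
    using I[OF u] I[OF v] I[OF w] ind by metis+
  ultimately have det: "I u \<bullet> cross3 (I v) (I w) \<noteq> 0"
    by (intro triple_product_nonzero) auto
  have i1: "(pure a \<star> p) \<bullet> v = a \<bullet> I v" if "v \<in> tangent_space S3 p" for v
    by (subst I[OF that, symmetric]) (use n in \<open>simp add: inner_qmult_right[of "pure a"] qmult_assoc qmult_qconj_unit\<close>)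
  have i2: "(pure a \<star> v) \<bullet> w = cross3 a (I v) \<bullet> I w"
    if "v \<in> tangent_space S3 p" "w \<in> tangent_space S3 p" for v w
  proof -
    have "(pure a \<star> v) \<bullet> w = (pure a \<star> (pure (I v) \<star> p)) \<bullet> (pure (I w) \<star> p)"
      using I that by simp
    also have "\<dots> = (pure a \<star> pure (I v)) \<bullet> (pure (I w) \<star> p \<star> qconj p)"
      unfolding qmult_assoc[of "pure a", symmetric] by (rule inner_qmult_right)
    also have "\<dots> = (pure a \<star> pure (I v)) \<bullet> pure (I w)"
      using n by (simp add: qmult_assoc qmult_qconj_unit)
    finally have "(pure a \<star> v) \<bullet> w = (pure a \<star> pure (I v)) \<bullet> pure (I w)" .
    then show ?thesis
      by (simp add: pure_mult_pure inner_diff_left)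
  qed
  have trip: "(a \<bullet> U) * (cross3 a V \<bullet> W) + (a \<bullet> V) * (cross3 a W \<bullet> U) + (a \<bullet> W) * (cross3 a U \<bullet> V)
      = (a \<bullet> a) * (U \<bullet> cross3 V W)" for U V W :: "real^3"
    by (simp add: inner_vec_def sum_3 cross_components algebra_simps)
  let ?T = "tilt a \<epsilon> p"
  have b: "tilted_form a \<epsilon> p v = 2 / ?T * (a \<bullet> I v)" if "v \<in> tangent_space S3 p" for v
    by (simp add: tilted_form_def alpha_form_pure i1[OF that])
  define d where "d v = \<epsilon> * ((pure a \<star> v) \<bullet> (p \<star> pure e1) + (pure a \<star> p) \<bullet> (v \<star> pure e1))" for v
  have e: "ext_d S3 (tilted_form a \<epsilon>) p v w = 4 / ?T * (cross3 a (I v) \<bullet> I w)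
     - 2 / ?T\<^sup>2 * (d v * (a \<bullet> I w) - d w * (a \<bullet> I v))"
    if "v \<in> tangent_space S3 p" "w \<in> tangent_space S3 p" for v w
    using ext_d_tilted[OF p _ that, of a \<epsilon>] t by (simp add: d_def i1 i2 that)
  have "tilted_form a \<epsilon> p u * ext_d S3 (tilted_form a \<epsilon>) p v w
      + tilted_form a \<epsilon> p v * ext_d S3 (tilted_form a \<epsilon>) p w u
      + tilted_form a \<epsilon> p w * ext_d S3 (tilted_form a \<epsilon>) p u v
    = 8 / ?T\<^sup>2 * ((a \<bullet> I u) * (cross3 a (I v) \<bullet> I w) + (a \<bullet> I v) * (cross3 a (I w) \<bullet> I u)
      + (a \<bullet> I w) * (cross3 a (I u) \<bullet> I v))"
    using t by (simp add: b e u v w field_simps power2_eq_square)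
  also have "\<dots> \<noteq> 0"
    unfolding trip using t a det by (simp add: norm_eq_1)
  finally show "tilted_form a \<epsilon> p u * ext_d S3 (tilted_form a \<epsilon>) p v w
      + tilted_form a \<epsilon> p v * ext_d S3 (tilted_form a \<epsilon>) p w u
      + tilted_form a \<epsilon> p w * ext_d S3 (tilted_form a \<epsilon>) p u v \<noteq> 0" .
qed

lemma tilt_derivative_reeb:
  assumes "norm u = 1"
  shows "(pure a \<star> tilted_reeb a \<epsilon> u) \<bullet> (u \<star> pure e1) + (pure a \<star> u) \<bullet> (tilted_reeb a \<epsilon> u \<star> pure e1) = 0"
proof -
  have 1: "(pure a \<star> (pure a \<star> u)) \<bullet> (u \<star> pure e1) = - ((pure a \<star> u) \<bullet> (pure a \<star> u \<star> pure e1))"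
    by (simp add: inner_pure_left[of a "pure a \<star> u"] qmult_assoc)
  have 2: "(pure a \<star> (u \<star> pure e1)) \<bullet> (u \<star> pure e1) = 0"
    using inner_pure_self(1)[of "u \<star> pure e1" a] by (simp add: inner_commute)
  have 3: "(pure a \<star> u) \<bullet> (u \<star> pure e1 \<star> pure e1) = - ((pure a \<star> u \<star> pure e1) \<bullet> (u \<star> pure e1))"
    using inner_pure_right[of "pure a \<star> u" e1 "u \<star> pure e1"] by simp
  have 4: "(pure a \<star> u) \<bullet> (u \<star> pure e1 \<star> pure e1) = 0"
    using 2 3 by (simp add: qmult_assoc)
  show ?thesis
    using 1 2 4 by (simp add: tilted_reeb_def qmult_distribs inner_add_left inner_add_right qmult_assoc)
qed

lemma tilted_reeb_tangent: "u \<in> S3 \<Longrightarrow> tilted_reeb a \<epsilon> u \<in> tangent_space S3 u"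
  by (simp add: tangent_S3 tilted_reeb_def inner_add_right inner_pure_self)

text \<open>On tangent vectors the derivative of \<open>tilt\<close> is twice \<open>- \<epsilon>\<close>
  times the product with \<open>c u i\<close>. This cancels the contribution of the summand
  \<open>\<epsilon> u i / 2\<close> to the exterior derivative.\<close>

lemma tilted_reeb_field:
  assumes a: "norm a = 1" and \<epsilon>: "0 \<le> \<epsilon>" "\<epsilon> < 1" and u: "u \<in> S3"
  shows "reeb_field S3 (tilted_form a \<epsilon>) u = tilted_reeb a \<epsilon> u"
  unfolding reeb_field_def
proof (rule the_equality)
  let ?T = "tilt a \<epsilon> u" and ?R = "tilted_reeb a \<epsilon> u"
  define d where "d v = \<epsilon> * ((pure a \<star> v) \<bullet> (u \<star> pure e1) + (pure a \<star> u) \<bullet> (v \<star> pure e1))" for v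
  have n: "norm u = 1" using u by (simp add: S3_iff)
  have t: "?T > 0" using tilt_pos[OF a \<epsilon> n] .
  have e: "ext_d S3 (tilted_form a \<epsilon>) u v w = 4 / ?T * ((pure a \<star> v) \<bullet> w)
    - 2 / ?T\<^sup>2 * (d v * ((pure a \<star> u) \<bullet> w) - d w * ((pure a \<star> u) \<bullet> v))"
    if "v \<in> tangent_space S3 u" "w \<in> tangent_space S3 u" for v w
    using ext_d_tilted[OF u _ that] t by (simp add: d_def)
  have aa: "pure a \<star> (pure a \<star> q) = - q" for q
    by (simp add: qmult_assoc[symmetric] pure_square[OF a] qmult_distribs)
  have auR: "2 * ((pure a \<star> u) \<bullet> ?R) = ?T"
  proof -
    have "(pure a \<star> u) \<bullet> (pure a \<star> u) = 1"
      using n a by (simp add: norm_eq_1[symmetric] norm_qmult)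
    then show ?thesis
      by (simp add: tilted_reeb_def inner_add_right tilt_def)
  qed
  have dR: "d ?R = 0"
    using tilt_derivative_reeb[OF n] by (simp add: d_def)
  have dw: "d w = 2 * \<epsilon> * ((pure a \<star> w) \<bullet> (u \<star> pure e1))" for w
  proof -
    have "(pure a \<star> u) \<bullet> (w \<star> pure e1) = (pure a \<star> w) \<bullet> (u \<star> pure e1)"
      using inner_pure_right[of w e1 "pure a \<star> u"] inner_pure_left[of a w "u \<star> pure e1"]
      by (simp add: inner_commute qmult_assoc)
    then show ?thesis by (simp add: d_def algebra_simps)
  qed
  have uw: "(pure a \<star> ?R) \<bullet> w = - (\<epsilon> / 2) * ((pure a \<star> w) \<bullet> (u \<star> pure e1))" if "w \<in> tangent_space S3 u" for w
  proof -
    have "u \<bullet> w = 0" using that u by (simp add: tangent_S3)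
    then show ?thesis
      using inner_pure_left[of a w "u \<star> pure e1"]
      by (simp add: tilted_reeb_def qmult_distribs aa inner_diff_right inner_commute)
  qed
  note RT = tilted_reeb_tangent[OF u, of a \<epsilon>]
  have eR: "ext_d S3 (tilted_form a \<epsilon>) u ?R w = 0" if w: "w \<in> tangent_space S3 u" for w
  proof -
    have "ext_d S3 (tilted_form a \<epsilon>) u ?R w = 4 / ?T * ((pure a \<star> ?R) \<bullet> w) + d w * (2 * ((pure a \<star> u) \<bullet> ?R)) / ?T\<^sup>2"
      using e[OF RT w] by (simp add: dR)
    also have "\<dots> = 0"
      using t unfolding auR by (simp add: uw[OF w] dw power2_eq_square field_simps)
    finally show ?thesis .
  qed
  show "?R \<in> tangent_space S3 u \<and> tilted_form a \<epsilon> u ?R = 1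
      \<and> (\<forall>w\<in>tangent_space S3 u. ext_d S3 (tilted_form a \<epsilon>) u ?R w = 0)"
    using RT eR auR t by (simp add: tilted_form_def alpha_form_pure)
  fix r
  assume r: "r \<in> tangent_space S3 u \<and> tilted_form a \<epsilon> u r = 1
      \<and> (\<forall>w\<in>tangent_space S3 u. ext_d S3 (tilted_form a \<epsilon>) u r w = 0)"
  \<comment> \<open>test the difference \<open>s\<close> of two candidates against \<open>a s\<close>\<close>
  define s where "s = r - ?R"
  have sT: "s \<in> tangent_space S3 u"
    using r RT u by (simp add: s_def tangent_S3 inner_diff_right)
  have s0: "(pure a \<star> u) \<bullet> s = 0"
    using r auR t by (simp add: s_def inner_diff_right tilted_form_def alpha_form_pure)
  define w where "w = pure a \<star> s"
  have wT: "w \<in> tangent_space S3 u"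
    using s0 u inner_pure_left[of a u s] by (simp add: w_def tangent_S3)
  have auw: "(pure a \<star> u) \<bullet> w = 0"
    using inner_qmult_same[of "pure a" u s] sT u by (simp add: w_def tangent_S3)
  have "4 / ?T * ((pure a \<star> r) \<bullet> w) + 2 / ?T\<^sup>2 * (d w * ((pure a \<star> u) \<bullet> r)) = 0"
    using e[OF _ wT, of r] r wT by (simp add: auw)
  moreover have "4 / ?T * ((pure a \<star> ?R) \<bullet> w) + 2 / ?T\<^sup>2 * (d w * ((pure a \<star> u) \<bullet> ?R)) = 0"
    using e[OF RT wT] eR[OF wT] by (simp add: auw)
  moreover have "(pure a \<star> u) \<bullet> r = (pure a \<star> u) \<bullet> ?R"
    using s0 by (simp add: s_def inner_diff_right)
  ultimately have "4 / ?T * ((pure a \<star> r) \<bullet> w) = 4 / ?T * ((pure a \<star> ?R) \<bullet> w)"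
    by (metis add_right_cancel)
  then have "(pure a \<star> r) \<bullet> w = (pure a \<star> ?R) \<bullet> w"
    using t by simp
  then have "w \<bullet> w = 0"
    unfolding w_def by (simp add: s_def qmult.diff_right inner_diff_left)
  then have "s \<bullet> s = 0"
    using inner_qmult_same[of "pure a" s s] a by (auto simp: w_def norm_eq_1)
  then show "r = ?R"
    by (simp add: s_def)
qed

subsection \<open>The circle action\<close>

definition circ :: "real \<Rightarrow> quat" where
  "circ \<theta> = (cos (\<theta> / 2), sin (\<theta> / 2) *\<^sub>R e3)"

definition axis_at :: "real \<Rightarrow> real^3" where
  "axis_at \<theta> = cos \<theta> *\<^sub>R e1 + sin \<theta> *\<^sub>R e2"

lemma norm_axis_at [simp]: "norm (axis_at \<theta>) = 1"
  by (simp add: norm_eq_1 axis_at_def inner_add_left inner_add_right inner_axis_axis flip: power2_eq_square)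

lemma circ_alt: "circ \<theta> = cos (\<theta> / 2) *\<^sub>R q_one + sin (\<theta> / 2) *\<^sub>R pure e3"
  by (simp add: circ_def q_one_def pure_def)

lemma norm_circ [simp]: "norm (circ \<theta>) = 1"
  by (simp add: norm_eq_1 circ_alt inner_add_left inner_add_right inner_axis_axis flip: power2_eq_square)

lemma circ_add: "circ (s + t) = circ s \<star> circ t"
proof -
  have "pure e3 \<star> pure e3 = - q_one"
    by (rule pure_square) simp
  then show ?thesis
    by (simp add: circ_alt qmult_distribs add_divide_distrib cos_add sin_add algebra_simps)
qed

text \<open>The factor 1/2 in \<open>circ\<close> appears because conjugation doubles the angle.\<close>

lemma circ_rot: "rot (qconj (circ \<theta>)) e1 = axis_at \<theta>"
proof -
  let ?c = "cos (\<theta> / 2)" and ?s = "sin (\<theta> / 2)"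
  have pr: "pure e3 \<star> pure e1 = pure e2" "pure e1 \<star> pure e3 = - pure e2"
    "pure e2 \<star> pure e3 = pure e1" "pure e3 \<star> pure e2 = - pure e1"
    by (simp_all add: pure_mult_pure cross_basis pure_linear inner_axis_axis)
  have q: "qconj (circ \<theta>) = ?c *\<^sub>R q_one - ?s *\<^sub>R pure e3"
    by (simp add: circ_def qconj_def q_one_def pure_def)
  have "pure (rot (qconj (circ \<theta>)) e1) = circ \<theta> \<star> pure e1 \<star> qconj (circ \<theta>)"
    by (simp add: pure_rot)
  also have "\<dots> = (?c\<^sup>2 - ?s\<^sup>2) *\<^sub>R pure e1 + (2 * ?s * ?c) *\<^sub>R pure e2"
    unfolding q unfolding circ_alt
    by (simp add: qmult_distribs pr algebra_simps power2_eq_square flip: scaleR_2)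
  also have "\<dots> = pure (axis_at \<theta>)"
    using cos_double[of "\<theta> / 2"] sin_double[of "\<theta> / 2"] by (simp add: axis_at_def pure_linear)
  finally show ?thesis by simp
qed

lemma circ_eq_one_iff: "circ t = q_one \<longleftrightarrow> (\<exists>n::int. t = 4 * pi * of_int n)"
proof -
  have "circ t = q_one \<longleftrightarrow> cos (t / 2) = 1"
    by (auto simp: circ_def q_one_def dest: cos_one_sin_zero)
  also have "\<dots> \<longleftrightarrow> (\<exists>n::int. t / 2 = of_int n * 2 * pi)"
    by (simp add: cos_one_2pi_int)
  also have "\<dots> \<longleftrightarrow> (\<exists>n::int. t = 4 * pi * of_int n)"
    by (auto simp: field_simps)
  finally show ?thesis .
qed

lemma circle_of_unit_quaternions_circ: "circle_of_unit_quaternions circ"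
proof -
  have "(circ has_vector_derivative (1/2) *\<^sub>R (pure e3 \<star> circ t)) (at t)" for t
  proof -
    have "pure e3 \<star> pure e3 = - q_one"
      by (rule pure_square) simp
    then show ?thesis
      unfolding circ_alt [abs_def]
      by (auto intro!: derivative_eq_intros simp: has_vector_derivative_def qmult_distribs algebra_simps)
  qed
  moreover have "bounded_linear (\<lambda>q. (1/2) *\<^sub>R (pure e3 \<star> q))"
    by (intro bounded_linear_const_scaleR qmult.bounded_linear_right)
  ultimately have "smooth_on UNIV circ"
    using smooth_on_linear_ode by blast
  then show ?thesis
    unfolding circle_of_unit_quaternions_def
    using norm_circ circ_add circ_eq_one_iff by blast
qed

text \<open>Left translations carry the tilted forms into one another because they commute with the
  right translations that enter \<open>tilt\<close>.\<close>

lemma pushforward_tilted: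
  assumes q: "norm q = 1" and a: "rot (qconj q) b = a"
  shows "form1_eq S3 (pushforward S3 (\<lambda>u. q \<star> u) (tilted_form b \<epsilon>)) (tilted_form a \<epsilon>)"
  unfolding form1_eq_def
proof (intro ballI)
  fix u v assume u: "u \<in> S3" and v: "v \<in> tangent_space S3 u"
  have inv: "inv_into S3 (\<lambda>u. q \<star> u) w = qconj q \<star> w" if "w \<in> S3" for w
  proof (rule inv_into_f_eq)
    show "inj_on (\<lambda>u. q \<star> u) S3"
      using qmult_qconj_unit(4)[OF q] by (metis inj_onI)
  qed (use that q in \<open>auto simp: S3_iff norm_qmult qmult_qconj_unit\<close>)
  have bl: "bounded_linear (\<lambda>w. qconj q \<star> w)"
    by (rule qmult.bounded_linear_right)
  have td: "tdiff S3 (inv_into S3 (\<lambda>u. q \<star> u)) u v = qconj q \<star> v"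
    by (rule tdiff_eq[OF smooth_on_linear[OF open_UNIV bl] _ _ bounded_linear_imp_has_derivative[OF bl] v])
      (auto simp: inv)
  have pa: "pure a = q \<star> pure b \<star> qconj q"
    using a pure_rot[of "qconj q" b] by simp
  have sw: "pure b \<star> (qconj q \<star> w) = qconj q \<star> (pure a \<star> w)" for w
    using q by (simp add: pa qmult_assoc qmult_qconj_unit)
  have iso: "(qconj q \<star> x) \<bullet> (qconj q \<star> y) = x \<bullet> y" for x y
    using inner_qmult_same[of "qconj q" x y] q by (simp add: norm_eq_1[symmetric])
  have "tilt b \<epsilon> (qconj q \<star> u) = tilt a \<epsilon> u"
    unfolding tilt_def sw qmult_assoc iso ..
  then show "pushforward S3 (\<lambda>u. q \<star> u) (tilted_form b \<epsilon>) u v = tilted_form a \<epsilon> u v"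
    by (simp add: pushforward_def pullback_def td inv[OF u] tilted_form_def alpha_form_pure sw iso)
qed

lemma pushforward_circ:
  "form1_eq S3 (pushforward S3 (qmult (circ \<theta>)) (tilted_form e1 \<epsilon>)) (tilted_form (axis_at \<theta>) \<epsilon>)"
  using pushforward_tilted[OF norm_circ circ_rot] by simp

lemma tilted_smooth_family: "smooth_form_family {0..<1} S3 (tilted_form e1)"
  unfolding smooth_form_family_def
proof
  fix z :: "real \<times> quat" assume "z \<in> {0..<1} \<times> S3"
  then have "z \<in> {(\<epsilon>, u). tilt e1 \<epsilon> u \<noteq> 0}"
    using tilt_pos[of e1] by (fastforce simp: S3_iff)
  then show "\<exists>U B. z \<in> U \<and> smooth_on U B \<and> (\<forall>(e, q)\<in>({0..<1} \<times> S3) \<inter> U.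
      \<forall>v\<in>tangent_space S3 q. tilted_form e1 e q v = B (e, q) \<bullet> v)"
    by (intro exI[where x = "{(\<epsilon>, u). tilt e1 \<epsilon> u \<noteq> 0}"]
        exI[where x = "\<lambda>(\<epsilon>, u). tilted_dual e1 \<epsilon> u"] conjI tilted_dual_smooth(1))
      (auto simp: tilted_form_dual)
qed

section \<open>The symplectic forms and the Hamiltonians\<close>

subsection \<open>Orthonormal frames\<close>

lemma frame_products:
  assumes "norm x = 1" "norm y = 1" "x \<bullet> y = 0"
  shows "x \<bullet> x = 1" "y \<bullet> y = 1" "x \<bullet> y = 0" "y \<bullet> x = 0"
    "cross3 y x \<bullet> cross3 y x = 1" "x \<bullet> cross3 y x = 0" "cross3 y x \<bullet> x = 0"
    "y \<bullet> cross3 y x = 0" "cross3 y x \<bullet> y = 0"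
    "cross3 x y = - cross3 y x" "cross3 (cross3 y x) y = x" "cross3 y (cross3 y x) = - x"
    "cross3 x (cross3 y x) = y" "cross3 (cross3 y x) x = - y"
proof -
  show 1: "x \<bullet> x = 1" "y \<bullet> y = 1" "x \<bullet> y = 0" "y \<bullet> x = 0"
    using assms by (simp_all add: norm_eq_1 inner_commute)
  show "cross3 y x \<bullet> cross3 y x = 1" "x \<bullet> cross3 y x = 0" "cross3 y x \<bullet> x = 0"
    "y \<bullet> cross3 y x = 0" "cross3 y x \<bullet> y = 0"
    using 1 by (simp_all add: dot_cross dot_cross_self)
  show "cross3 x y = - cross3 y x"
    by (rule cross_skew)
  show c: "cross3 y (cross3 y x) = - x" "cross3 x (cross3 y x) = y"
    using 1 by (simp_all add: Lagrange)
  show "cross3 (cross3 y x) y = x" "cross3 (cross3 y x) x = - y"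
    using c cross_skew[of "cross3 y x" x] cross_skew[of "cross3 y x" y] by simp_all
qed

lemma frame_expansion:
  assumes f: "norm x = 1" "norm y = 1" "x \<bullet> y = 0"
  shows "v = (v \<bullet> x) *\<^sub>R x + (v \<bullet> cross3 y x) *\<^sub>R cross3 y x + (v \<bullet> y) *\<^sub>R y"
proof -
  let ?m = "cross3 y x"
  let ?d = "v - ((v \<bullet> x) *\<^sub>R x + (v \<bullet> ?m) *\<^sub>R ?m + (v \<bullet> y) *\<^sub>R y)"
  note fr = frame_products[OF f]
  have d: "?d \<bullet> x = 0" "?d \<bullet> ?m = 0" "?d \<bullet> y = 0"
    by (simp_all add: inner_diff_left inner_add_left fr)
  have "cross3 ?d ?m = 0"
    using d by (simp add: Lagrange)
  moreover have "?m \<noteq> 0"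
    using fr(5) by auto
  ultimately have "?d = 0"
    using d(2) norm_and_cross_eq_0 by blast
  then show ?thesis by simp
qed

subsection \<open>The connection form and the symplectic forms\<close>

text \<open>The two structure equations are evaluated on \<open>(x \<times> y, 0)\<close>, on which
  \<open>\<lambda>\<^sub>1\<close> vanishes and \<open>\<lambda>\<^sub>2\<close> is 1: the
  second one gives the value 0 of the connection form on it, and then the first one yields its
  value on every tangent vector.\<close>

lemma connection_form_value:
  assumes \<alpha>: "connection_form \<alpha>" and z: "(x, y) \<in> ST_cot"
    and v: "(a, A) \<in> tangent_space ST_cot (x, y)"
  shows "\<alpha> (x, y) (a, A) = cross3 y x \<bullet> A"
proof -
  have f: "norm x = 1" "norm y = 1" "x \<bullet> y = 0"
    using z by (auto simp: STcot_iff)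
  note fr = frame_products[OF f]
  have b1: "((\<lambda>q::phase. (snd q, 0)) has_derivative (\<lambda>v. (snd v, 0))) (at (x, y))"
    by (auto intro!: derivative_eq_intros)
  have s1: "smooth_on UNIV (\<lambda>q::phase. (snd q, 0::real^3))"
    by (intro smooth_intros open_UNIV)
  have d1: "ext_d ST_cot lambda1 (x, y) v w = snd v \<bullet> fst w - snd w \<bullet> fst v"
    if "v \<in> tangent_space ST_cot (x, y)" "w \<in> tangent_space ST_cot (x, y)" for v w
    using ext_d_eq[OF curl_free_STcot[OF z] s1 _ _ b1 that]
    by (simp add: lambda1_def inner_prod_def)
  have b2: "((\<lambda>q::phase. (cross3 (fst q) (snd q), 0)) has_derivative
      (\<lambda>v. (cross3 x (snd v) + cross3 (fst v) y, 0))) (at (x, y))"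
    by (auto intro!: derivative_eq_intros bounded_bilinear.FDERIV[OF bounded_bilinear_cross3])
  have s2: "smooth_on UNIV (\<lambda>q::phase. (cross3 (fst q) (snd q), 0::real^3))"
    by (intro smooth_intros open_UNIV)
  have d2: "ext_d ST_cot lambda2 (x, y) v w = (cross3 x (snd v) + cross3 (fst v) y) \<bullet> fst w
      - (cross3 x (snd w) + cross3 (fst w) y) \<bullet> fst v"
    if "v \<in> tangent_space ST_cot (x, y)" "w \<in> tangent_space ST_cot (x, y)" for v w
    using ext_d_eq[OF curl_free_STcot[OF z] s2 _ _ b2 that]
    by (simp add: lambda2_def inner_prod_def)
  let ?v1 = "(y, - x)" and ?v2 = "(cross3 x y, 0)"
  have v1: "?v1 \<in> tangent_space ST_cot (x, y)" and v2: "?v2 \<in> tangent_space ST_cot (x, y)"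
    using fr by (simp_all add: tangent_STcot[OF z])
  have eq1: "ext_d ST_cot lambda1 (x, y) v w = wedge lambda2 \<alpha> (x, y) v w"
    and eq2: "ext_d ST_cot lambda2 (x, y) v w = wedge \<alpha> lambda1 (x, y) v w"
    if "v \<in> tangent_space ST_cot (x, y)" "w \<in> tangent_space ST_cot (x, y)" for v w
    using \<alpha> z that by (auto simp: connection_form_def form2_eq_def)
  have "\<alpha> (x, y) ?v2 = 0"
    using eq2[OF v1 v2] unfolding d2[OF v1 v2] by (simp add: wedge_def lambda1_def fr)
  then show ?thesis
    using eq1[OF v2 v] unfolding d1[OF v2 v]
    by (simp add: wedge_def lambda2_def fr inner_commute)
qed

text \<open>The tangent vector at \<open>(x, \<rho> y)\<close> on which \<open>\<lambda>\<^sub>1\<close>,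
  \<open>\<lambda>\<^sub>2\<close>, the connection form and \<open>d\<rho>\<close> have the
  values \<open>l1\<close>, \<open>l2\<close>, \<open>c\<close> and \<open>r\<close>.\<close>

definition cot_vec :: "real^3 \<Rightarrow> real^3 \<Rightarrow> real \<Rightarrow> real \<Rightarrow> real \<Rightarrow> real \<Rightarrow> real \<Rightarrow> phase" where
  "cot_vec x y \<rho> l1 l2 c r =
    (l1 *\<^sub>R y - l2 *\<^sub>R cross3 y x, r *\<^sub>R y + (\<rho> * c) *\<^sub>R cross3 y x - (\<rho> * l1) *\<^sub>R x)"

lemma Tcot_frame:
  assumes "(x, Y) \<in> T_cot_minus_zero"
  obtains \<rho> y where "\<rho> > 0" "Y = \<rho> *\<^sub>R y" "norm x = 1" "norm y = 1" "x \<bullet> y = 0"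
proof (rule that[of "norm Y" "Y /\<^sub>R norm Y"])
  have "norm x = 1" "x \<bullet> Y = 0" "Y \<noteq> 0"
    using assms by (simp_all add: Tcot_iff)
  then show "norm Y > 0" "Y = norm Y *\<^sub>R (Y /\<^sub>R norm Y)" "norm x = 1" "norm (Y /\<^sub>R norm Y) = 1"
    "x \<bullet> (Y /\<^sub>R norm Y) = 0"
    by simp_all
qed

lemma tangent_cot_vec:
  assumes f: "norm x = 1" "norm y = 1" "x \<bullet> y = 0" and \<rho>: "\<rho> > 0"
  shows "cot_vec x y \<rho> l1 l2 c r \<in> tangent_space T_cot_minus_zero (x, \<rho> *\<^sub>R y)"
    and "v \<in> tangent_space T_cot_minus_zero (x, \<rho> *\<^sub>R y) \<Longrightarrow>
      \<exists>l1 l2 c r. v = cot_vec x y \<rho> l1 l2 c r"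
proof -
  note fr = frame_products[OF f]
  let ?m = "cross3 y x"
  have z: "(x, \<rho> *\<^sub>R y) \<in> T_cot_minus_zero"
    using f \<rho> by (auto simp: Tcot_iff)
  show "cot_vec x y \<rho> l1 l2 c r \<in> tangent_space T_cot_minus_zero (x, \<rho> *\<^sub>R y)"
    unfolding cot_vec_def tangent_Tcot[OF z]
    by (simp add: fr inner_diff_right inner_add_right)
  assume v: "v \<in> tangent_space T_cot_minus_zero (x, \<rho> *\<^sub>R y)"
  obtain a A where aA: "v = (a, A)" by (cases v)
  have t: "a \<bullet> x = 0" "A \<bullet> x = - \<rho> * (a \<bullet> y)"
    using v by (simp_all add: aA tangent_Tcot[OF z] inner_commute add_eq_0_iff)
  have "a = (a \<bullet> y) *\<^sub>R y - (- (a \<bullet> ?m)) *\<^sub>R ?m"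
    using frame_expansion[OF f, of a] t by (simp add: add.commute)
  moreover have "A = (A \<bullet> y) *\<^sub>R y + (\<rho> * ((A \<bullet> ?m) / \<rho>)) *\<^sub>R ?m - (\<rho> * (a \<bullet> y)) *\<^sub>R x"
    using frame_expansion[OF f, of A] t \<rho> by (simp add: algebra_simps)
  ultimately show "\<exists>l1 l2 c r. v = cot_vec x y \<rho> l1 l2 c r"
    unfolding aA cot_vec_def by blast
qed

text \<open>In these coordinates the form is \<open>sin \<theta> (d\<rho> \<and> \<lambda>\<^sub>1 +
  \<rho> \<lambda>\<^sub>2 \<and> \<alpha>) + cos \<theta> (d\<rho> \<and> \<alpha> + \<rho>
  \<lambda>\<^sub>1 \<and> \<lambda>\<^sub>2)\<close>.\<close>

lemma omega_cot_vec:
  assumes \<alpha>: "connection_form \<alpha>"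
    and f: "norm x = 1" "norm y = 1" "x \<bullet> y = 0" and \<rho>: "\<rho> > 0"
  shows "omega \<alpha> \<theta> (x, \<rho> *\<^sub>R y) (cot_vec x y \<rho> l1 l2 c r) (cot_vec x y \<rho> k1 k2 d s) =
    sin \<theta> * (r * k1 - s * l1 + \<rho> * (l2 * d - k2 * c)) +
    cos \<theta> * (r * d - s * c + \<rho> * (l1 * k2 - k1 * l2))"
proof -
  note fr = frame_products[OF f]
  let ?m = "cross3 y x" and ?z = "(x, \<rho> *\<^sub>R y)"
  let ?v = "cot_vec x y \<rho> l1 l2 c r" and ?w = "cot_vec x y \<rho> k1 k2 d s"
  have z: "?z \<in> T_cot_minus_zero"
    using f \<rho> by (auto simp: Tcot_iff)
  note T = tangent_cot_vec(1)[OF f \<rho>]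
  have b1: "((\<lambda>q::phase. (snd q, 0)) has_derivative (\<lambda>v. (snd v, 0))) (at ?z)"
    by (auto intro!: derivative_eq_intros)
  have s1: "smooth_on UNIV (\<lambda>q::phase. (snd q, 0::real^3))"
    by (intro smooth_intros open_UNIV)
  have "ext_d T_cot_minus_zero liouville ?z ?v ?w = snd ?v \<bullet> fst ?w - snd ?w \<bullet> fst ?v"
    using ext_d_eq[OF curl_free_Tcot[OF z] s1 _ _ b1 T T]
    by (simp add: liouville_def inner_prod_def)
  also have "\<dots> = r * k1 - s * l1 + \<rho> * (l2 * d - k2 * c)"
    by (simp add: cot_vec_def inner_diff_left inner_diff_right inner_add_left inner_add_right fr algebra_simps)
  finally have L: "ext_d T_cot_minus_zero liouville ?z ?v ?w = r * k1 - s * l1 + \<rho> * (l2 * d - k2 * c)" .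
  let ?U = "UNIV \<times> (- {0}) :: phase set"
  let ?B = "\<lambda>q::phase. (0::real^3, (1 / norm (snd q)) *\<^sub>R cross3 (snd q) (fst q))"
  have U: "open ?U" by (intro open_Times) auto
  have sB: "smooth_on ?U ?B"
    by (intro smooth_intros U) auto
  have BT: "rho_times \<alpha> q v = ?B q \<bullet> v"
    if q: "q \<in> T_cot_minus_zero" and v: "v \<in> tangent_space T_cot_minus_zero q" for q v
  proof -
    obtain x Y a A where xY: "q = (x, Y)" "v = (a, A)" by (cases q, cases v)
    have Y: "Y \<noteq> 0" using q by (simp add: xY Tcot_iff)
    let ?u = "\<lambda>v. (fst v, snd v /\<^sub>R norm Y - ((Y \<bullet> snd v) / norm Y ^ 3) *\<^sub>R Y)"
    have td: "tdiff T_cot_minus_zero unit_covector q v = ?u v"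
      using tdiff_eq[OF unit_covector_smooth _ _ unit_covector_has_derivative[OF Y, of x] v[unfolded xY]] Y
      by (simp add: xY)
    have tT: "?u v \<in> tangent_space ST_cot (unit_covector q)"
      using smooth_map_tangent[OF unit_covector_smooth _ _ unit_covector_has_derivative[OF Y, of x] v[unfolded xY],
          of ST_cot] Y
      by (simp add: xY unit_covector_in_ST)
    have "\<alpha> (unit_covector q) (?u v) = cross3 (Y /\<^sub>R norm Y) x \<bullet> (A /\<^sub>R norm Y - ((Y \<bullet> A) / norm Y ^ 3) *\<^sub>R Y)"
      using connection_form_value[OF \<alpha>, of x "Y /\<^sub>R norm Y"] unit_covector_in_ST[OF q] tT
      by (simp add: xY unit_covector_def rho_def)
    then show ?thesis
      unfolding rho_times_def pullback_def td
      using Y by (simp add: rho_def xY inner_diff_right cross_mult_left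
          dot_cross_self inner_commute[of _ Y] divide_simps mult_ac)
  qed
  have DB: "(?B has_derivative (\<lambda>v. (0, (1 / \<rho>) *\<^sub>R (cross3 (\<rho> *\<^sub>R y) (fst v) + cross3 (snd v) x)
     - ((y \<bullet> snd v) / \<rho>\<^sup>2) *\<^sub>R cross3 (\<rho> *\<^sub>R y) x))) (at ?z)"
    using \<rho> f by (auto intro!: derivative_eq_intros bounded_bilinear.FDERIV[OF bounded_bilinear_cross3]
        simp: power2_eq_square)
  have "ext_d T_cot_minus_zero (rho_times \<alpha>) ?z ?v ?w =
    (0, (1 / \<rho>) *\<^sub>R (cross3 (\<rho> *\<^sub>R y) (fst ?v) + cross3 (snd ?v) x)
     - ((y \<bullet> snd ?v) / \<rho>\<^sup>2) *\<^sub>R cross3 (\<rho> *\<^sub>R y) x) \<bullet> ?w -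
    (0, (1 / \<rho>) *\<^sub>R (cross3 (\<rho> *\<^sub>R y) (fst ?w) + cross3 (snd ?w) x)
     - ((y \<bullet> snd ?w) / \<rho>\<^sup>2) *\<^sub>R cross3 (\<rho> *\<^sub>R y) x) \<bullet> ?v"
    by (rule ext_d_eq[OF curl_free_Tcot[OF z] sB _ _ DB T T]) (use f \<rho> BT in auto)
  also have "\<dots> = (- c *\<^sub>R y + l2 *\<^sub>R x) \<bullet> snd ?w - (- d *\<^sub>R y + k2 *\<^sub>R x) \<bullet> snd ?v"
  proof -
    have "(1 / \<rho>) *\<^sub>R (cross3 (\<rho> *\<^sub>R y) (fst (cot_vec x y \<rho> l1 l2 c r)) + cross3 (snd (cot_vec x y \<rho> l1 l2 c r)) x)
     - ((y \<bullet> snd (cot_vec x y \<rho> l1 l2 c r)) / \<rho>\<^sup>2) *\<^sub>R cross3 (\<rho> *\<^sub>R y) x = - c *\<^sub>R y + l2 *\<^sub>R x" for l1 l2 c r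
      using \<rho> by (simp add: cot_vec_def Cross3.left_diff_distrib Cross3.right_diff_distrib cross_add_left
          cross_mult_left cross_mult_right fr inner_diff_right inner_add_right power2_eq_square algebra_simps)
    then show ?thesis
      by (simp add: inner_prod_def)
  qed
  also have "\<dots> = r * d - s * c + \<rho> * (l1 * k2 - k1 * l2)"
    by (simp add: cot_vec_def inner_diff_left inner_diff_right inner_add_left inner_add_right fr algebra_simps)
  finally show ?thesis
    by (simp add: omega_def L)
qed

subsection \<open>The perturbed Hamiltonians\<close>

text \<open>Up to the factor \<open>\<epsilon>\<close>, the second summand is the Hamiltonian of the rotation about the fixed
  axis with respect to the symplectic form of the angle \<open>\<theta>\<close>. The pull-back of this function along
  \<open>u \<mapsto> (rot u e1, rot u e3)\<close> is \<open>tilt\<close>.\<close>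

definition katok_norm :: "real \<Rightarrow> real \<Rightarrow> phase \<Rightarrow> real" where
  "katok_norm \<theta> \<epsilon> z = norm (snd z) + \<epsilon> * (cos \<theta> * norm (snd z) * (fst z \<bullet> e1)
     + sin \<theta> * (cross3 (snd z) (fst z) \<bullet> e1))"

definition katok_ham :: "real \<Rightarrow> real \<Rightarrow> phase \<Rightarrow> real" where
  "katok_ham \<theta> \<epsilon> z = (katok_norm \<theta> \<epsilon> z)\<^sup>2 / 2"

definition katok_field :: "real \<Rightarrow> real \<Rightarrow> phase \<Rightarrow> phase" where
  "katok_field \<theta> \<epsilon> z =
    (sin \<theta> *\<^sub>R (snd z /\<^sub>R norm (snd z)) + \<epsilon> *\<^sub>R cross3 (fst z) e1,
     cos \<theta> *\<^sub>R cross3 (snd z) (fst z) - (sin \<theta> * norm (snd z)) *\<^sub>R fst z + \<epsilon> *\<^sub>R cross3 (snd z) e1)"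

lemma katok_ham_0: "katok_ham \<theta> 0 = kinetic"
  by (simp add: katok_ham_def katok_norm_def kinetic_def fun_eq_iff)

lemma katok_norm_frame:
  assumes "norm y = 1" "\<rho> > 0"
  shows "katok_norm \<theta> \<epsilon> (x, \<rho> *\<^sub>R y) = \<rho> * (1 + \<epsilon> * ((cos \<theta> *\<^sub>R x + sin \<theta> *\<^sub>R cross3 y x) \<bullet> e1))"
  using assms by (simp add: katok_norm_def cross_mult_left inner_add_left algebra_simps)

text \<open>The vector \<open>cos \<theta> x + sin \<theta> (y \<times> x)\<close> has length 1, so
  \<open>\<epsilon> < 1\<close> suffices.\<close>

lemma frame_factor_pos:
  assumes f: "norm x = 1" "norm y = 1" "x \<bullet> y = 0" and \<epsilon>: "0 \<le> \<epsilon>" "\<epsilon> < 1"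
  shows "1 + \<epsilon> * ((cos \<theta> *\<^sub>R x + sin \<theta> *\<^sub>R cross3 y x) \<bullet> e1) > 0"
proof -
  let ?n = "cos \<theta> *\<^sub>R x + sin \<theta> *\<^sub>R cross3 y x"
  have "?n \<bullet> ?n = 1"
    by (simp add: inner_add_left inner_add_right frame_products[OF f] flip: power2_eq_square)
  then have "norm ?n = 1"
    by (simp add: norm_eq_1)
  then have "\<bar>?n \<bullet> e1\<bar> \<le> 1"
    using Cauchy_Schwarz_ineq2[of ?n e1] by simp
  then have "\<bar>\<epsilon> * (?n \<bullet> e1)\<bar> \<le> \<epsilon> * 1"
    unfolding abs_mult using \<epsilon> by (intro mult_mono) auto
  then show ?thesis using \<epsilon> by simp
qed

lemma katok_level_iff:
  assumes f: "norm x = 1" "norm y = 1" "x \<bullet> y = 0" and \<rho>: "\<rho> > 0" and \<epsilon>: "0 \<le> \<epsilon>" "\<epsilon> < 1"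
  shows "(x, \<rho> *\<^sub>R y) \<in> level (katok_ham \<theta> \<epsilon>) (1/2) \<longleftrightarrow>
    \<rho> * (1 + \<epsilon> * ((cos \<theta> *\<^sub>R x + sin \<theta> *\<^sub>R cross3 y x) \<bullet> e1)) = 1"
proof -
  let ?h = "\<rho> * (1 + \<epsilon> * ((cos \<theta> *\<^sub>R x + sin \<theta> *\<^sub>R cross3 y x) \<bullet> e1))"
  have h: "?h > 0"
    using frame_factor_pos[OF f \<epsilon>] \<rho> by simp
  have "(x, \<rho> *\<^sub>R y) \<in> T_cot_minus_zero"
    using f \<rho> by (auto simp: Tcot_iff)
  moreover have "katok_ham \<theta> \<epsilon> (x, \<rho> *\<^sub>R y) = 1/2 \<longleftrightarrow> ?h\<^sup>2 = 1"
    unfolding katok_ham_def katok_norm_frame[OF f(2) \<rho>] by simp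
  moreover have "?h\<^sup>2 = 1 \<longleftrightarrow> ?h = 1"
    using h power2_eq_1_iff[of ?h] by auto
  ultimately show ?thesis
    by (simp add: level_def)
qed

lemma katok_ham_smooth:
  "smooth_on (UNIV \<times> (UNIV \<times> (- {0}))) (\<lambda>(\<epsilon>, z). katok_ham \<theta> \<epsilon> z)"
  "smooth_on (UNIV \<times> (- {0})) (katok_ham \<theta> \<epsilon>)"
proof -
  have 1: "open (UNIV \<times> (UNIV \<times> (- {0})) :: (real \<times> phase) set)" "open (UNIV \<times> (- {0}) :: phase set)"
    by (intro open_Times open_UNIV; auto)+
  show "smooth_on (UNIV \<times> (UNIV \<times> (- {0}))) (\<lambda>(\<epsilon>, z). katok_ham \<theta> \<epsilon> z)"
    unfolding katok_ham_def katok_norm_def split_def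
    by (intro smooth_intros 1) auto
  show "smooth_on (UNIV \<times> (- {0})) (katok_ham \<theta> \<epsilon>)"
    unfolding katok_ham_def [abs_def] katok_norm_def
    by (intro smooth_intros 1) auto
qed

lemma katok_ham_has_derivative:
  assumes f: "norm x = 1" "norm y = 1" "x \<bullet> y = 0" and \<rho>: "\<rho> > 0"
  shows "(katok_ham \<theta> \<epsilon> has_derivative (\<lambda>v. katok_norm \<theta> \<epsilon> (x, \<rho> *\<^sub>R y) * (y \<bullet> snd v +
      \<epsilon> * (cos \<theta> * ((y \<bullet> snd v) * (x \<bullet> e1) + \<rho> * (fst v \<bullet> e1))
        + sin \<theta> * ((cross3 (\<rho> *\<^sub>R y) (fst v) + cross3 (snd v) x) \<bullet> e1))))) (at (x, \<rho> *\<^sub>R y))"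
proof -
  have n: "(katok_norm \<theta> \<epsilon> has_derivative (\<lambda>v. y \<bullet> snd v +
      \<epsilon> * (cos \<theta> * ((y \<bullet> snd v) * (x \<bullet> e1) + \<rho> * (fst v \<bullet> e1))
        + sin \<theta> * ((cross3 (\<rho> *\<^sub>R y) (fst v) + cross3 (snd v) x) \<bullet> e1)))) (at (x, \<rho> *\<^sub>R y))"
    unfolding katok_norm_def [abs_def] using \<rho> f
    by (auto intro!: derivative_eq_intros bounded_bilinear.FDERIV[OF bounded_bilinear_cross3]
        simp: algebra_simps)
  show ?thesis
    unfolding katok_ham_def [abs_def]
    by (rule has_derivative_eq_rhs, rule has_derivative_divide', rule has_derivative_power, rule n)
      (auto simp: algebra_simps)
qed

text \<open>In the coordinates of \<open>cot_vec\<close> the symplectic form splits into two rotations by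
  the angle \<open>\<theta>\<close>, which gives both the verification and the uniqueness.\<close>

lemma ham_field_katok:
  assumes \<alpha>: "connection_form \<alpha>" and \<epsilon>: "0 \<le> \<epsilon>" "\<epsilon> < 1"
    and z: "z \<in> level (katok_ham \<theta> \<epsilon>) (1/2)"
  shows "X_ham \<alpha> \<theta> (katok_ham \<theta> \<epsilon>) z = katok_field \<theta> \<epsilon> z"
proof -
  obtain x Y where xY: "z = (x, Y)" by (cases z)
  have zT: "(x, Y) \<in> T_cot_minus_zero"
    using z by (simp add: level_def xY)
  then obtain \<rho> y where \<rho>: "\<rho> > 0" "Y = \<rho> *\<^sub>R y" and f: "norm x = 1" "norm y = 1" "x \<bullet> y = 0"
    by (rule Tcot_frame)
  note fr = frame_products[OF f]
  let ?m = "cross3 y x" and ?c = "cos \<theta>" and ?s = "sin \<theta>"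
  define g where "g = ?c * (x \<bullet> e1) + ?s * (?m \<bullet> e1)"
  have lev: "\<rho> * (1 + \<epsilon> * g) = 1"
    using z katok_level_iff[OF f \<rho>(1) \<epsilon>] by (simp add: xY \<rho>(2) g_def inner_add_left)
  have h1: "katok_norm \<theta> \<epsilon> (x, \<rho> *\<^sub>R y) = 1"
    using lev unfolding katok_norm_frame[OF f(2) \<rho>(1)] by (simp add: g_def inner_add_left)
  let ?x1 = "x \<bullet> e1" and ?y1 = "y \<bullet> e1" and ?m1 = "?m \<bullet> e1"
  have td: "tdiff T_cot_minus_zero (katok_ham \<theta> \<epsilon>) z (cot_vec x y \<rho> k1 k2 d r) =
      r * (1 + \<epsilon> * g) + \<epsilon> * \<rho> * (?c * (k1 * ?y1 - k2 * ?m1) + ?s * (k2 * ?x1 - d * ?y1))" for k1 k2 d r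
  proof -
    have "tdiff T_cot_minus_zero (katok_ham \<theta> \<epsilon>) z (cot_vec x y \<rho> k1 k2 d r) =
       (\<lambda>v. katok_norm \<theta> \<epsilon> (x, \<rho> *\<^sub>R y) * (y \<bullet> snd v +
      \<epsilon> * (cos \<theta> * ((y \<bullet> snd v) * (x \<bullet> e1) + \<rho> * (fst v \<bullet> e1))
        + sin \<theta> * ((cross3 (\<rho> *\<^sub>R y) (fst v) + cross3 (snd v) x) \<bullet> e1)))) (cot_vec x y \<rho> k1 k2 d r)"
      unfolding xY \<rho>(2) using f \<rho>
      by (intro tdiff_eq[OF katok_ham_smooth(2) _ _ katok_ham_has_derivative[OF f \<rho>(1)]]
          tangent_cot_vec(1)[OF f \<rho>(1)]) auto
    also have "\<dots> = r * (1 + \<epsilon> * g) + \<epsilon> * \<rho> * (?c * (k1 * ?y1 - k2 * ?m1) + ?s * (k2 * ?x1 - d * ?y1))"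
      unfolding h1 by (simp add: cot_vec_def Cross3.left_diff_distrib Cross3.right_diff_distrib cross_add_left
          cross_mult_left cross_mult_right fr inner_diff_right inner_add_right inner_diff_left inner_add_left
          g_def algebra_simps)
    finally show ?thesis .
  qed
  let ?l1 = "?s + \<epsilon> * ?m1" and ?l2 = "\<epsilon> * ?y1" and ?al = "?c + \<epsilon> * ?x1"
  have e: "e1 = ?x1 *\<^sub>R x + ?m1 *\<^sub>R ?m + ?y1 *\<^sub>R y"
    using frame_expansion[OF f, of e1] by (simp add: inner_commute)
  have cx: "cross3 x e1 = ?m1 *\<^sub>R y - ?y1 *\<^sub>R ?m" "cross3 y e1 = ?x1 *\<^sub>R ?m - ?m1 *\<^sub>R x"
    by (subst e, simp add: cross_add_right cross_mult_right fr)+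
  have Xf: "katok_field \<theta> \<epsilon> z = cot_vec x y \<rho> ?l1 ?l2 ?al 0"
    using \<rho> f by (simp add: katok_field_def xY cot_vec_def cross_mult_left cx algebra_simps)
  have om: "omega \<alpha> \<theta> z (cot_vec x y \<rho> l1 l2 c r) (cot_vec x y \<rho> k1 k2 d s) =
    sin \<theta> * (r * k1 - s * l1 + \<rho> * (l2 * d - k2 * c)) +
    cos \<theta> * (r * d - s * c + \<rho> * (l1 * k2 - k1 * l2))" for l1 l2 c r k1 k2 d s
    unfolding xY \<rho>(2) by (rule omega_cot_vec[OF \<alpha> f \<rho>(1)])
  have T: "cot_vec x y \<rho> l1 l2 c r \<in> tangent_space T_cot_minus_zero z" for l1 l2 c r
    unfolding xY \<rho>(2) by (rule tangent_cot_vec(1)[OF f \<rho>(1)])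
  have T': "\<exists>l1 l2 c r. v = cot_vec x y \<rho> l1 l2 c r" if "v \<in> tangent_space T_cot_minus_zero z" for v
    using that unfolding xY \<rho>(2) by (rule tangent_cot_vec(2)[OF f \<rho>(1)])
  have cs: "?s * ?s + ?c * ?c = 1"
    using sin_cos_squared_add[of \<theta>] by (simp add: power2_eq_square)
  have main: "omega \<alpha> \<theta> z (cot_vec x y \<rho> ?l1 ?l2 ?al 0) (cot_vec x y \<rho> k1 k2 d s)
      = - tdiff T_cot_minus_zero (katok_ham \<theta> \<epsilon>) z (cot_vec x y \<rho> k1 k2 d s)" for k1 k2 d s
    unfolding om td g_def using cs by algebra
  show ?thesis
    unfolding ham_field_def Xf
  proof (rule the_equality)
    show "cot_vec x y \<rho> ?l1 ?l2 ?al 0 \<in> tangent_space T_cot_minus_zero z \<and>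
      (\<forall>w\<in>tangent_space T_cot_minus_zero z. omega \<alpha> \<theta> z (cot_vec x y \<rho> ?l1 ?l2 ?al 0) w
        = - tdiff T_cot_minus_zero (katok_ham \<theta> \<epsilon>) z w)"
    proof (intro conjI ballI T)
      fix w assume "w \<in> tangent_space T_cot_minus_zero z"
      then obtain k1 k2 d s where w: "w = cot_vec x y \<rho> k1 k2 d s"
        using T' by blast
      show "omega \<alpha> \<theta> z (cot_vec x y \<rho> ?l1 ?l2 ?al 0) w
        = - tdiff T_cot_minus_zero (katok_ham \<theta> \<epsilon>) z w"
        unfolding w by (rule main)
    qed
    fix X
    assume X: "X \<in> tangent_space T_cot_minus_zero z \<and>
      (\<forall>w\<in>tangent_space T_cot_minus_zero z. omega \<alpha> \<theta> z X w = - tdiff T_cot_minus_zero (katok_ham \<theta> \<epsilon>) z w)"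
    then obtain l1 l2 c r where Xv: "X = cot_vec x y \<rho> l1 l2 c r"
      using T' by blast
    have eq: "omega \<alpha> \<theta> z (cot_vec x y \<rho> l1 l2 c r) (cot_vec x y \<rho> k1 k2 d s)
      = omega \<alpha> \<theta> z (cot_vec x y \<rho> ?l1 ?l2 ?al 0) (cot_vec x y \<rho> k1 k2 d s)" for k1 k2 d s
      unfolding main using X T unfolding Xv by blast
    define p q t where "p = l1 - ?l1" and "q = \<rho> * (l2 - ?l2)" and "t = c - ?al"
    have E1: "?s * r - ?c * q = 0"
      using eq[of 1 0 0 0] unfolding om by (simp add: q_def algebra_simps)
    have E2: "?s * p + ?c * t = 0"
      using eq[of 0 0 0 1] unfolding om by (simp add: p_def t_def algebra_simps)
    have E3: "?s * q + ?c * r = 0"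
      using eq[of 0 0 1 0] unfolding om by (simp add: q_def algebra_simps)
    have "\<rho> * (?c * p - ?s * t) = 0"
      using eq[of 0 1 0 0] unfolding om by (simp add: p_def t_def algebra_simps)
    then have E4: "?c * p - ?s * t = 0"
      using \<rho> by simp
    have "r = 0" "q = 0"
      using E1 E3 cs by algebra+
    moreover have "p = 0" "t = 0"
      using E2 E4 cs by algebra+
    ultimately show "X = cot_vec x y \<rho> ?l1 ?l2 ?al 0"
      using \<rho> unfolding Xv p_def q_def t_def by simp
  qed
qed

section \<open>The double cover and the Reeb flows\<close>

subsection \<open>The double cover\<close>

definition cover :: "real \<Rightarrow> real \<Rightarrow> quat \<Rightarrow> phase" where
  "cover \<theta> \<epsilon> u = (rot u e1, (1 / tilt (axis_at \<theta>) \<epsilon> u) *\<^sub>R rot u e3)"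

definition lift :: "quat \<Rightarrow> phase \<Rightarrow> quat" where
  "lift p z = lift_from p (fst z) (snd z /\<^sub>R norm (snd z))"

lemma rot_frame:
  assumes "norm u = 1"
  shows "norm (rot u e1) = 1" "norm (rot u e3) = 1" "rot u e1 \<bullet> rot u e3 = 0"
    "cross3 (rot u e3) (rot u e1) = rot u e2"
  using assms by (simp_all add: norm_rot rot_inner rot_cross cross_basis inner_axis_axis)

lemma tilt_frame:
  assumes "norm u = 1"
  shows "tilt (axis_at \<theta>) \<epsilon> u =
    1 + \<epsilon> * ((cos \<theta> *\<^sub>R rot u e1 + sin \<theta> *\<^sub>R cross3 (rot u e3) (rot u e1)) \<bullet> e1)"
  unfolding tilt_rot rot_frame(4)[OF assms] by (simp add: axis_at_def rot_linear)

lemma tilt_axis_pos: "0 \<le> \<epsilon> \<Longrightarrow> \<epsilon> < 1 \<Longrightarrow> u \<in> S3 \<Longrightarrow> tilt (axis_at \<theta>) \<epsilon> u > 0"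
  by (simp add: tilt_pos S3_iff)

lemma cover_in_level:
  assumes \<epsilon>: "0 \<le> \<epsilon>" "\<epsilon> < 1" and u: "u \<in> S3"
  shows "cover \<theta> \<epsilon> u \<in> level (katok_ham \<theta> \<epsilon>) (1/2)"
proof -
  have n: "norm u = 1" using u by (simp add: S3_iff)
  have t: "tilt (axis_at \<theta>) \<epsilon> u > 0" by (rule tilt_axis_pos[OF \<epsilon> u])
  show ?thesis
    unfolding cover_def using t
    by (subst katok_level_iff[OF rot_frame(1-3)[OF n] _ \<epsilon>]) (simp_all flip: tilt_frame[OF n])
qed

lemma level_frame:
  assumes \<epsilon>: "0 \<le> \<epsilon>" "\<epsilon> < 1" and z: "z \<in> level (katok_ham \<theta> \<epsilon>) (1/2)"
  obtains x y \<rho> where "z = (x, \<rho> *\<^sub>R y)" "norm x = 1" "norm y = 1" "x \<bullet> y = 0" "\<rho> > 0"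
    "\<rho> * (1 + \<epsilon> * ((cos \<theta> *\<^sub>R x + sin \<theta> *\<^sub>R cross3 y x) \<bullet> e1)) = 1"
proof -
  obtain x Y where xY: "z = (x, Y)" by (cases z)
  have "(x, Y) \<in> T_cot_minus_zero"
    using z by (simp add: level_def xY)
  then obtain \<rho> y where \<rho>: "\<rho> > 0" "Y = \<rho> *\<^sub>R y" and f: "norm x = 1" "norm y = 1" "x \<bullet> y = 0"
    by (rule Tcot_frame)
  show ?thesis
    using katok_level_iff[OF f \<rho>(1) \<epsilon>] z by (intro that[OF _ f \<rho>(1)]) (simp_all add: xY \<rho>(2))
qed

lemma cover_of_lift:
  assumes \<epsilon>: "0 \<le> \<epsilon>" "\<epsilon> < 1" and z: "z \<in> level (katok_ham \<theta> \<epsilon>) (1/2)" and L: "lift p z \<noteq> 0"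
  shows "lift p z /\<^sub>R norm (lift p z) \<in> S3"
    and "cover \<theta> \<epsilon> (lift p z /\<^sub>R norm (lift p z)) = z"
proof -
  obtain x y \<rho> where zz: "z = (x, \<rho> *\<^sub>R y)" and f: "norm x = 1" "norm y = 1" "x \<bullet> y = 0" and \<rho>: "\<rho> > 0"
    and lev: "\<rho> * (1 + \<epsilon> * ((cos \<theta> *\<^sub>R x + sin \<theta> *\<^sub>R cross3 y x) \<bullet> e1)) = 1"
    using \<epsilon> z by (rule level_frame)
  have l: "lift p z = lift_from p x y"
    using \<rho> f by (simp add: lift_def zz)
  define u where "u = lift p z /\<^sub>R norm (lift p z)"
  have u: "norm u = 1" "rot u e1 = x" "rot u e3 = y"
    using rot_of_lift[OF f, of p] L unfolding u_def l by simp_all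
  have "\<rho> * tilt (axis_at \<theta>) \<epsilon> u = 1"
    unfolding tilt_frame[OF u(1)] u(2,3) by (rule lev)
  then have "\<rho> = 1 / tilt (axis_at \<theta>) \<epsilon> u"
    by (metis mult_eq_0_iff nonzero_eq_divide_eq zero_neq_one)
  then show "u \<in> S3" "cover \<theta> \<epsilon> u = z"
    using u by (simp_all add: S3_iff cover_def zz)
qed

lemma lift_of_cover:
  assumes \<epsilon>: "0 \<le> \<epsilon>" "\<epsilon> < 1" and u: "u \<in> S3"
  shows "lift p (cover \<theta> \<epsilon> u) = (4 * (p \<bullet> u)) *\<^sub>R u"
proof -
  have n: "norm u = 1" using u by (simp add: S3_iff)
  have t: "tilt (axis_at \<theta>) \<epsilon> u > 0" by (rule tilt_axis_pos[OF \<epsilon> u])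
  then have "snd (cover \<theta> \<epsilon> u) /\<^sub>R norm (snd (cover \<theta> \<epsilon> u)) = rot u e3"
    using rot_frame(2)[OF n] by (simp add: cover_def)
  then show ?thesis
    using lift_from_rot[OF n] by (simp add: lift_def cover_def)
qed

lemma cover_surj:
  assumes \<epsilon>: "0 \<le> \<epsilon>" "\<epsilon> < 1"
  shows "cover \<theta> \<epsilon> ` S3 = level (katok_ham \<theta> \<epsilon>) (1/2)"
proof
  show "level (katok_ham \<theta> \<epsilon>) (1/2) \<subseteq> cover \<theta> \<epsilon> ` S3"
  proof
    fix z assume z: "z \<in> level (katok_ham \<theta> \<epsilon>) (1/2)"
    obtain p where "lift p z \<noteq> 0"
      unfolding lift_def using lift_from_nonzero by blast
    from cover_of_lift[OF \<epsilon> z this] show "z \<in> cover \<theta> \<epsilon> ` S3"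
      by (metis imageI)
  qed
qed (use cover_in_level[OF \<epsilon>] in blast)

lemma cover_eq_iff:
  assumes \<epsilon>: "0 \<le> \<epsilon>" "\<epsilon> < 1" and u: "u \<in> S3" and v: "v \<in> S3"
  shows "cover \<theta> \<epsilon> u = cover \<theta> \<epsilon> v \<longleftrightarrow> v = u \<or> v = - u"
proof
  assume eq: "cover \<theta> \<epsilon> u = cover \<theta> \<epsilon> v"
  have n: "norm u = 1" "norm v = 1" using u v by (simp_all add: S3_iff)
  have t: "tilt (axis_at \<theta>) \<epsilon> u > 0" "tilt (axis_at \<theta>) \<epsilon> v > 0" by (rule tilt_axis_pos[OF \<epsilon>] u v)+
  have "rot u e3 = snd (cover \<theta> \<epsilon> u) /\<^sub>R norm (snd (cover \<theta> \<epsilon> u))"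
    "rot v e3 = snd (cover \<theta> \<epsilon> v) /\<^sub>R norm (snd (cover \<theta> \<epsilon> v))"
    using rot_frame(2)[OF n(1)] rot_frame(2)[OF n(2)] t by (simp_all add: cover_def)
  then have "rot u e3 = rot v e3"
    by (simp only: eq)
  then show "v = u \<or> v = - u"
    using rot_eq_iff[OF n] eq by (simp add: cover_def)
next
  have "tilt (axis_at \<theta>) \<epsilon> (- u) = tilt (axis_at \<theta>) \<epsilon> u"
    by (simp add: tilt_rot)
  then show "v = u \<or> v = - u \<Longrightarrow> cover \<theta> \<epsilon> u = cover \<theta> \<epsilon> v"
    by (auto simp: cover_def)
qed

lemma cover_smooth: "smooth_on {u. tilt (axis_at \<theta>) \<epsilon> u \<noteq> 0} (cover \<theta> \<epsilon>)"
proof -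
  have "smooth_on {u. tilt (axis_at \<theta>) \<epsilon> u \<noteq> 0} (tilt (axis_at \<theta>) \<epsilon>)"
    using tilt_smooth(2) tilt_domain_open(1) by (rule smooth_on_subset) simp
  then show ?thesis
    unfolding cover_def [abs_def]
    by (intro smooth_intros tilt_domain_open(1)) auto
qed

definition lift_domain :: "quat \<Rightarrow> phase set" where
  "lift_domain p = {z. snd z \<noteq> 0 \<and> lift p z \<noteq> 0}"

lemma lift_smooth:
  "open (lift_domain p)" "smooth_on (lift_domain p) (\<lambda>z. lift p z /\<^sub>R norm (lift p z))"
proof -
  let ?U = "UNIV \<times> (- {0}) :: phase set"
  have U: "open ?U" by (intro open_Times) auto
  have s: "smooth_on ?U (lift p)"
    unfolding lift_def [abs_def] lift_from_def pure_def by (intro smooth_intros U) auto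
  have "open (?U \<inter> lift p -` (- {0}))"
    by (rule continuous_open_preimage[OF smooth_on_imp_continuous_on[OF s] U]) auto
  moreover have e: "?U \<inter> lift p -` (- {0}) = lift_domain p"
    by (auto simp: lift_domain_def)
  ultimately show op: "open (lift_domain p)" by simp
  have "smooth_on (lift_domain p) (lift p)"
    using s op by (rule smooth_on_subset) (use e in auto)
  then show "smooth_on (lift_domain p) (\<lambda>z. lift p z /\<^sub>R norm (lift p z))"
    by (intro smooth_intros) (auto simp: lift_domain_def)
qed

lemma cover_in_lift_domain:
  assumes \<epsilon>: "0 \<le> \<epsilon>" "\<epsilon> < 1" and u: "u \<in> S3"
  shows "cover \<theta> \<epsilon> u \<in> lift_domain p \<longleftrightarrow> p \<bullet> u \<noteq> 0"
proof -
  have "snd (cover \<theta> \<epsilon> u) \<noteq> 0"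
    using tilt_axis_pos[OF \<epsilon> u, of \<theta>] rot_frame(2)[of u] u by (auto simp: cover_def S3_iff)
  moreover have "u \<noteq> 0" using u by (auto simp: S3_iff)
  ultimately show ?thesis
    by (simp add: lift_domain_def lift_of_cover[OF \<epsilon> u])
qed

lemma normalized_lift_of_cover:
  assumes \<epsilon>: "0 \<le> \<epsilon>" "\<epsilon> < 1" and u: "u \<in> S3"
  shows "lift p (cover \<theta> \<epsilon> u) /\<^sub>R norm (lift p (cover \<theta> \<epsilon> u)) = sgn (p \<bullet> u) *\<^sub>R u"
proof -
  have "norm u = 1" using u by (simp add: S3_iff)
  then have "norm (lift p (cover \<theta> \<epsilon> u)) = 4 * \<bar>p \<bullet> u\<bar>"
    unfolding lift_of_cover[OF \<epsilon> u] norm_scaleR by (simp add: abs_mult)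
  moreover have "inverse (4 * \<bar>c\<bar>) * (4 * c) = sgn c" for c :: real
    by (cases "c = 0"; cases "c > 0") (auto simp: field_simps)
  ultimately show ?thesis
    unfolding lift_of_cover[OF \<epsilon> u] by (simp only: scaleR_scaleR)
qed

text \<open>Over the image of \<open>p\<close> the two sheets are the hemispheres \<open>p \<bullet> u >
  0\<close> and \<open>p \<bullet> u < 0\<close>, on which \<open>lift p\<close> and its
  negative invert the cover.\<close>

lemma cover_covering_space:
  assumes \<epsilon>: "0 \<le> \<epsilon>" "\<epsilon> < 1"
  shows "covering_space S3 (cover \<theta> \<epsilon>) (level (katok_ham \<theta> \<epsilon>) (1/2))"
proof -
  let ?N = "level (katok_ham \<theta> \<epsilon>) (1/2)" and ?f = "cover \<theta> \<epsilon>"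
  have cont: "continuous_on S3 ?f"
    by (rule continuous_on_subset[OF smooth_on_imp_continuous_on[OF cover_smooth]])
      (use tilt_axis_pos[OF \<epsilon>, of _ \<theta>] in force)
  have sheets: "\<exists>T. z \<in> T \<and> openin (top_of_set ?N) T \<and>
      (\<exists>v. \<Union> v = S3 \<inter> ?f -` T \<and> (\<forall>u\<in>v. openin (top_of_set S3) u) \<and>
        pairwise disjnt v \<and> (\<forall>u\<in>v. \<exists>q. homeomorphism u T ?f q))"
    if z: "z \<in> ?N" for z
  proof -
    obtain p where p: "p \<in> S3" "z = ?f p"
      using z cover_surj[OF \<epsilon>] by (metis imageE)
    let ?T = "?N \<inter> lift_domain p"
    let ?A = "\<lambda>s::real. {u \<in> S3. s * (p \<bullet> u) > 0}"
    let ?g = "\<lambda>z. lift p z /\<^sub>R norm (lift p z)"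
    have zT: "z \<in> ?T"
      using z p cover_in_lift_domain[OF \<epsilon> p(1)] by (auto simp: S3_iff)
    have oT: "openin (top_of_set ?N) ?T"
      using lift_smooth(1) by (rule openin_open_Int)
    have oA: "openin (top_of_set S3) (?A s)" for s
    proof -
      have "open ((\<lambda>u. s * (p \<bullet> u)) -` {0<..})"
        by (intro open_vimage continuous_intros open_greaterThan)
      then have "openin (top_of_set S3) (S3 \<inter> (\<lambda>u. s * (p \<bullet> u)) -` {0<..})"
        by (rule openin_open_Int)
      moreover have "S3 \<inter> (\<lambda>u. s * (p \<bullet> u)) -` {0<..} = ?A s" by auto
      ultimately show ?thesis by simp
    qed
    have hom: "homeomorphism (?A s) ?T ?f (\<lambda>z. s *\<^sub>R ?g z)" if s: "s = 1 \<or> s = -1" for s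
    proof (rule homeomorphismI)
      show "continuous_on (?A s) ?f"
        using cont by (rule continuous_on_subset) auto
      show "continuous_on ?T (\<lambda>z. s *\<^sub>R ?g z)"
        by (intro continuous_on_scaleR continuous_on_const
            continuous_on_subset[OF smooth_on_imp_continuous_on[OF lift_smooth(2)]]) auto
      show "?f ` ?A s \<subseteq> ?T"
        by (auto simp: cover_in_level[OF \<epsilon>] cover_in_lift_domain[OF \<epsilon>])
      show "s *\<^sub>R ?g (?f u) = u" if "u \<in> ?A s" for u
      proof -
        have "sgn (p \<bullet> u) = s" using that s by auto
        then show ?thesis
          using that s by (subst normalized_lift_of_cover[OF \<epsilon>]) auto
      qed
      have gS: "?g z \<in> S3" "?f (?g z) = z" if "z \<in> ?T" for z
        using that cover_of_lift[OF \<epsilon>, of z \<theta> p] by (auto simp: lift_domain_def)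
      have fs: "?f (s *\<^sub>R ?g z) = z" if "z \<in> ?T" for z
        using gS[OF that] s cover_eq_iff[OF \<epsilon> gS(1)[OF that], of "- ?g z" \<theta>]
        by (auto simp: S3_iff)
      then show "?f (s *\<^sub>R ?g z) = z" if "z \<in> ?T" for z
        using that .
      show "(\<lambda>z. s *\<^sub>R ?g z) ` ?T \<subseteq> ?A s"
      proof
        fix w assume "w \<in> (\<lambda>z. s *\<^sub>R ?g z) ` ?T"
        then obtain z where z: "z \<in> ?T" and w: "w = s *\<^sub>R ?g z" by blast
        have "?g z = sgn (p \<bullet> ?g z) *\<^sub>R ?g z"
          using normalized_lift_of_cover[OF \<epsilon> gS(1)[OF z], of p \<theta>] gS(2)[OF z] by simp
        moreover have "?g z \<noteq> 0"
          using gS(1)[OF z] by (auto simp: S3_iff)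
        ultimately have "sgn (p \<bullet> ?g z) = 1"
          by (metis scaleR_cancel_right scaleR_one)
        then have "p \<bullet> ?g z > 0" by (simp only: sgn_1_pos)
        moreover have "s * (p \<bullet> w) = p \<bullet> ?g z"
          using s by (auto simp: w)
        moreover have "w \<in> S3"
          using gS(1)[OF z] s by (auto simp: w S3_iff)
        ultimately show "w \<in> ?A s" by simp
      qed
    qed
    have "?f u \<in> ?T \<longleftrightarrow> p \<bullet> u \<noteq> 0" if "u \<in> S3" for u
      using that by (simp add: cover_in_level[OF \<epsilon>] cover_in_lift_domain[OF \<epsilon>])
    then have "S3 \<inter> ?f -` ?T = {u \<in> S3. p \<bullet> u \<noteq> 0}" by blast
    moreover have "\<Union> {?A 1, ?A (-1)} = {u \<in> S3. p \<bullet> u \<noteq> 0}"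
      by auto
    ultimately have "\<Union> {?A 1, ?A (-1)} = S3 \<inter> ?f -` ?T"
      by simp
    moreover have "pairwise disjnt {?A 1, ?A (-1)}"
      by (auto simp: pairwise_def disjnt_def)
    ultimately show ?thesis
      using zT oT oA hom
      by (intro exI[of _ ?T] conjI exI[of _ "{?A 1, ?A (-1)}"]) blast+
  qed
  show ?thesis
    unfolding covering_space_def by (intro conjI ballI sheets cont cover_surj[OF \<epsilon>])
qed

lemma cover_smooth_double_cover:
  assumes \<epsilon>: "0 \<le> \<epsilon>" "\<epsilon> < 1"
  shows "smooth_double_cover S3 (cover \<theta> \<epsilon>) (level (katok_ham \<theta> \<epsilon>) (1/2))"
  unfolding smooth_double_cover_def
proof (intro conjI ballI)
  let ?N = "level (katok_ham \<theta> \<epsilon>) (1/2)" and ?f = "cover \<theta> \<epsilon>"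
  have dom: "u \<in> {u. tilt (axis_at \<theta>) \<epsilon> u \<noteq> 0}" if "u \<in> S3" for u
    using tilt_axis_pos[OF \<epsilon> that, of \<theta>] by auto
  show "covering_space S3 ?f ?N"
    by (rule cover_covering_space[OF \<epsilon>])
  show "smooth_map S3 ?f"
    using dom cover_smooth by (rule smooth_mapI) auto
  fix p assume p: "p \<in> S3"
  let ?g = "\<lambda>z. lift p z /\<^sub>R norm (lift p z)"
  have op: "open {u. p \<bullet> u > 0}"
    by (rule open_halfspace_gt)
  show "bij_betw (tdiff S3 ?f p) (tangent_space S3 p) (tangent_space ?N (?f p))"
  proof (rule tdiff_bij_of_local_inverse[OF cover_smooth dom[OF p] _ _ lift_smooth(2) _ _ _ op])
    show "?f p \<in> lift_domain p"
      using cover_in_lift_domain[OF \<epsilon> p] p by (auto simp: S3_iff)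
    show "?g z \<in> S3" "?f (?g z) = z" if "z \<in> ?N" "z \<in> lift_domain p" for z
      using that cover_of_lift[OF \<epsilon>] by (auto simp: lift_domain_def)
    show "?f q \<in> lift_domain p \<and> ?g (?f q) = q" if "q \<in> S3" "q \<in> {u. p \<bullet> u > 0}" for q
      using that by (simp add: cover_in_lift_domain[OF \<epsilon>] normalized_lift_of_cover[OF \<epsilon>])
    show "p \<in> {u. p \<bullet> u > 0}"
      using p by (auto simp: S3_iff)
  qed (use cover_in_level[OF \<epsilon>] p in auto)
next
  fix z assume "z \<in> level (katok_ham \<theta> \<epsilon>) (1/2)"
  then obtain u where u: "u \<in> S3" "z = cover \<theta> \<epsilon> u"
    using cover_surj[OF \<epsilon>] by (metis imageE)
  have "{p \<in> S3. cover \<theta> \<epsilon> p = z} = {u, - u}"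
  proof -
    have mu: "- u \<in> S3" using u by (simp add: S3_iff)
    have "cover \<theta> \<epsilon> (- u) = cover \<theta> \<epsilon> u"
      using cover_eq_iff[OF \<epsilon> u(1) mu, of \<theta>] by simp
    moreover have "p = u \<or> p = - u" if "p \<in> S3" "cover \<theta> \<epsilon> p = z" for p
      using cover_eq_iff[OF \<epsilon> u(1) that(1), of \<theta>] that(2) u(2) by simp
    ultimately show ?thesis
      using u mu by auto
  qed
  moreover have "u \<noteq> - u"
  proof
    assume "u = - u"
    then have "u \<bullet> u = - (u \<bullet> u)" by (metis inner_minus_right)
    then show False using u(1) by (simp add: S3_iff norm_eq_1)
  qed
  ultimately show "card {p \<in> S3. cover \<theta> \<epsilon> p = z} = 2"
    by simp
qed

text \<open>Left multiplication by the imaginary \<open>a\<close> acts on the frame before the rotation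
  and right multiplication by \<open>i\<close> acts after it.\<close>

lemma rot_derivative_reeb:
  assumes "norm u = 1"
  shows "snd (qconj (tilted_reeb a \<epsilon> u) \<star> pure b \<star> u + qconj u \<star> pure b \<star> tilted_reeb a \<epsilon> u)
    = rot u (cross3 b a) + \<epsilon> *\<^sub>R cross3 (rot u b) e1"
proof -
  have com: "pure c \<star> pure d - pure d \<star> pure c = 2 *\<^sub>R pure (cross3 c d)" for c d
    using cross_skew[of d c] by (simp add: pure_mult_pure pure_linear inner_commute scaleR_2)
  have qc: "qconj (tilted_reeb a \<epsilon> u) = - ((1/2) *\<^sub>R (qconj u \<star> pure a + \<epsilon> *\<^sub>R (pure e1 \<star> qconj u)))"
  proof -
    have "qconj (p + q) = qconj p + qconj q" for p q
      by (simp add: qconj_def)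
    then show ?thesis
      by (simp add: tilted_reeb_def qmult_distribs algebra_simps)
  qed
  have "qconj (tilted_reeb a \<epsilon> u) \<star> pure b \<star> u + qconj u \<star> pure b \<star> tilted_reeb a \<epsilon> u
    = (1/2) *\<^sub>R (qconj u \<star> (pure b \<star> pure a - pure a \<star> pure b) \<star> u)
      + (\<epsilon> / 2) *\<^sub>R (pure (rot u b) \<star> pure e1 - pure e1 \<star> pure (rot u b))"
    unfolding qc unfolding tilted_reeb_def pure_rot by (simp add: qmult_distribs qmult_assoc algebra_simps)
  also have "\<dots> = pure (rot u (cross3 b a) + \<epsilon> *\<^sub>R cross3 (rot u b) e1)"
    unfolding com by (simp add: qmult_distribs pure_rot pure_linear)
  finally show ?thesis by simp
qed

lemma cover_derivative_reeb:
  assumes \<epsilon>: "0 \<le> \<epsilon>" "\<epsilon> < 1" and u: "u \<in> S3"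
  obtains D where "(cover \<theta> \<epsilon> has_derivative D) (at u)"
    and "D (tilted_reeb (axis_at \<theta>) \<epsilon> u) = katok_field \<theta> \<epsilon> (cover \<theta> \<epsilon> u)"
proof -
  let ?a = "axis_at \<theta>" and ?R = "tilted_reeb (axis_at \<theta>) \<epsilon> u"
  let ?T = "tilt ?a \<epsilon> u"
  have n: "norm u = 1" using u by (simp add: S3_iff)
  have t: "?T > 0" by (rule tilt_axis_pos[OF \<epsilon> u])
  let ?r = "\<lambda>b v. snd (qconj v \<star> pure b \<star> u + qconj u \<star> pure b \<star> v)"
  let ?d = "\<lambda>v. \<epsilon> * ((pure ?a \<star> v) \<bullet> (u \<star> pure e1) + (pure ?a \<star> u) \<bullet> (v \<star> pure e1))"
  have D: "(cover \<theta> \<epsilon> has_derivative (\<lambda>v. (?r e1 v,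
      (1 / ?T) *\<^sub>R ?r e3 v - (?d v / ?T\<^sup>2) *\<^sub>R rot u e3))) (at u)"
    unfolding cover_def [abs_def] using t
    by (auto intro!: derivative_eq_intros rot_has_derivative tilt_has_derivative simp: power2_eq_square)
  have d0: "?d ?R = 0"
    using tilt_derivative_reeb[OF n, of ?a \<epsilon>] by simp
  have cr: "cross3 e1 ?a = sin \<theta> *\<^sub>R e3" "cross3 e3 ?a = cos \<theta> *\<^sub>R e2 - sin \<theta> *\<^sub>R e1"
    by (simp_all add: axis_at_def cross_add_right cross_mult_right cross_basis)
  let ?x = "rot u e1" and ?y = "rot u e3"
  have "(?r e1 ?R, (1 / ?T) *\<^sub>R ?r e3 ?R - (?d ?R / ?T\<^sup>2) *\<^sub>R rot u e3) =
      (sin \<theta> *\<^sub>R ?y + \<epsilon> *\<^sub>R cross3 ?x e1,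
       (1 / ?T) *\<^sub>R (cos \<theta> *\<^sub>R rot u e2 - sin \<theta> *\<^sub>R ?x + \<epsilon> *\<^sub>R cross3 ?y e1))"
    unfolding d0 rot_derivative_reeb[OF n] cr by (simp add: rot_linear)
  also have "\<dots> = katok_field \<theta> \<epsilon> (cover \<theta> \<epsilon> u)"
    using t rot_frame[OF n]
    by (simp add: katok_field_def cover_def cross_mult_left algebra_simps)
  finally show ?thesis
    using that[OF D] by simp
qed

lemma tilted_reeb_flow_doubly_covers:
  assumes \<epsilon>: "0 \<le> \<epsilon>" "\<epsilon> < 1"
    and \<beta>: "form1_eq S3 \<beta> (tilted_form (axis_at \<theta>) \<epsilon>)"
    and X: "\<And>z. z \<in> level (katok_ham \<theta> \<epsilon>) (1/2) \<Longrightarrow> X z = katok_field \<theta> \<epsilon> z"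
  shows "reeb_flow_doubly_covers S3 \<beta> (level (katok_ham \<theta> \<epsilon>) (1/2)) X"
  unfolding reeb_flow_doubly_covers_def
proof (intro exI conjI ballI)
  show "smooth_double_cover S3 (cover \<theta> \<epsilon>) (level (katok_ham \<theta> \<epsilon>) (1/2))"
    by (rule cover_smooth_double_cover[OF \<epsilon>])
  fix u assume u: "u \<in> S3"
  obtain D where D: "(cover \<theta> \<epsilon> has_derivative D) (at u)"
    "D (tilted_reeb (axis_at \<theta>) \<epsilon> u) = katok_field \<theta> \<epsilon> (cover \<theta> \<epsilon> u)"
    using cover_derivative_reeb[OF \<epsilon> u] by blast
  have "reeb_field S3 \<beta> u = tilted_reeb (axis_at \<theta>) \<epsilon> u"
    unfolding reeb_field_cong[OF \<beta>] by (rule tilted_reeb_field[OF norm_axis_at \<epsilon> u])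
  moreover have "tdiff S3 (cover \<theta> \<epsilon>) u (tilted_reeb (axis_at \<theta>) \<epsilon> u) = D (tilted_reeb (axis_at \<theta>) \<epsilon> u)"
    using tilt_axis_pos[OF \<epsilon> u, of \<theta>]
    by (intro tdiff_eq[OF cover_smooth _ _ D(1) tilted_reeb_tangent[OF u]]) auto
  ultimately show "tdiff S3 (cover \<theta> \<epsilon>) u (reeb_field S3 \<beta> u) = X (cover \<theta> \<epsilon> u)"
    using D(2) X[OF cover_in_level[OF \<epsilon> u]] by simp
qed

subsection \<open>Orbits of the Reeb flows\<close>

definition qexp :: "real^3 \<Rightarrow> real \<Rightarrow> quat" where
  "qexp a s = cos s *\<^sub>R q_one + sin s *\<^sub>R pure a"

definition reeb_orbit :: "real^3 \<Rightarrow> real \<Rightarrow> quat \<Rightarrow> real \<Rightarrow> quat" where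
  "reeb_orbit a \<epsilon> u t = qexp a (t / 2) \<star> u \<star> qexp e1 (\<epsilon> * t / 2)"

lemma norm_qexp: "norm a = 1 \<Longrightarrow> norm (qexp a s) = 1"
  by (simp add: norm_eq_1 qexp_def inner_add_left inner_add_right flip: power2_eq_square)

lemma qexp_0 [simp]: "qexp a 0 = q_one"
  by (simp add: qexp_def)

lemma qexp_add: "norm a = 1 \<Longrightarrow> qexp a (s + t) = qexp a s \<star> qexp a t"
  by (simp add: qexp_def qmult_distribs pure_square cos_add sin_add algebra_simps)

lemma qexp_has_vector_derivative:
  assumes "norm a = 1"
  shows "((\<lambda>t. qexp a (k * t)) has_vector_derivative k *\<^sub>R (pure a \<star> qexp a (k * t))) (at t)"
    and "pure a \<star> qexp a s = qexp a s \<star> pure a"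
  unfolding qexp_def
  by (auto intro!: derivative_eq_intros simp: has_vector_derivative_def qmult_distribs
      pure_square[OF assms] algebra_simps)

lemma reeb_orbit_has_vector_derivative:
  assumes a: "norm a = 1"
  shows "(reeb_orbit a \<epsilon> u has_vector_derivative tilted_reeb a \<epsilon> (reeb_orbit a \<epsilon> u t)) (at t)"
proof -
  have e: "norm e1 = 1" by simp
  have 1: "((\<lambda>t. qexp a (t / 2)) has_vector_derivative (1/2) *\<^sub>R (pure a \<star> qexp a (t / 2))) (at t)"
    using qexp_has_vector_derivative(1)[OF a, of "1/2" t] by simp
  have 2: "((\<lambda>t. qexp e1 (\<epsilon> * t / 2)) has_vector_derivative (\<epsilon> / 2) *\<^sub>R (qexp e1 (\<epsilon> * t / 2) \<star> pure e1)) (at t)"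
    using qexp_has_vector_derivative(1)[OF e, of "\<epsilon> / 2" t]
      qexp_has_vector_derivative(2)[OF e, of "\<epsilon> * t / 2"] by simp
  have 3: "((\<lambda>t. qexp a (t / 2) \<star> u) has_vector_derivative (1/2) *\<^sub>R (pure a \<star> qexp a (t / 2)) \<star> u) (at t)"
    using bounded_linear.has_vector_derivative[OF qmult.bounded_linear_left 1] by simp
  show ?thesis
    unfolding reeb_orbit_def [abs_def]
    using bounded_bilinear.has_vector_derivative[OF bounded_bilinear_qmult 3 2]
    by (simp add: tilted_reeb_def qmult_distribs qmult_assoc add.commute scaleR_add_right)
qed

lemma tilted_reeb_skew_linear: "linear (tilted_reeb a \<epsilon>)" "v \<bullet> tilted_reeb a \<epsilon> v = 0"
  by (auto simp: linear_iff tilted_reeb_def qmult_distribs algebra_simps inner_add_right inner_pure_self)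

lemma reeb_orbit_in_S3:
  assumes "norm a = 1" "u \<in> S3" shows "reeb_orbit a \<epsilon> u t \<in> S3"
  using assms norm_qexp[of e1] by (simp add: S3_iff reeb_orbit_def norm_qmult norm_qexp)

lemma reeb_orbit_0 [simp]: "reeb_orbit a \<epsilon> u 0 = u"
  by (simp add: reeb_orbit_def)

lemma integral_curve_tilted_reeb:
  assumes "norm a = 1" "integral_curve M (tilted_reeb a \<epsilon>) \<gamma>"
  shows "\<gamma> t = reeb_orbit a \<epsilon> (\<gamma> 0) t"
  by (rule skew_linear_ode_unique[OF tilted_reeb_skew_linear _ reeb_orbit_has_vector_derivative[OF assms(1)]])
    (use assms(2) in \<open>auto simp: integral_curve_def\<close>)

lemma integral_curve_cong:
  "(\<And>p. p \<in> M \<Longrightarrow> X p = Y p) \<Longrightarrow> integral_curve M X \<gamma> = integral_curve M Y \<gamma>"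
  unfolding integral_curve_def by metis

lemma qexp_eq_one_iff: "qexp a s = q_one \<longleftrightarrow> cos s = 1" if "norm a = 1"
proof
  assume "qexp a s = q_one"
  then have "fst (qexp a s) = fst q_one" by simp
  then show "cos s = 1" by (simp add: qexp_def q_one_def)
next
  show "cos s = 1 \<Longrightarrow> qexp a s = q_one"
    by (simp add: qexp_def cos_one_sin_zero)
qed

lemma reeb_orbits_minimal_period:
  assumes \<beta>: "form1_eq S3 \<beta> (tilted_form a 0)" and a: "norm a = 1"
    and \<gamma>: "integral_curve S3 (reeb_field S3 \<beta>) \<gamma>"
  shows "has_minimal_period \<gamma> (4 * pi)"
proof -
  have R: "reeb_field S3 \<beta> u = tilted_reeb a 0 u" if "u \<in> S3" for u
    unfolding reeb_field_cong[OF \<beta>] using tilted_reeb_field[OF a _ _ that, of 0] by simp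
  have \<gamma>': "\<gamma> t = qexp a (t / 2) \<star> \<gamma> 0" for t
    using integral_curve_tilted_reeb[OF a, of S3 0 \<gamma> t] \<gamma> integral_curve_cong[of S3, OF R]
    by (simp add: reeb_orbit_def)
  have n: "norm (\<gamma> 0) = 1"
    using \<gamma> by (auto simp: integral_curve_def S3_iff)
  show ?thesis
    unfolding has_minimal_period_def
  proof (intro conjI allI impI notI)
    fix t
    have "qexp a (t / 2 + 2 * pi) = qexp a (t / 2)"
      by (simp add: qexp_def)
    moreover have "(t + 4 * pi) / 2 = t / 2 + 2 * pi" by simp
    ultimately show "\<gamma> (t + 4 * pi) = \<gamma> t"
      by (simp only: \<gamma>'[of "t + 4 * pi"] \<gamma>'[of t])
  next
    fix S assume S: "0 < S \<and> S < 4 * pi" and per: "\<forall>t. \<gamma> (t + S) = \<gamma> t"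
    have "qexp a (S / 2) \<star> \<gamma> 0 = \<gamma> 0"
      using per[rule_format, of 0] \<gamma>'[of S] by simp
    then have "qexp a (S / 2) \<star> \<gamma> 0 \<star> qconj (\<gamma> 0) = \<gamma> 0 \<star> qconj (\<gamma> 0)"
      by simp
    then have "cos (S / 2) = 1"
      using n a by (simp add: qmult_assoc qmult_qconj_unit qexp_eq_one_iff)
    then obtain k :: int where k: "S / 2 = of_int k * 2 * pi"
      by (auto simp: cos_one_2pi_int)
    then have "0 < of_int k * (4 * pi)" "of_int k * (4 * pi) < 1 * (4 * pi)"
      using S by (simp_all add: field_simps)
    then have "0 < k" "k < 1"
      by (simp_all add: zero_less_mult_iff)
    then show False by simp
  qed simp
qed

section \<open>The Hamiltonian flows\<close>

subsection \<open>Flow lines of the Hamiltonian fields\<close>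

lemma level_point:
  assumes \<epsilon>: "0 \<le> \<epsilon>" "\<epsilon> < 1" and z: "z \<in> level (katok_ham \<theta> \<epsilon>) (1/2)"
  shows "norm (fst z) = 1" "fst z \<bullet> snd z = 0" "snd z \<noteq> 0"
  using z by (cases z; simp add: level_def Tcot_iff)+

lemma katok_flow_norm:
  assumes \<epsilon>: "0 \<le> \<epsilon>" "\<epsilon> < 1"
    and \<zeta>: "integral_curve (level (katok_ham \<theta> \<epsilon>) (1/2)) (katok_field \<theta> \<epsilon>) \<zeta>"
  shows "norm (snd (\<zeta> t)) = norm (snd (\<zeta> 0))"
proof -
  have z: "fst (\<zeta> t) \<bullet> snd (\<zeta> t) = 0"
    and d: "(\<zeta> has_vector_derivative katok_field \<theta> \<epsilon> (\<zeta> t)) (at t)" for t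
    using \<zeta> level_point(2)[OF \<epsilon>, of "\<zeta> t" \<theta>] by (auto simp: integral_curve_def)
  have d2: "((\<lambda>t. snd (\<zeta> t)) has_vector_derivative snd (katok_field \<theta> \<epsilon> (\<zeta> t))) (at t)" for t
    using bounded_linear.has_vector_derivative[OF bounded_linear_snd d] .
  have "((\<lambda>t. snd (\<zeta> t) \<bullet> snd (\<zeta> t)) has_real_derivative 0) (at t)" for t
  proof -
    have "snd (\<zeta> t) \<bullet> snd (katok_field \<theta> \<epsilon> (\<zeta> t)) = 0"
      using z[of t] by (simp add: katok_field_def inner_add_right inner_diff_right dot_cross_self inner_commute)
    then show ?thesis
      using bounded_bilinear.has_vector_derivative[OF bounded_bilinear_inner d2 d2, of t]
      by (simp add: has_real_derivative_iff_has_vector_derivative inner_commute)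
  qed
  then have "snd (\<zeta> t) \<bullet> snd (\<zeta> t) = snd (\<zeta> 0) \<bullet> snd (\<zeta> 0)"
    by (rule DERIV_isconst_all[rule_format, of "\<lambda>t. snd (\<zeta> t) \<bullet> snd (\<zeta> t)"])
  then show ?thesis
    by (simp add: norm_eq_sqrt_inner)
qed

text \<open>The Hamiltonian field is quadratic in \<open>(x, y)\<close>, but linear and skew-symmetric in
  the moving frame \<open>(x, m, y)\<close> with \<open>m = y \<times> x\<close>.\<close>

definition frame_field :: "real \<Rightarrow> real \<Rightarrow> (real^3) \<times> (real^3) \<times> (real^3) \<Rightarrow> (real^3) \<times> (real^3) \<times> (real^3)" where
  "frame_field \<theta> \<epsilon> = (\<lambda>(x, m, y). (sin \<theta> *\<^sub>R y + \<epsilon> *\<^sub>R cross3 x e1,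
     - cos \<theta> *\<^sub>R y + \<epsilon> *\<^sub>R cross3 m e1,
     cos \<theta> *\<^sub>R m - sin \<theta> *\<^sub>R x + \<epsilon> *\<^sub>R cross3 y e1))"

lemma frame_field_skew_linear: "linear (frame_field \<theta> \<epsilon>)" "v \<bullet> frame_field \<theta> \<epsilon> v = 0"
  by (auto simp: linear_iff frame_field_def cross_add_left cross_mult_left algebra_simps
      inner_add_right inner_diff_right dot_cross_self inner_commute split: prod.split)

text \<open>The rotation field acts on cross products as a derivation (Jacobi identity).\<close>

lemma katok_flow_frame:
  assumes \<epsilon>: "0 \<le> \<epsilon>" "\<epsilon> < 1"
    and \<zeta>: "integral_curve (level (katok_ham \<theta> \<epsilon>) (1/2)) (katok_field \<theta> \<epsilon>) \<zeta>"
  defines "r \<equiv> norm (snd (\<zeta> 0))"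
  defines "\<Phi> \<equiv> \<lambda>t. (fst (\<zeta> t), cross3 (snd (\<zeta> t)) (fst (\<zeta> t)) /\<^sub>R r, snd (\<zeta> t) /\<^sub>R r)"
  shows "(\<Phi> has_vector_derivative frame_field \<theta> \<epsilon> (\<Phi> t)) (at t)"
proof -
  obtain x Y where xY: "\<zeta> t = (x, Y)" by (cases "\<zeta> t")
  have l: "\<zeta> t \<in> level (katok_ham \<theta> \<epsilon>) (1/2)" "\<zeta> 0 \<in> level (katok_ham \<theta> \<epsilon>) (1/2)"
    and d: "(\<zeta> has_vector_derivative katok_field \<theta> \<epsilon> (\<zeta> t)) (at t)"
    using \<zeta> by (auto simp: integral_curve_def)
  have n: "norm x = 1" "x \<bullet> Y = 0" "Y \<noteq> 0" "r > 0"
    using level_point[OF \<epsilon> l(1)] level_point[OF \<epsilon> l(2)] by (auto simp: xY r_def)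
  have r: "norm Y = r"
    using katok_flow_norm[OF \<epsilon> \<zeta>, of t] by (simp add: xY r_def)
  let ?x' = "sin \<theta> *\<^sub>R (Y /\<^sub>R r) + \<epsilon> *\<^sub>R cross3 x e1"
  let ?Y' = "cos \<theta> *\<^sub>R cross3 Y x - (sin \<theta> * r) *\<^sub>R x + \<epsilon> *\<^sub>R cross3 Y e1"
  have f: "katok_field \<theta> \<epsilon> (\<zeta> t) = (?x', ?Y')"
    by (simp add: katok_field_def xY r)
  have dx: "((\<lambda>t. fst (\<zeta> t)) has_vector_derivative ?x') (at t)"
    and dY: "((\<lambda>t. snd (\<zeta> t)) has_vector_derivative ?Y') (at t)"
    using bounded_linear.has_vector_derivative[OF bounded_linear_fst d]
      bounded_linear.has_vector_derivative[OF bounded_linear_snd d] unfolding f by simp_all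
  have dm: "((\<lambda>t. cross3 (snd (\<zeta> t)) (fst (\<zeta> t))) has_vector_derivative (cross3 Y ?x' + cross3 ?Y' x)) (at t)"
    using bounded_bilinear.has_vector_derivative[OF bounded_bilinear_cross3 dY dx] by (simp add: xY)
  have "x \<bullet> x = 1" using n by (simp add: norm_eq_1)
  then have c1: "cross3 (cross3 Y x) x = - Y"
    using n(2) cross_skew[of "cross3 Y x" x] by (simp add: Lagrange)
  have c2: "cross3 Y (cross3 x e1) + cross3 (cross3 Y e1) x = cross3 (cross3 Y x) e1"
    using Jacobi[of Y x e1]
    by (simp add: cross_skew[of e1 "cross3 Y x"] cross_skew[of e1 Y] cross_skew[of "cross3 Y e1" x] algebra_simps)
  have c3: "cross3 Y ?x' + cross3 ?Y' x = - cos \<theta> *\<^sub>R Y + \<epsilon> *\<^sub>R cross3 (cross3 Y x) e1"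
    unfolding c2[symmetric] by (simp add: cross_add_left cross_add_right cross_mult_left cross_mult_right
        Cross3.left_diff_distrib c1 scaleR_add_right)
  have "(\<Phi> has_vector_derivative (?x', (cross3 Y ?x' + cross3 ?Y' x) /\<^sub>R r, ?Y' /\<^sub>R r)) (at t)"
    unfolding \<Phi>_def
    by (intro has_vector_derivative_Pair dx bounded_linear.has_vector_derivative[OF bounded_linear_scaleR_right] dm dY)
  moreover have "(?x', (cross3 Y ?x' + cross3 ?Y' x) /\<^sub>R r, ?Y' /\<^sub>R r) = frame_field \<theta> \<epsilon> (\<Phi> t)"
    unfolding c3 using n(4)
    by (simp add: frame_field_def \<Phi>_def xY cross_mult_left scaleR_add_right scaleR_diff_right mult.commute)
  ultimately show ?thesis by simp
qed

lemma katok_flow_unique: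
  assumes \<epsilon>: "0 \<le> \<epsilon>" "\<epsilon> < 1"
    and \<zeta>: "integral_curve (level (katok_ham \<theta> \<epsilon>) (1/2)) (katok_field \<theta> \<epsilon>) \<zeta>"
    and \<eta>: "integral_curve (level (katok_ham \<theta> \<epsilon>) (1/2)) (katok_field \<theta> \<epsilon>) \<eta>"
    and 0: "\<zeta> 0 = \<eta> 0"
  shows "\<zeta> t = \<eta> t"
proof -
  let ?r = "norm (snd (\<eta> 0))"
  let ?\<Phi> = "\<lambda>\<zeta> t. (fst (\<zeta> t), cross3 (snd (\<zeta> t)) (fst (\<zeta> t)) /\<^sub>R ?r, snd (\<zeta> t) /\<^sub>R ?r)"
  have 1: "(?\<Phi> \<zeta> has_vector_derivative frame_field \<theta> \<epsilon> (?\<Phi> \<zeta> t)) (at t)" for t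
    using katok_flow_frame[OF \<epsilon> \<zeta>, of t] unfolding 0 .
  have 2: "(?\<Phi> \<eta> has_vector_derivative frame_field \<theta> \<epsilon> (?\<Phi> \<eta> t)) (at t)" for t
    by (rule katok_flow_frame[OF \<epsilon> \<eta>])
  have 3: "?\<Phi> \<zeta> 0 = ?\<Phi> \<eta> 0"
    by (simp only: 0)
  have "?\<Phi> \<zeta> t = ?\<Phi> \<eta> t"
    by (rule skew_linear_ode_unique[OF frame_field_skew_linear 1 2 3])
  moreover have "?r \<noteq> 0"
    using \<eta> level_point(3)[OF \<epsilon>, of "\<eta> 0" \<theta>] by (auto simp: integral_curve_def)
  ultimately show ?thesis
    by (simp add: prod_eq_iff)
qed

lemma integral_curve_cover_orbit:
  assumes \<epsilon>: "0 \<le> \<epsilon>" "\<epsilon> < 1" and u: "u \<in> S3"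
  shows "integral_curve (level (katok_ham \<theta> \<epsilon>) (1/2)) (katok_field \<theta> \<epsilon>)
    (\<lambda>t. cover \<theta> \<epsilon> (reeb_orbit (axis_at \<theta>) \<epsilon> u t))"
  unfolding integral_curve_def
proof (intro allI conjI)
  fix t
  let ?p = "reeb_orbit (axis_at \<theta>) \<epsilon> u t"
  have p: "?p \<in> S3"
    by (rule reeb_orbit_in_S3[OF norm_axis_at u])
  show "cover \<theta> \<epsilon> ?p \<in> level (katok_ham \<theta> \<epsilon>) (1/2)"
    by (rule cover_in_level[OF \<epsilon> p])
  obtain D where D: "(cover \<theta> \<epsilon> has_derivative D) (at ?p)"
    "D (tilted_reeb (axis_at \<theta>) \<epsilon> ?p) = katok_field \<theta> \<epsilon> (cover \<theta> \<epsilon> ?p)"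
    using cover_derivative_reeb[OF \<epsilon> p] by blast
  show "((\<lambda>t. cover \<theta> \<epsilon> (reeb_orbit (axis_at \<theta>) \<epsilon> u t)) has_vector_derivative
      katok_field \<theta> \<epsilon> (cover \<theta> \<epsilon> ?p)) (at t)"
    using curve_compose_derivative[OF reeb_orbit_has_vector_derivative[OF norm_axis_at] D(1)]
    unfolding D(2) .
qed

lemma integral_curve_is_cover_orbit:
  assumes \<epsilon>: "0 \<le> \<epsilon>" "\<epsilon> < 1"
    and \<zeta>: "integral_curve (level (katok_ham \<theta> \<epsilon>) (1/2)) (katok_field \<theta> \<epsilon>) \<zeta>"
  obtains u where "u \<in> S3" "\<And>t. \<zeta> t = cover \<theta> \<epsilon> (reeb_orbit (axis_at \<theta>) \<epsilon> u t)"
proof -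
  have "\<zeta> 0 \<in> cover \<theta> \<epsilon> ` S3"
    unfolding cover_surj[OF \<epsilon>] using \<zeta> by (simp add: integral_curve_def)
  then obtain u where u: "u \<in> S3" "\<zeta> 0 = cover \<theta> \<epsilon> u" by blast
  show ?thesis
  proof (rule that[OF u(1)])
    show "\<zeta> t = cover \<theta> \<epsilon> (reeb_orbit (axis_at \<theta>) \<epsilon> u t)" for t
      by (rule katok_flow_unique[OF \<epsilon> \<zeta> integral_curve_cover_orbit[OF \<epsilon> u(1)]]) (simp add: u(2))
  qed
qed

subsection \<open>Periodic orbits\<close>

text \<open>The orbits of the flow through points \<open>u\<close> where the two commuting circle actions
  have the same orbit.\<close>

definition axis_orbit :: "real \<Rightarrow> real \<Rightarrow> real \<Rightarrow> phase set" where
  "axis_orbit \<theta> \<epsilon> \<sigma> = cover \<theta> \<epsilon> ` {u \<in> S3. rot u (axis_at \<theta>) = \<sigma> *\<^sub>R e1}"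

text \<open>At such points right multiplication by \<open>exp (i s)\<close> is left multiplication by
  \<open>exp (\<plusminus> a s)\<close>.\<close>

lemma qmult_qexp:
  assumes "norm u = 1" "rot u a = \<sigma> *\<^sub>R e1" "\<sigma> = 1 \<or> \<sigma> = -1"
  shows "u \<star> qexp e1 s = qexp a (\<sigma> * s) \<star> u"
proof -
  have "u \<star> (\<sigma> *\<^sub>R pure e1) = pure a \<star> u"
    using qmult_rot[OF assms(1), of a] by (simp add: assms(2) pure_linear)
  then have "u \<star> pure e1 = \<sigma> *\<^sub>R (pure a \<star> u)"
    using assms(3) by (auto simp: qmult_distribs minus_equation_iff)
  then show ?thesis
    using assms(3) by (auto simp: qexp_def qmult_distribs)
qed

lemma reeb_orbit_axis:
  assumes "norm u = 1" "rot u a = \<sigma> *\<^sub>R e1" "\<sigma> = 1 \<or> \<sigma> = -1" "norm a = 1"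
  shows "reeb_orbit a \<epsilon> u t = qexp a ((1 + \<sigma> * \<epsilon>) * t / 2) \<star> u"
proof -
  have "(1 + \<sigma> * \<epsilon>) * t / 2 = t / 2 + \<sigma> * (\<epsilon> * t / 2)"
    by (simp add: algebra_simps add_divide_distrib)
  then show ?thesis
    by (simp only: reeb_orbit_def qmult_assoc qmult_qexp[OF assms(1-3)] qexp_add[OF assms(4)])
qed

text \<open>Commuting with \<open>a\<close> forces the imaginary part of \<open>w\<close> to be parallel to \<open>a\<close>.\<close>

lemma commuting_unit_quaternion:
  assumes w: "norm w = 1" and a: "norm a = 1" and com: "pure a \<star> w = w \<star> pure a"
  obtains s where "w = qexp a s"
proof -
  obtain r b where wr: "w = (r, b)" by (cases w)
  have c: "cross3 a b = cross3 b a"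
    using com by (simp add: wr pure_def qmult_def)
  have "cross3 a b = 0"
  proof -
    have "cross3 a b + cross3 a b = 0"
      using c cross_skew[of a b] by (metis add.right_inverse)
    then show ?thesis
      by (simp flip: scaleR_2)
  qed
  then have "cross3 a (cross3 a b) = 0" by simp
  then have b: "b = (a \<bullet> b) *\<^sub>R a"
    using a by (simp add: Lagrange norm_eq_1)
  have "b \<bullet> b = (a \<bullet> b)\<^sup>2"
    using a by (subst (1 2) b) (simp add: norm_eq_1 power2_eq_square)
  then have "r\<^sup>2 + (a \<bullet> b)\<^sup>2 = 1"
    using w by (simp add: wr norm_eq_1 power2_eq_square)
  then obtain s where "r = cos s" "a \<bullet> b = sin s"
    using sincos_total_2pi by metis
  then have "w = qexp a s"
    using b by (simp add: wr qexp_def q_one_def pure_def)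
  then show ?thesis by (rule that)
qed

text \<open>Two unit quaternions that rotate \<open>a\<close> to the same vector differ by a unit
  quaternion commuting with \<open>a\<close>, and the orbit runs through all of these because
  \<open>1 \<plusminus> \<epsilon>\<close> is not 0.\<close>

lemma range_cover_axis_orbit:
  assumes \<epsilon>: "0 \<le> \<epsilon>" "\<epsilon> < 1" and u: "u \<in> S3" and r: "rot u (axis_at \<theta>) = \<sigma> *\<^sub>R e1"
    and \<sigma>: "\<sigma> = 1 \<or> \<sigma> = -1"
  shows "range (\<lambda>t. cover \<theta> \<epsilon> (reeb_orbit (axis_at \<theta>) \<epsilon> u t)) = axis_orbit \<theta> \<epsilon> \<sigma>"
proof -
  let ?a = "axis_at \<theta>"
  have n: "norm u = 1" using u by (simp add: S3_iff)
  note orb = reeb_orbit_axis[OF n r \<sigma> norm_axis_at, of \<epsilon>]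
  have pos: "1 + \<sigma> * \<epsilon> \<noteq> 0" using \<epsilon> \<sigma> by auto
  have ra: "rot (qexp ?a s) ?a = ?a" for s
  proof -
    have "pure (rot (qexp ?a s) ?a) = qconj (qexp ?a s) \<star> (qexp ?a s \<star> pure ?a)"
      unfolding pure_rot qmult_assoc qexp_has_vector_derivative(2)[OF norm_axis_at] ..
    then have "pure (rot (qexp ?a s) ?a) = pure ?a"
      by (simp only: qmult_qconj_unit(4)[OF norm_qexp[OF norm_axis_at]])
    then show ?thesis
      by (simp only: pure_inject)
  qed
  have "range (reeb_orbit ?a \<epsilon> u) = {u \<in> S3. rot u ?a = \<sigma> *\<^sub>R e1}"
  proof (intro equalityI subsetI)
    fix v assume "v \<in> range (reeb_orbit ?a \<epsilon> u)"
    then obtain t where v: "v = qexp ?a ((1 + \<sigma> * \<epsilon>) * t / 2) \<star> u"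
      using orb by auto
    then show "v \<in> {u \<in> S3. rot u ?a = \<sigma> *\<^sub>R e1}"
      using n by (simp add: S3_iff norm_qmult norm_qexp rot_mult ra r)
  next
    fix v assume "v \<in> {u \<in> S3. rot u ?a = \<sigma> *\<^sub>R e1}"
    then have v: "norm v = 1" "rot v ?a = \<sigma> *\<^sub>R e1" by (simp_all add: S3_iff)
    let ?w = "v \<star> qconj u"
    have "pure ?a \<star> ?w = v \<star> pure (\<sigma> *\<^sub>R e1) \<star> qconj u"
      using qmult_rot[OF v(1), of ?a] by (simp add: v(2) qmult_assoc[symmetric])
    also have "\<dots> = ?w \<star> (u \<star> pure (\<sigma> *\<^sub>R e1) \<star> qconj u)"
      using n by (simp add: qmult_assoc qmult_qconj_unit)
    also have "\<dots> = ?w \<star> pure ?a"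
      using qmult_rot[OF n, of ?a] n by (simp add: r qmult_assoc qmult_qconj_unit)
    finally have "pure ?a \<star> ?w = ?w \<star> pure ?a" .
    then obtain s where s: "?w = qexp ?a s"
      using v n by (elim commuting_unit_quaternion[rotated 2]) (simp_all add: norm_qmult)
    have "v = ?w \<star> u"
      using n by (simp add: qmult_assoc qmult_qconj_unit)
    also have "\<dots> = reeb_orbit ?a \<epsilon> u (2 * s / (1 + \<sigma> * \<epsilon>))"
      using pos by (simp add: orb s)
    finally show "v \<in> range (reeb_orbit ?a \<epsilon> u)"
      by blast
  qed
  then show ?thesis
    unfolding axis_orbit_def by (metis image_image)
qed

lemma exists_axis_point:
  assumes "\<sigma> = 1 \<or> \<sigma> = -1"
  obtains u where "u \<in> S3" "rot u (axis_at \<theta>) = \<sigma> *\<^sub>R e1"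
proof -
  have "pure (rot (circ \<theta>) (axis_at \<theta>)) = pure (rot (circ \<theta>) (rot (qconj (circ \<theta>)) e1))"
    by (simp only: circ_rot)
  also have "\<dots> = pure e1"
    by (simp add: pure_rot qmult_assoc qmult_qconj_unit)
  finally have 1: "rot (circ \<theta>) (axis_at \<theta>) = e1" by simp
  have "pure (rot (pure e2) e1) = pure (- e1)"
    by (simp add: pure_rot pure_mult_pure cross_basis pure_linear inner_axis_axis qmult_distribs)
  then have "rot (circ \<theta> \<star> pure e2) (axis_at \<theta>) = - e1"
    by (simp only: rot_mult 1 pure_inject)
  then show ?thesis
    using assms 1 that[of "circ \<theta>"] that[of "circ \<theta> \<star> pure e2"] by (auto simp: S3_iff norm_qmult)
qed

text \<open>Conjugating by \<open>u\<close> turns the closing condition into \<open>exp (n T/2) =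
  \<plusminus> exp (- \<epsilon> i T/2)\<close>. If \<open>sin (T/2) = 0\<close>, then both
  \<open>T/2\<close> and \<open>\<epsilon> T/2\<close> are multiples of \<open>\<pi>\<close> and
  \<open>\<epsilon>\<close> is rational; otherwise \<open>n\<close> is parallel to
  \<open>i\<close>.\<close>

lemma periodic_point_on_axis:
  assumes \<epsilon>: "0 \<le> \<epsilon>" "\<epsilon> < 1" "\<epsilon> \<notin> \<rat>" and u: "u \<in> S3" and T: "T > 0" and a: "norm a = 1"
    and per: "reeb_orbit a \<epsilon> u T = u \<or> reeb_orbit a \<epsilon> u T = - u"
  obtains \<sigma> where "\<sigma> = 1 \<or> \<sigma> = -1" "rot u a = \<sigma> *\<^sub>R e1"
proof -
  have n: "norm u = 1" using u by (simp add: S3_iff)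
  let ?n = "rot u a"
  obtain k :: real where k: "k = 1 \<or> k = -1" "reeb_orbit a \<epsilon> u T = k *\<^sub>R u"
    using per by (metis scaleR_minus1_left scaleR_one)
  have ue: "qexp a s \<star> u = u \<star> qexp ?n s" for s
    using qmult_rot[OF n, of a] by (simp add: qexp_def qmult_distribs)
  have "u \<star> (qexp ?n (T / 2) \<star> qexp e1 (\<epsilon> * T / 2)) = u \<star> (k *\<^sub>R q_one)"
    using k(2) by (simp add: reeb_orbit_def ue qmult_assoc qmult_distribs)
  then have "qexp ?n (T / 2) \<star> qexp e1 (\<epsilon> * T / 2) = k *\<^sub>R q_one"
    using qmult_qconj_unit(4)[OF n] by metis
  then have "qexp ?n (T / 2) \<star> qexp e1 (\<epsilon> * T / 2) \<star> qexp e1 (- (\<epsilon> * T / 2)) = k *\<^sub>R qexp e1 (- (\<epsilon> * T / 2))"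
    by (simp add: qmult_distribs)
  moreover have "qexp e1 (\<epsilon> * T / 2) \<star> qexp e1 (- (\<epsilon> * T / 2)) = q_one"
    using qexp_add[of e1 "\<epsilon> * T / 2" "- (\<epsilon> * T / 2)"] by simp
  ultimately have "qexp ?n (T / 2) = k *\<^sub>R qexp e1 (- (\<epsilon> * T / 2))"
    by (simp add: qmult_assoc)
  then have "snd (qexp ?n (T / 2)) = snd (k *\<^sub>R qexp e1 (- (\<epsilon> * T / 2)))"
    by simp
  then have eq: "sin (T / 2) *\<^sub>R ?n = (- k * sin (\<epsilon> * T / 2)) *\<^sub>R e1"
    by (simp add: qexp_def q_one_def)
  have "sin (T / 2) \<noteq> 0"
  proof
    assume 0: "sin (T / 2) = 0"
    then have "sin (\<epsilon> * T / 2) = 0"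
      using eq k by auto
    then obtain i j :: int where ij: "T / 2 = of_int i * pi" "\<epsilon> * T / 2 = of_int j * pi"
      using 0 by (auto simp: sin_zero_iff_int2)
    then have "of_int i * \<epsilon> = of_int j" and "i \<noteq> 0"
      using T by (auto simp: field_simps)
    then have "\<epsilon> = of_int j / of_int i"
      by (simp add: field_simps)
    then show False using \<epsilon>(3) by simp
  qed
  define \<sigma> where "\<sigma> = (- k * sin (\<epsilon> * T / 2)) / sin (T / 2)"
  have "?n = (1 / sin (T / 2)) *\<^sub>R (sin (T / 2) *\<^sub>R ?n)"
    using \<open>sin (T / 2) \<noteq> 0\<close> by simp
  then have n\<sigma>: "?n = \<sigma> *\<^sub>R e1"
    unfolding eq by (simp add: \<sigma>_def)
  have "\<bar>\<sigma>\<bar> = 1"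
    using norm_rot[OF n, of a] a unfolding n\<sigma> by simp
  then have "\<sigma> = 1 \<or> \<sigma> = -1"
    by linarith
  then show ?thesis
    using n\<sigma> by (rule that)
qed

lemma two_periodic_orbits:
  assumes \<epsilon>: "0 \<le> \<epsilon>" "\<epsilon> < 1" "\<epsilon> \<notin> \<rat>"
    and X: "\<And>z. z \<in> level (katok_ham \<theta> \<epsilon>) (1/2) \<Longrightarrow> X z = katok_field \<theta> \<epsilon> z"
  shows "card (periodic_orbits (level (katok_ham \<theta> \<epsilon>) (1/2)) X) = 2"
proof -
  let ?N = "level (katok_ham \<theta> \<epsilon>) (1/2)" and ?a = "axis_at \<theta>"
  have ic: "integral_curve ?N X \<gamma> = integral_curve ?N (katok_field \<theta> \<epsilon>) \<gamma>" for \<gamma>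
    by (rule integral_curve_cong) (rule X)
  have "periodic_orbits ?N X = {axis_orbit \<theta> \<epsilon> 1, axis_orbit \<theta> \<epsilon> (-1)}"
  proof (intro equalityI subsetI)
    fix O' assume "O' \<in> periodic_orbits ?N X"
    then obtain \<zeta> T where \<zeta>: "integral_curve ?N (katok_field \<theta> \<epsilon>) \<zeta>" "O' = range \<zeta>"
      and T: "T > 0" "\<forall>t. \<zeta> (t + T) = \<zeta> t"
      unfolding periodic_orbits_def using ic by auto
    obtain u where u: "u \<in> S3" "\<And>t. \<zeta> t = cover \<theta> \<epsilon> (reeb_orbit ?a \<epsilon> u t)"
      using integral_curve_is_cover_orbit[OF \<epsilon>(1,2) \<zeta>(1)] by blast
    have "cover \<theta> \<epsilon> u = cover \<theta> \<epsilon> (reeb_orbit ?a \<epsilon> u T)"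
      using T(2)[rule_format, of 0] u(2)[of T] u(2)[of 0] by simp
    then have "reeb_orbit ?a \<epsilon> u T = u \<or> reeb_orbit ?a \<epsilon> u T = - u"
      using cover_eq_iff[OF \<epsilon>(1,2) u(1) reeb_orbit_in_S3[OF norm_axis_at u(1)]] by blast
    then obtain \<sigma> where \<sigma>: "\<sigma> = 1 \<or> \<sigma> = -1" "rot u ?a = \<sigma> *\<^sub>R e1"
      using periodic_point_on_axis[OF \<epsilon> u(1) T(1) norm_axis_at] by blast
    have "\<zeta> = (\<lambda>t. cover \<theta> \<epsilon> (reeb_orbit ?a \<epsilon> u t))"
      using u(2) by blast
    then have "O' = axis_orbit \<theta> \<epsilon> \<sigma>"
      unfolding \<zeta>(2) using range_cover_axis_orbit[OF \<epsilon>(1,2) u(1) \<sigma>(2,1)] by simp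
    then show "O' \<in> {axis_orbit \<theta> \<epsilon> 1, axis_orbit \<theta> \<epsilon> (-1)}"
      using \<sigma>(1) by blast
  next
    fix O' assume "O' \<in> {axis_orbit \<theta> \<epsilon> 1, axis_orbit \<theta> \<epsilon> (-1)}"
    then obtain \<sigma> :: real where \<sigma>: "\<sigma> = 1 \<or> \<sigma> = -1" "O' = axis_orbit \<theta> \<epsilon> \<sigma>" by blast
    obtain u where u: "u \<in> S3" "rot u ?a = \<sigma> *\<^sub>R e1"
      using \<sigma>(1) by (rule exists_axis_point)
    let ?\<zeta> = "\<lambda>t. cover \<theta> \<epsilon> (reeb_orbit ?a \<epsilon> u t)" and ?T = "4 * pi / (1 + \<sigma> * \<epsilon>)"
    have pos: "1 + \<sigma> * \<epsilon> > 0" using \<epsilon> \<sigma>(1) by auto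
    have "reeb_orbit ?a \<epsilon> u (t + ?T) = reeb_orbit ?a \<epsilon> u t" for t
    proof -
      have "(1 + \<sigma> * \<epsilon>) * (t + ?T) / 2 = (1 + \<sigma> * \<epsilon>) * t / 2 + 2 * pi"
        using pos by (simp add: field_simps)
      moreover have "qexp ?a (s + 2 * pi) = qexp ?a s" for s
        by (simp add: qexp_def)
      ultimately show ?thesis
        using u by (simp only: reeb_orbit_axis[OF _ u(2) \<sigma>(1) norm_axis_at] S3_iff)
    qed
    then have "\<forall>t. ?\<zeta> (t + ?T) = ?\<zeta> t" by simp
    moreover have "?T > 0" using pos by simp
    moreover have "integral_curve ?N X ?\<zeta>"
      using integral_curve_cover_orbit[OF \<epsilon>(1,2) u(1)] ic by blast
    moreover have "O' = range ?\<zeta>"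
      using range_cover_axis_orbit[OF \<epsilon>(1,2) u \<sigma>(1)] \<sigma>(2) by simp
    ultimately show "O' \<in> periodic_orbits ?N X"
      unfolding periodic_orbits_def by blast
  qed
  moreover have "axis_orbit \<theta> \<epsilon> 1 \<noteq> axis_orbit \<theta> \<epsilon> (-1)"
  proof
    assume eq: "axis_orbit \<theta> \<epsilon> 1 = axis_orbit \<theta> \<epsilon> (-1)"
    obtain u where u: "u \<in> S3" "rot u ?a = 1 *\<^sub>R e1"
      using exists_axis_point[of 1 \<theta>] by blast
    then have "cover \<theta> \<epsilon> u \<in> axis_orbit \<theta> \<epsilon> (-1)"
      unfolding eq[symmetric] unfolding axis_orbit_def by (intro imageI) simp
    then obtain v where v: "v \<in> S3" "rot v ?a = - e1" "cover \<theta> \<epsilon> u = cover \<theta> \<epsilon> v"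
      by (auto simp: axis_orbit_def)
    then have "rot v ?a = rot u ?a"
      using cover_eq_iff[OF \<epsilon>(1,2) u(1) v(1)] by auto
    then have "e1 = - e1"
      using u(2) v(2) by (metis scaleR_one)
    then have "e1 $ 1 = (- e1) $ 1"
      by (rule arg_cong)
    then show False
      by (simp add: axis_def)
  qed
  ultimately show ?thesis by simp
qed

section \<open>The Finsler metric and the first variation\<close>

subsection \<open>The Finsler metric\<close>

definition wind :: "real \<Rightarrow> real^3 \<Rightarrow> real^3" where
  "wind \<epsilon> x = \<epsilon> *\<^sub>R cross3 x e1"

definition zermelo :: "real \<Rightarrow> (real^3) \<times> (real^3) \<Rightarrow> real" where
  "zermelo \<epsilon> z = (sqrt ((snd z \<bullet> wind \<epsilon> (fst z))\<^sup>2
       + (1 - wind \<epsilon> (fst z) \<bullet> wind \<epsilon> (fst z)) * (snd z \<bullet> snd z))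
     - snd z \<bullet> wind \<epsilon> (fst z)) / (1 - wind \<epsilon> (fst z) \<bullet> wind \<epsilon> (fst z))"

lemma wind_less_1:
  assumes "norm x = 1" "0 \<le> \<epsilon>" "\<epsilon> < 1"
  shows "wind \<epsilon> x \<bullet> wind \<epsilon> x < 1"
proof -
  have "cross3 x e1 \<bullet> cross3 x e1 \<le> 1"
    using assms(1) by (simp add: dot_cross norm_eq_1 inner_axis_axis inner_commute[of e1 x])
  then have "wind \<epsilon> x \<bullet> wind \<epsilon> x \<le> \<epsilon> * \<epsilon> * 1"
    unfolding wind_def inner_scaleR_left inner_scaleR_right mult.assoc[symmetric]
    using assms by (intro mult_left_mono) auto
  also have "\<epsilon> * \<epsilon> < 1 * 1"
    using assms by (intro mult_strict_mono') auto
  finally show ?thesis by simp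
qed

lemma zermelo_radicand_pos:
  assumes "wind \<epsilon> x \<bullet> wind \<epsilon> x < 1" "v \<noteq> 0"
  shows "(v \<bullet> wind \<epsilon> x)\<^sup>2 + (1 - wind \<epsilon> x \<bullet> wind \<epsilon> x) * (v \<bullet> v) > 0"
  using assms by (intro add_nonneg_pos mult_pos_pos) auto

lemma zermelo_pos:
  assumes "wind \<epsilon> x \<bullet> wind \<epsilon> x < 1" "v \<noteq> 0"
  shows "zermelo \<epsilon> (x, v) > 0"
proof -
  let ?b = "v \<bullet> wind \<epsilon> x" and ?l = "1 - wind \<epsilon> x \<bullet> wind \<epsilon> x"
  have "?l * (v \<bullet> v) > 0"
    using assms by simp
  then have "sqrt (?b\<^sup>2) < sqrt (?b\<^sup>2 + ?l * (v \<bullet> v))"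
    by (intro real_sqrt_less_mono) simp
  then have "?b < sqrt (?b\<^sup>2 + ?l * (v \<bullet> v))"
    by simp
  then show ?thesis
    using assms by (simp add: zermelo_def)
qed

lemma zermelo_zero [simp]: "zermelo \<epsilon> (x, 0) = 0"
  by (simp add: zermelo_def)

text \<open>Zermelo's characterisation: \<open>zermelo\<close> measures the time needed for the displacement \<open>v\<close> when
  moving with unit speed relative to the wind.\<close>

lemma zermelo_root:
  fixes x v :: "real^3"
  assumes "wind \<epsilon> x \<bullet> wind \<epsilon> x < 1"
  defines "F \<equiv> zermelo \<epsilon> (x, v)"
  shows "(v - F *\<^sub>R wind \<epsilon> x) \<bullet> (v - F *\<^sub>R wind \<epsilon> x) = F\<^sup>2"
proof -
  let ?b = "v \<bullet> wind \<epsilon> x" and ?l = "1 - wind \<epsilon> x \<bullet> wind \<epsilon> x"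
  define S where "S = sqrt (?b\<^sup>2 + ?l * (v \<bullet> v))"
  have l: "?l > 0" using assms by simp
  have "S\<^sup>2 = ?b\<^sup>2 + ?l * (v \<bullet> v)"
    unfolding S_def using l by (intro real_sqrt_pow2 add_nonneg_nonneg mult_nonneg_nonneg) auto
  moreover have F: "?l * F = S - ?b"
    using l by (simp add: F_def zermelo_def S_def)
  ultimately have "?l * (?l * F\<^sup>2 + 2 * F * ?b - v \<bullet> v) = 0"
    by algebra
  then have "?l * F\<^sup>2 + 2 * F * ?b = v \<bullet> v"
    using l by simp
  then show ?thesis
    by (simp add: inner_diff_left inner_diff_right inner_commute power2_eq_square algebra_simps)
qed

text \<open>The quadratic equation for \<open>f\<close> has only one positive root.\<close>

lemma zermelo_eqI:
  assumes W: "wind \<epsilon> x \<bullet> wind \<epsilon> x < 1" and f: "f > 0"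
    and eq: "(v - f *\<^sub>R wind \<epsilon> x) \<bullet> (v - f *\<^sub>R wind \<epsilon> x) = f\<^sup>2"
  shows "zermelo \<epsilon> (x, v) = f"
proof -
  let ?b = "v \<bullet> wind \<epsilon> x" and ?l = "1 - wind \<epsilon> x \<bullet> wind \<epsilon> x"
  have l: "?l > 0" using W by simp
  have e: "f * (?l * f + 2 * ?b) = v \<bullet> v"
    using eq by (simp add: inner_diff_left inner_diff_right inner_commute power2_eq_square algebra_simps)
  have "?l * f + 2 * ?b \<ge> 0"
    using e f by (metis inner_ge_zero zero_le_mult_iff less_le_not_le)
  moreover have "?l * f > 0" using l f by simp
  ultimately have "?l * f + ?b > 0" by linarith
  moreover have "(?l * f + ?b)\<^sup>2 = ?b\<^sup>2 + ?l * (v \<bullet> v)"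
    unfolding e[symmetric] by algebra
  ultimately have "sqrt (?b\<^sup>2 + ?l * (v \<bullet> v)) = ?l * f + ?b"
    by (metis less_eq_real_def real_sqrt_unique)
  then show ?thesis
    using l by (simp add: zermelo_def)
qed

definition zermelo_domain :: "real \<Rightarrow> ((real^3) \<times> (real^3)) set" where
  "zermelo_domain \<epsilon> = {z. wind \<epsilon> (fst z) \<bullet> wind \<epsilon> (fst z) < 1 \<and> snd z \<noteq> 0}"

lemma wind_smooth [smooth_intros]:
  fixes f :: "'a::euclidean_space \<Rightarrow> real^3"
  assumes "smooth_on U f" shows "smooth_on U (\<lambda>x. wind \<epsilon> (f x))"
  unfolding wind_def using smooth_on_open[OF assms] by (intro smooth_intros assms)

lemma zermelo_domain_open: "open (zermelo_domain \<epsilon>)"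
proof -
  have "smooth_on UNIV (\<lambda>z::(real^3) \<times> (real^3). wind \<epsilon> (fst z) \<bullet> wind \<epsilon> (fst z))"
    by (intro smooth_intros open_UNIV)
  then have c: "continuous_on UNIV (\<lambda>z::(real^3) \<times> (real^3). wind \<epsilon> (fst z) \<bullet> wind \<epsilon> (fst z))"
    by (rule smooth_on_imp_continuous_on)
  have "open ((\<lambda>z::(real^3) \<times> (real^3). wind \<epsilon> (fst z) \<bullet> wind \<epsilon> (fst z)) -` {..<1} \<inter> (UNIV \<times> (- {0})))"
    using c by (intro open_Int open_vimage open_Times open_UNIV open_lessThan) auto
  moreover have "(\<lambda>z::(real^3) \<times> (real^3). wind \<epsilon> (fst z) \<bullet> wind \<epsilon> (fst z)) -` {..<1} \<inter> (UNIV \<times> (- {0})) = zermelo_domain \<epsilon>"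
    by (auto simp: zermelo_domain_def)
  ultimately show ?thesis by simp
qed

lemma zermelo_smooth: "smooth_on (zermelo_domain \<epsilon>) (zermelo \<epsilon>)"
  unfolding zermelo_def [abs_def]
proof (intro smooth_intros zermelo_domain_open)
  fix z assume "z \<in> zermelo_domain \<epsilon>"
  then have "wind \<epsilon> (fst z) \<bullet> wind \<epsilon> (fst z) < 1" "snd z \<noteq> 0"
    by (auto simp: zermelo_domain_def)
  then show "(snd z \<bullet> wind \<epsilon> (fst z))\<^sup>2 + (1 - wind \<epsilon> (fst z) \<bullet> wind \<epsilon> (fst z)) * (snd z \<bullet> snd z) > 0"
    "1 - wind \<epsilon> (fst z) \<bullet> wind \<epsilon> (fst z) \<noteq> 0"
    using zermelo_radicand_pos by auto
qed

text \<open>The second derivative is \<open>2 F'\<^sup>2 + 2 F F''\<close>, where \<open>F'' \<ge>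
  0\<close> by the Cauchy--Schwarz inequality in \<open>cs\<close>. If \<open>F'\<close>
  vanishes, then the numerator of \<open>F''\<close> reduces to \<open>l v2 Q > 0\<close>.\<close>

lemma randers_second_derivative_pos:
  fixes l B0 B1 v0 v1 v2 :: real
  assumes l: "l > 0" and v: "v0 > 0" "v2 > 0" and cs: "(B0 * B1 + l * v1)\<^sup>2 \<le> (B0\<^sup>2 + l * v0) * (B1\<^sup>2 + l * v2)"
    and F: "sqrt (B0\<^sup>2 + l * v0) - B0 > 0"
  defines "F \<equiv> \<lambda>t. (sqrt ((B0 + t * B1)\<^sup>2 + l * (v0 + 2 * t * v1 + t\<^sup>2 * v2)) - (B0 + t * B1)) / l"
  shows "deriv (deriv (\<lambda>t. (F t)\<^sup>2)) 0 > 0"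
proof -
  define Q where "Q t = (B0 + t * B1)\<^sup>2 + l * (v0 + 2 * t * v1 + t\<^sup>2 * v2)" for t
  define P where "P t = (B0 + t * B1) * B1 + l * (v1 + t * v2)" for t
  have Q0: "Q 0 > 0"
    unfolding Q_def using l v by (simp add: add_nonneg_pos)
  have dQ: "(Q has_real_derivative 2 * P t) (at t)" for t
    unfolding Q_def [abs_def] P_def by (auto intro!: derivative_eq_intros simp: power2_eq_square algebra_simps)
  have dP: "(P has_real_derivative (B1\<^sup>2 + l * v2)) (at t)" for t
    unfolding P_def [abs_def] by (auto intro!: derivative_eq_intros simp: power2_eq_square algebra_simps)
  have FQ: "F t = (sqrt (Q t) - (B0 + t * B1)) / l" for t
    by (simp add: F_def Q_def)
  define F' where "F' t = (P t / sqrt (Q t) - B1) / l" for t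
  have dS: "((\<lambda>t. sqrt (Q t)) has_real_derivative P t / sqrt (Q t)) (at t)" if "Q t > 0" for t
    using that by (auto intro!: derivative_eq_intros dQ simp: field_simps)
  have dF: "(F has_real_derivative F' t) (at t)" if "Q t > 0" for t
  proof -
    have "((\<lambda>t. B0 + t * B1) has_real_derivative B1) (at t)"
      by (auto intro!: derivative_eq_intros)
    then show ?thesis
      unfolding FQ [abs_def] F'_def by (intro DERIV_cdivide DERIV_diff dS that)
  qed
  define F'' where "F'' = ((B1\<^sup>2 + l * v2) * Q 0 - (P 0)\<^sup>2) / (sqrt (Q 0) ^ 3 * l)"
  have dF': "(F' has_real_derivative F'') (at 0)"
  proof -
    have s: "sqrt (Q 0) \<noteq> 0" "sqrt (Q 0) * sqrt (Q 0) = Q 0" using Q0 by simp_all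
    have "(F' has_real_derivative ((((B1\<^sup>2 + l * v2) * sqrt (Q 0) - P 0 * (P 0 / sqrt (Q 0))) / (sqrt (Q 0) * sqrt (Q 0)) - 0) / l)) (at 0)"
      unfolding F'_def [abs_def] using l s(1)
      by (intro DERIV_cdivide DERIV_diff DERIV_divide dP dS[OF Q0] DERIV_const) auto
    moreover have "(((B1\<^sup>2 + l * v2) * sqrt (Q 0) - P 0 * (P 0 / sqrt (Q 0))) / (sqrt (Q 0) * sqrt (Q 0)) - 0) / l = F''"
    proof -
      have "((B1\<^sup>2 + l * v2) * S - p * (p / S)) / (S * S) = ((B1\<^sup>2 + l * v2) * (S * S) - p\<^sup>2) / S ^ 3" if "S \<noteq> 0" for S p
        using that by (simp add: field_simps power2_eq_square power3_eq_cube)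
      from this[OF s(1), of "P 0"] show ?thesis
        unfolding F''_def s(2) by simp
    qed
    ultimately show ?thesis by simp
  qed
  have "isCont Q 0"
    using dQ DERIV_isCont by blast
  then have "\<forall>\<^sub>F t in nhds 0. Q t > 0"
    using Q0 order_tendstoD(1)[of Q "Q 0" "at 0" 0] by (simp add: isCont_def eventually_nhds_conv_at)
  then have "\<forall>\<^sub>F t in nhds 0. deriv (\<lambda>t. (F t)\<^sup>2) t = 2 * F t * F' t"
  proof eventually_elim
    case (elim t)
    have "((\<lambda>t. (F t)\<^sup>2) has_real_derivative 2 * F t * F' t) (at t)"
      by (auto intro!: derivative_eq_intros dF[OF elim])
    then show ?case by (rule DERIV_imp_deriv)
  qed
  then have "deriv (deriv (\<lambda>t. (F t)\<^sup>2)) 0 = deriv (\<lambda>t. 2 * F t * F' t) 0"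
    by (rule deriv_cong_ev) simp
  also have "\<dots> = 2 * (F' 0)\<^sup>2 + 2 * F 0 * F''"
    by (rule DERIV_imp_deriv) (auto intro!: derivative_eq_intros dF[OF Q0] dF' simp: power2_eq_square algebra_simps)
  also have "\<dots> > 0"
  proof -
    have F0: "F 0 > 0" using F l by (simp add: F_def)
    have P0: "(P 0)\<^sup>2 \<le> (B1\<^sup>2 + l * v2) * Q 0"
      using cs by (simp add: P_def Q_def mult.commute)
    have "F'' \<ge> 0"
      unfolding F''_def using P0 Q0 l by simp
    show ?thesis
    proof (cases "F' 0 = 0")
      case True
      then have "P 0 = B1 * sqrt (Q 0)"
        using Q0 l by (simp add: F'_def field_simps)
      then have "(P 0)\<^sup>2 = B1\<^sup>2 * Q 0"
        using Q0 by (simp add: power_mult_distrib)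
      then have "(B1\<^sup>2 + l * v2) * Q 0 - (P 0)\<^sup>2 = l * v2 * Q 0"
        by (simp add: algebra_simps)
      then have "F'' > 0"
        unfolding F''_def using Q0 l v by simp
      then show ?thesis using F0 True by simp
    next
      case False
      then show ?thesis
        using F0 \<open>F'' \<ge> 0\<close> by (intro add_pos_nonneg) auto
    qed
  qed
  finally show ?thesis .
qed

lemma zermelo_finsler:
  assumes \<epsilon>: "0 \<le> \<epsilon>" "\<epsilon> < 1"
  shows "finsler_metric (zermelo \<epsilon>)"
  unfolding finsler_metric_def
proof (intro conjI)
  have dom: "wind \<epsilon> x \<bullet> wind \<epsilon> x < 1" if "(x, v) \<in> TS2" for x v
    using that wind_less_1[OF _ \<epsilon>] by (simp add: TS2_def)
  show "smooth_map {(x, v) \<in> TS2. v \<noteq> 0} (zermelo \<epsilon>)"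
    by (rule smooth_mapI[OF _ zermelo_smooth]) (auto simp: zermelo_domain_def dom)
  show "\<forall>(x, v)\<in>TS2. v \<noteq> 0 \<longrightarrow> zermelo \<epsilon> (x, v) > 0"
    using dom zermelo_pos by auto
  show "\<forall>(x, v)\<in>TS2. \<forall>t>0. zermelo \<epsilon> (x, t *\<^sub>R v) = t * zermelo \<epsilon> (x, v)"
  proof (clarify)
    fix x v t assume xv: "(x, v) \<in> TS2" and t: "(t::real) > 0"
    show "zermelo \<epsilon> (x, t *\<^sub>R v) = t * zermelo \<epsilon> (x, v)"
    proof (cases "v = 0")
      case False
      have "(t *\<^sub>R v - (t * zermelo \<epsilon> (x, v)) *\<^sub>R wind \<epsilon> x) \<bullet> (t *\<^sub>R v - (t * zermelo \<epsilon> (x, v)) *\<^sub>R wind \<epsilon> x)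
        = t * t * ((v - zermelo \<epsilon> (x, v) *\<^sub>R wind \<epsilon> x) \<bullet> (v - zermelo \<epsilon> (x, v) *\<^sub>R wind \<epsilon> x))"
        by (simp add: inner_diff_left inner_diff_right algebra_simps)
      then show ?thesis
        using t zermelo_pos[OF dom[OF xv] False] zermelo_root[OF dom[OF xv], of v]
        by (intro zermelo_eqI dom[OF xv]) (simp_all add: power2_eq_square)
    qed simp
  qed
  show "\<forall>x v w. (x, v) \<in> TS2 \<and> (x, w) \<in> TS2 \<and> v \<noteq> 0 \<and> w \<noteq> 0 \<longrightarrow>
      deriv (deriv (\<lambda>t. (zermelo \<epsilon> (x, v + t *\<^sub>R w))\<^sup>2)) 0 > 0"
  proof (intro allI impI; elim conjE)
    fix x v w :: "real^3" assume xv: "(x, v) \<in> TS2" and nz: "v \<noteq> 0" "w \<noteq> 0"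
    let ?W = "wind \<epsilon> x"
    let ?l = "1 - ?W \<bullet> ?W"
    have l: "?l > 0" using dom[OF xv] by simp
    have z: "zermelo \<epsilon> (x, v + t *\<^sub>R w) = (sqrt ((v \<bullet> ?W + t * (w \<bullet> ?W))\<^sup>2
      + ?l * (v \<bullet> v + 2 * t * (v \<bullet> w) + t\<^sup>2 * (w \<bullet> w))) - (v \<bullet> ?W + t * (w \<bullet> ?W))) / ?l" for t
    proof -
      have "(v + t *\<^sub>R w) \<bullet> (v + t *\<^sub>R w) = v \<bullet> v + 2 * t * (v \<bullet> w) + t\<^sup>2 * (w \<bullet> w)"
        by (simp add: inner_add_left inner_add_right inner_commute power2_eq_square algebra_simps)
      then show ?thesis
        by (simp add: zermelo_def inner_add_left)
    qed
    show "deriv (deriv (\<lambda>t. (zermelo \<epsilon> (x, v + t *\<^sub>R w))\<^sup>2)) 0 > 0"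
      unfolding z
    proof (rule randers_second_derivative_pos[OF l])
      let ?a = "v \<bullet> ?W" and ?b = "w \<bullet> ?W"
      have "(?a\<^sup>2 + ?l * (v \<bullet> v)) * (?b\<^sup>2 + ?l * (w \<bullet> w)) - (?a * ?b + ?l * (v \<bullet> w))\<^sup>2
        = ?l * ((?b *\<^sub>R v - ?a *\<^sub>R w) \<bullet> (?b *\<^sub>R v - ?a *\<^sub>R w))
          + ?l\<^sup>2 * ((v \<bullet> v) * (w \<bullet> w) - (v \<bullet> w)\<^sup>2)"
        unfolding inner_diff_left inner_diff_right inner_scaleR_left inner_scaleR_right inner_commute[of w v]
        by algebra
      moreover have "(v \<bullet> v) * (w \<bullet> w) - (v \<bullet> w)\<^sup>2 \<ge> 0"
        using Cauchy_Schwarz_ineq[of v w] by simp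
      ultimately show "(?a * ?b + ?l * (v \<bullet> w))\<^sup>2 \<le> (?a\<^sup>2 + ?l * (v \<bullet> v)) * (?b\<^sup>2 + ?l * (w \<bullet> w))"
        using mult_nonneg_nonneg[OF less_imp_le[OF l] inner_ge_zero[of "?b *\<^sub>R v - ?a *\<^sub>R w"]]
          mult_nonneg_nonneg[OF zero_le_power2[of ?l], of "(v \<bullet> v) * (w \<bullet> w) - (v \<bullet> w)\<^sup>2"]
        by linarith
      show "sqrt (?a\<^sup>2 + ?l * (v \<bullet> v)) - ?a > 0"
        using zermelo_pos[OF dom[OF xv] nz(1)] l by (simp add: zermelo_def zero_less_divide_iff)
    qed (use nz in auto)
  qed
qed

subsection \<open>First variation of length\<close>

text \<open>The integrand is smooth only near the segment, for instance where a velocity does not vanish;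
  by compactness this suffices for differentiation under the integral sign.\<close>

lemma smooth_parameter_integral:
  fixes \<Psi> :: "real \<times> real \<Rightarrow> real"
  assumes \<Psi>: "smooth_on W \<Psi>" and W: "{0} \<times> {a..b} \<subseteq> W"
  shows "((\<lambda>s. integral {a..b} (\<lambda>t. \<Psi> (s, t))) has_real_derivative
    integral {a..b} (\<lambda>t. frechet_derivative \<Psi> (at (0, t)) (1, 0))) (at 0)"
proof -
  obtain X where X: "0 \<in> X" "open X" "X \<times> {a..b} \<subseteq> W"
    using Elementary_Topology.tube_lemma[OF _ smooth_on_open[OF \<Psi>] W] by auto
  obtain r where r: "r > 0" "ball 0 r \<subseteq> X"
    using X(1,2) open_contains_ball by blast
  let ?U = "ball (0::real) r"
  have sub: "(s, t) \<in> W" if "s \<in> ?U" "t \<in> {a..b}" for s t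
    using that r(2) X(3) by blast
  have d: "((\<lambda>s. \<Psi> (s, t)) has_field_derivative frechet_derivative \<Psi> (at (s, t)) (1, 0)) (at s within ?U)"
    if "s \<in> ?U" "t \<in> cbox a b" for s t
  proof -
    have "((\<lambda>s. (s, t)) has_vector_derivative (1, 0)) (at s)"
      by (auto intro!: derivative_eq_intros simp: has_vector_derivative_def)
    then have "((\<lambda>s. \<Psi> (s, t)) has_vector_derivative frechet_derivative \<Psi> (at (s, t)) (1, 0)) (at s)"
      by (rule curve_compose_derivative) (use that sub \<Psi> in \<open>auto intro: smooth_on_has_derivative\<close>)
    then show ?thesis
      by (simp add: has_real_derivative_iff_has_vector_derivative has_vector_derivative_at_within)
  qed
  have i: "(\<lambda>t. \<Psi> (s, t)) integrable_on cbox a b" if "s \<in> ?U" for s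
    by (rule integrable_continuous, rule continuous_on_compose2[OF smooth_on_imp_continuous_on[OF \<Psi>]])
      (use that sub in \<open>auto intro!: continuous_intros\<close>)
  have c: "continuous_on (?U \<times> cbox a b) (\<lambda>(s, t). frechet_derivative \<Psi> (at (s, t)) (1, 0))"
  proof -
    have "continuous_on (?U \<times> cbox a b) (\<lambda>z. frechet_derivative \<Psi> (at z) (1, 0))"
      by (rule continuous_on_subset[OF smooth_on_imp_continuous_on[OF smooth_on_frechet_derivative[OF \<Psi>]]])
        (use sub in auto)
    then show ?thesis by (simp add: case_prod_beta)
  qed
  have "((\<lambda>s. integral (cbox a b) (\<lambda>t. \<Psi> (s, t))) has_field_derivative
      integral (cbox a b) (\<lambda>t. frechet_derivative \<Psi> (at (0, t)) (1, 0))) (at 0 within ?U)"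
    using r(1) by (intro leibniz_rule_field_derivative[OF d i c]) auto
  then show ?thesis
    using r(1) by (simp add: at_within_open[of 0 ?U])
qed

section \<open>Geodesics\<close>

lemma smooth_partial_derivative:
  fixes f :: "real \<times> real \<Rightarrow> 'b::real_normed_vector"
  assumes "smooth_on W f" "(s, t) \<in> W"
  shows "((\<lambda>s. f (s, t)) has_vector_derivative frechet_derivative f (at (s, t)) (1, 0)) (at s)"
    and "((\<lambda>t. f (s, t)) has_vector_derivative frechet_derivative f (at (s, t)) (0, 1)) (at t)"
proof -
  note D = smooth_on_has_derivative[OF assms]
  have 1: "((\<lambda>s. (s, t)) has_vector_derivative (1, 0)) (at s)"
    by (auto intro!: derivative_eq_intros simp: has_vector_derivative_def)
  have 2: "((\<lambda>t. (s, t)) has_vector_derivative (0, 1)) (at t)"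
    by (auto intro!: derivative_eq_intros simp: has_vector_derivative_def)
  show "((\<lambda>s. f (s, t)) has_vector_derivative frechet_derivative f (at (s, t)) (1, 0)) (at s)"
    by (rule curve_compose_derivative[OF 1 D])
  show "((\<lambda>t. f (s, t)) has_vector_derivative frechet_derivative f (at (s, t)) (0, 1)) (at t)"
    by (rule curve_compose_derivative[OF 2 D])
qed

definition velocity :: "(real \<Rightarrow> 'a::euclidean_space) \<Rightarrow> real \<Rightarrow> 'a" where
  "velocity \<gamma> t = vector_derivative \<gamma> (at t)"

lemma velocity_smooth:
  assumes "smooth_on UNIV \<gamma>"
  shows "smooth_on UNIV (velocity \<gamma>)" "(\<gamma> has_vector_derivative velocity \<gamma> t) (at t)"
proof -
  have d: "(\<gamma> has_vector_derivative frechet_derivative \<gamma> (at t) 1) (at t)" for t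
  proof -
    have D: "(\<gamma> has_derivative frechet_derivative \<gamma> (at t)) (at t)"
      by (rule smooth_on_has_derivative[OF assms]) simp
    have e: "frechet_derivative \<gamma> (at t) h = h *\<^sub>R frechet_derivative \<gamma> (at t) 1" for h
      using linear_scale[OF has_derivative_linear[OF D], of h 1] by simp
    show ?thesis
      unfolding has_vector_derivative_def by (rule has_derivative_eq_rhs[OF D]) (rule ext, rule e)
  qed
  then have v: "velocity \<gamma> t = frechet_derivative \<gamma> (at t) 1" for t
    unfolding velocity_def by (rule vector_derivative_at)
  show "(\<gamma> has_vector_derivative velocity \<gamma> t) (at t)"
    unfolding v by (rule d)
  show "smooth_on UNIV (velocity \<gamma>)"
    unfolding v [abs_def] by (rule smooth_on_frechet_derivative[OF assms])
qed

definition airspeed :: "real \<Rightarrow> (real \<Rightarrow> real^3) \<Rightarrow> real \<Rightarrow> real^3" where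
  "airspeed \<epsilon> \<gamma> t = velocity \<gamma> t - wind \<epsilon> (\<gamma> t)"

text \<open>The derivative of the metric in the fibre direction at the velocity of
  \<open>\<gamma>\<close>, for curves of unit speed.\<close>

definition momentum :: "real \<Rightarrow> (real \<Rightarrow> real^3) \<Rightarrow> real \<Rightarrow> real^3" where
  "momentum \<epsilon> \<gamma> t = (1 / (1 + airspeed \<epsilon> \<gamma> t \<bullet> wind \<epsilon> (\<gamma> t))) *\<^sub>R airspeed \<epsilon> \<gamma> t"

definition euler_lagrange :: "real \<Rightarrow> (real \<Rightarrow> real^3) \<Rightarrow> real \<Rightarrow> real^3" where
  "euler_lagrange \<epsilon> \<gamma> t = velocity (momentum \<epsilon> \<gamma>) t - \<epsilon> *\<^sub>R cross3 (momentum \<epsilon> \<gamma> t) e1"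

lemma unit_speed_facts:
  assumes \<epsilon>: "0 \<le> \<epsilon>" "\<epsilon> < 1" and \<gamma>: "smooth_on UNIV \<gamma>" "\<And>t. norm (\<gamma> t) = 1"
    and F: "\<And>t. zermelo \<epsilon> (\<gamma> t, velocity \<gamma> t) = 1"
  shows "airspeed \<epsilon> \<gamma> t \<bullet> airspeed \<epsilon> \<gamma> t = 1" "airspeed \<epsilon> \<gamma> t \<bullet> \<gamma> t = 0"
    "1 + airspeed \<epsilon> \<gamma> t \<bullet> wind \<epsilon> (\<gamma> t) > 0"
    "smooth_on UNIV (airspeed \<epsilon> \<gamma>)" "smooth_on UNIV (momentum \<epsilon> \<gamma>)"
    "smooth_on UNIV (euler_lagrange \<epsilon> \<gamma>)"
proof -
  have w: "wind \<epsilon> (\<gamma> t) \<bullet> wind \<epsilon> (\<gamma> t) < 1" for t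
    by (rule wind_less_1[OF \<gamma>(2) \<epsilon>])
  show u: "airspeed \<epsilon> \<gamma> t \<bullet> airspeed \<epsilon> \<gamma> t = 1" for t
    using zermelo_root[OF w[of t], where v = "velocity \<gamma> t"] by (simp add: F airspeed_def)
  have "((\<lambda>t. \<gamma> t \<bullet> \<gamma> t) has_real_derivative \<gamma> t \<bullet> velocity \<gamma> t + velocity \<gamma> t \<bullet> \<gamma> t) (at t)"
    using bounded_bilinear.has_vector_derivative[OF bounded_bilinear_inner velocity_smooth(2)[OF \<gamma>(1)] velocity_smooth(2)[OF \<gamma>(1)]]
    by (simp add: has_real_derivative_iff_has_vector_derivative)
  moreover have "(\<lambda>t. \<gamma> t \<bullet> \<gamma> t) = (\<lambda>t. 1)"
    using \<gamma>(2) by (simp add: norm_eq_1)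
  ultimately have "\<gamma> t \<bullet> velocity \<gamma> t + velocity \<gamma> t \<bullet> \<gamma> t = 0"
    using DERIV_unique DERIV_const by metis
  then show "airspeed \<epsilon> \<gamma> t \<bullet> \<gamma> t = 0"
    by (simp add: airspeed_def wind_def inner_diff_left inner_diff_right dot_cross_self inner_commute)
  show pos: "1 + airspeed \<epsilon> \<gamma> t \<bullet> wind \<epsilon> (\<gamma> t) > 0" for t
  proof -
    have "norm (wind \<epsilon> (\<gamma> t)) < 1"
      using w[of t] by (simp add: norm_eq_sqrt_inner)
    moreover have "norm (airspeed \<epsilon> \<gamma> t) = 1"
      using u[of t] by (simp add: norm_eq_1)
    ultimately show ?thesis
      using Cauchy_Schwarz_ineq2[of "airspeed \<epsilon> \<gamma> t" "wind \<epsilon> (\<gamma> t)"] by simp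
  qed
  show a: "smooth_on UNIV (airspeed \<epsilon> \<gamma>)"
    unfolding airspeed_def [abs_def] by (intro smooth_intros velocity_smooth(1) \<gamma>(1))
  show m: "smooth_on UNIV (momentum \<epsilon> \<gamma>)"
    unfolding momentum_def [abs_def] using pos
    by (intro smooth_intros a \<gamma>(1) open_UNIV) (metis less_irrefl)
  show "smooth_on UNIV (euler_lagrange \<epsilon> \<gamma>)"
    unfolding euler_lagrange_def [abs_def] by (intro smooth_intros velocity_smooth(1) m open_UNIV)
qed

text \<open>With \<open>v\<close> the velocity and \<open>w\<close> the wind, differentiating \<open>|v -
  F w| = F\<close> at \<open>F = 1\<close> in the direction of the variation expresses the
  derivative of \<open>F\<close> by the momentum.\<close>

lemma first_variation:
  assumes \<epsilon>: "0 \<le> \<epsilon>" "\<epsilon> < 1" and \<gamma>: "smooth_on UNIV \<gamma>" "\<And>t. norm (\<gamma> t) = 1"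
    and F: "\<And>t. zermelo \<epsilon> (\<gamma> t, velocity \<gamma> t) = 1"
    and ab: "a < b" and \<delta>: "\<delta> > 0" and \<Gamma>: "smooth_on ({-\<delta><..<\<delta>} \<times> UNIV) \<Gamma>"
    and S2: "\<Gamma> ` ({-\<delta><..<\<delta>} \<times> UNIV) \<subseteq> S2" and \<Gamma>0: "\<And>t. \<Gamma> (0, t) = \<gamma> t"
    and ends: "\<And>s. s \<in> {-\<delta><..<\<delta>} \<Longrightarrow> \<Gamma> (s, a) = \<gamma> a \<and> \<Gamma> (s, b) = \<gamma> b"
  shows "((\<lambda>s. finsler_length (zermelo \<epsilon>) a b (\<lambda>t. \<Gamma> (s, t))) has_real_derivative
    - integral {a..b} (\<lambda>t. euler_lagrange \<epsilon> \<gamma> t \<bullet> frechet_derivative \<Gamma> (at (0, t)) (1, 0))) (at 0)"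
proof -
  let ?I = "{-\<delta><..<\<delta>}" let ?D = "?I \<times> (UNIV :: real set)"
  note facts = unit_speed_facts[OF \<epsilon> \<gamma> F]
  define G where "G z = frechet_derivative \<Gamma> (at z) (0, 1)" for z
  have G: "smooth_on ?D G"
    unfolding G_def [abs_def] by (rule smooth_on_frechet_derivative[OF \<Gamma>])
  have D: "open ?D" by (rule smooth_on_open[OF \<Gamma>])
  have \<Gamma>t: "((\<lambda>t. \<Gamma> (s, t)) has_vector_derivative G (s, t)) (at t)" if "s \<in> ?I" for s t
    unfolding G_def by (rule smooth_partial_derivative(2)[OF \<Gamma>]) (use that in simp)
  have n\<Gamma>: "norm (\<Gamma> z) = 1" if "z \<in> ?D" for z
  proof -
    have "\<Gamma> z \<in> S2" using S2 that by blast
    then show ?thesis by (simp add: S2_def)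
  qed
  have G0: "G (0, t) = velocity \<gamma> t" for t
    using \<Gamma>t[of 0 t] \<delta> unfolding \<Gamma>0 velocity_def by (simp add: vector_derivative_at)
  define W where "W = ?D \<inter> G -` (- {0})"
  have W: "open W"
    unfolding W_def by (rule continuous_open_preimage[OF smooth_on_imp_continuous_on[OF G] D]) auto
  have W0: "(0, t) \<in> W" for t
  proof -
    have "velocity \<gamma> t \<noteq> 0" using F[of t] by auto
    then show ?thesis using \<delta> by (simp add: W_def G0)
  qed
  define \<Phi> where "\<Phi> z = zermelo \<epsilon> (\<Gamma> z, G z)" for z
  have wl: "wind \<epsilon> (\<Gamma> z) \<bullet> wind \<epsilon> (\<Gamma> z) < 1" if "z \<in> ?D" for z
    by (rule wind_less_1[OF n\<Gamma>[OF that] \<epsilon>])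
  have pair: "smooth_on W (\<lambda>z. (\<Gamma> z, G z))"
    using smooth_on_subset[OF \<Gamma> W] smooth_on_subset[OF G W] by (intro smooth_on_Pair) (auto simp: W_def)
  have \<Phi>: "smooth_on W \<Phi>"
    unfolding \<Phi>_def [abs_def]
    by (rule smooth_on_compose[OF zermelo_smooth pair]) (simp add: W_def zermelo_domain_def wl)
  have L: "((\<lambda>s. integral {a..b} (\<lambda>t. \<Phi> (s, t))) has_real_derivative
    integral {a..b} (\<lambda>t. frechet_derivative \<Phi> (at (0, t)) (1, 0))) (at 0)"
    by (rule smooth_parameter_integral[OF \<Phi>]) (use W0 in auto)
  have len: "finsler_length (zermelo \<epsilon>) a b (\<lambda>t. \<Gamma> (s, t)) = integral {a..b} (\<lambda>t. \<Phi> (s, t))" if "s \<in> ?I" for s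
    unfolding finsler_length_def \<Phi>_def vector_derivative_at[OF \<Gamma>t[OF that]] ..
  let ?p = "momentum \<epsilon> \<gamma>" and ?p' = "velocity (momentum \<epsilon> \<gamma>)"
  \<comment> \<open>The derivative of \<open>p \<bullet> \<Gamma>\<close> in \<open>t\<close>: its integral depends on the end points only. Differentiating
     this fact in \<open>s\<close> integrates by parts without interchanging the derivatives in \<open>s\<close> and \<open>t\<close>.\<close>
  define \<Psi> where "\<Psi> z = ?p (snd z) \<bullet> G z + ?p' (snd z) \<bullet> \<Gamma> z" for z
  have sp: "smooth_on ?D (\<lambda>z. ?p (snd z))" "smooth_on ?D (\<lambda>z. ?p' (snd z))"
    by (rule smooth_on_compose[OF facts(5)] smooth_on_compose[OF velocity_smooth(1)[OF facts(5)]],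
        auto intro!: smooth_intros D)+
  have \<Psi>: "smooth_on ?D \<Psi>"
    unfolding \<Psi>_def [abs_def] by (intro smooth_intros sp G \<Gamma>)
  have int\<Psi>: "integral {a..b} (\<lambda>t. \<Psi> (s, t)) = ?p b \<bullet> \<gamma> b - ?p a \<bullet> \<gamma> a" if s: "s \<in> ?I" for s
  proof -
    have "((\<lambda>t. ?p t \<bullet> \<Gamma> (s, t)) has_vector_derivative \<Psi> (s, t)) (at t)" for t
      using bounded_bilinear.has_vector_derivative[OF bounded_bilinear_inner
          velocity_smooth(2)[OF facts(5)] \<Gamma>t[OF s]] by (simp add: \<Psi>_def)
    then have "((\<lambda>t. \<Psi> (s, t)) has_integral ?p b \<bullet> \<Gamma> (s, b) - ?p a \<bullet> \<Gamma> (s, a)) {a..b}"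
      using ab by (intro fundamental_theorem_of_calculus) (auto intro: has_vector_derivative_at_within)
    then show ?thesis
      using ends[OF s] by (simp add: integral_unique)
  qed
  have I: "open ?I" "0 \<in> ?I" using \<delta> by auto
  have "((\<lambda>s. integral {a..b} (\<lambda>t. \<Psi> (s, t))) has_real_derivative
    integral {a..b} (\<lambda>t. frechet_derivative \<Psi> (at (0, t)) (1, 0))) (at 0)"
    by (rule smooth_parameter_integral[OF \<Psi>]) (use \<delta> in auto)
  moreover have "((\<lambda>s. integral {a..b} (\<lambda>t. \<Psi> (s, t))) has_real_derivative 0) (at 0)"
    by (rule has_field_derivative_transform_within_open[OF DERIV_const I]) (simp add: int\<Psi>)
  ultimately have zero: "integral {a..b} (\<lambda>t. frechet_derivative \<Psi> (at (0, t)) (1, 0)) = 0"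
    by (rule DERIV_unique)
  define V where "V t = frechet_derivative \<Gamma> (at (0, t)) (1, 0)" for t
  define Z where "Z t = frechet_derivative G (at (0, t)) (1, 0)" for t
  have D0: "(0, t) \<in> ?D" for t using \<delta> by simp
  have dG: "((\<lambda>s. \<Gamma> (s, t)) has_vector_derivative V t) (at 0)" "((\<lambda>s. G (s, t)) has_vector_derivative Z t) (at 0)" for t
    unfolding V_def Z_def by (rule smooth_partial_derivative(1)[OF \<Gamma> D0] smooth_partial_derivative(1)[OF G D0])+
  have \<Psi>s: "frechet_derivative \<Psi> (at (0, t)) (1, 0) = ?p t \<bullet> Z t + ?p' t \<bullet> V t" for t
  proof -
    have "((\<lambda>s. \<Psi> (s, t)) has_vector_derivative ?p t \<bullet> Z t + ?p' t \<bullet> V t) (at 0)"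
      unfolding \<Psi>_def snd_conv
      by (intro has_vector_derivative_add bounded_linear.has_vector_derivative[OF bounded_linear_inner_right] dG)
    then show ?thesis
      using smooth_partial_derivative(1)[OF \<Psi> D0] vector_derivative_unique_at by blast
  qed
  have \<Phi>s: "frechet_derivative \<Phi> (at (0, t)) (1, 0) = ?p t \<bullet> Z t - \<epsilon> * (?p t \<bullet> cross3 (V t) e1)" for t
  proof -
    let ?f' = "frechet_derivative \<Phi> (at (0, t)) (1, 0)"
    let ?y = "airspeed \<epsilon> \<gamma> t" and ?w = "wind \<epsilon> (\<gamma> t)"
    have \<Phi>0: "\<Phi> (0, t) = 1" by (simp add: \<Phi>_def \<Gamma>0 G0 F)
    have df: "((\<lambda>s. \<Phi> (s, t)) has_vector_derivative ?f') (at 0)"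
      by (rule smooth_partial_derivative(1)[OF \<Phi> W0])
    have dw: "((\<lambda>s. wind \<epsilon> (\<Gamma> (s, t))) has_vector_derivative \<epsilon> *\<^sub>R cross3 (V t) e1) (at 0)"
      unfolding wind_def
      by (rule bounded_linear.has_vector_derivative[OF bounded_linear_scaleR_right
            bounded_linear.has_vector_derivative[OF bounded_bilinear.bounded_linear_left[OF bounded_bilinear_cross3] dG(1)]])
    let ?A = "\<lambda>s. G (s, t) - \<Phi> (s, t) *\<^sub>R wind \<epsilon> (\<Gamma> (s, t))"
    have dA: "(?A has_vector_derivative Z t - (\<epsilon> *\<^sub>R cross3 (V t) e1 + ?f' *\<^sub>R ?w)) (at 0)"
      using has_vector_derivative_diff[OF dG(2) bounded_bilinear.has_vector_derivative[OF bounded_bilinear_scaleR df dw]]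
      by (simp add: \<Phi>0 \<Gamma>0)
    have A0: "?A 0 = ?y" by (simp add: \<Phi>0 \<Gamma>0 G0 airspeed_def)
    have l: "((\<lambda>s. ?A s \<bullet> ?A s) has_vector_derivative
        2 * (?y \<bullet> (Z t - (\<epsilon> *\<^sub>R cross3 (V t) e1 + ?f' *\<^sub>R ?w)))) (at 0)"
      using bounded_bilinear.has_vector_derivative[OF bounded_bilinear_inner dA dA]
      unfolding A0 by (simp add: inner_commute)
    have r: "((\<lambda>s. \<Phi> (s, t) * \<Phi> (s, t)) has_vector_derivative 2 * ?f') (at 0)"
      using bounded_bilinear.has_vector_derivative[OF bounded_bilinear_mult df df] by (simp add: \<Phi>0)
    have "((\<lambda>s. ?A s \<bullet> ?A s) has_vector_derivative 2 * ?f') (at 0)"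
      by (rule has_vector_derivative_transform_within_open[OF r I])
        (simp add: \<Phi>_def zermelo_root[OF wl] power2_eq_square)
    then have "2 * (?y \<bullet> (Z t - (\<epsilon> *\<^sub>R cross3 (V t) e1 + ?f' *\<^sub>R ?w))) = 2 * ?f'"
      using l vector_derivative_unique_at by blast
    then have "?f' * (1 + ?y \<bullet> ?w) = ?y \<bullet> Z t - \<epsilon> * (?y \<bullet> cross3 (V t) e1)"
      by (simp add: inner_diff_right inner_add_right algebra_simps)
    then have "?f' = (?y \<bullet> Z t - \<epsilon> * (?y \<bullet> cross3 (V t) e1)) / (1 + ?y \<bullet> ?w)"
      using facts(3)[of t] by (simp add: nonzero_eq_divide_eq)
    then show ?thesis
      by (simp add: momentum_def diff_divide_distrib)
  qed
  have "frechet_derivative \<Phi> (at (0, t)) (1, 0) =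
      frechet_derivative \<Psi> (at (0, t)) (1, 0) - euler_lagrange \<epsilon> \<gamma> t \<bullet> V t" for t
  proof -
    have "?p t \<bullet> cross3 (V t) e1 = - (cross3 (?p t) e1 \<bullet> V t)"
      using cross_triple[of "?p t" e1 "V t"] cross_skew[of e1 "V t"] by (simp add: inner_commute)
    then show ?thesis
      unfolding \<Phi>s \<Psi>s euler_lagrange_def by (simp add: inner_diff_left)
  qed
  moreover have "integral {a..b} (\<lambda>t. frechet_derivative \<Psi> (at (0, t)) (1, 0) - euler_lagrange \<epsilon> \<gamma> t \<bullet> V t)
    = 0 - integral {a..b} (\<lambda>t. euler_lagrange \<epsilon> \<gamma> t \<bullet> V t)"
  proof -
    have ct: "continuous_on {a..b} (\<lambda>t. (0::real, t))"
      by (intro continuous_intros)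
    have c1: "continuous_on {a..b} (\<lambda>t. frechet_derivative \<Psi> (at (0, t)) (1, 0))"
      by (rule continuous_on_compose2[OF smooth_on_imp_continuous_on[OF smooth_on_frechet_derivative[OF \<Psi>]] ct])
        (use D0 in auto)
    have "continuous_on {a..b} V"
      unfolding V_def [abs_def]
      by (rule continuous_on_compose2[OF smooth_on_imp_continuous_on[OF smooth_on_frechet_derivative[OF \<Gamma>]] ct])
        (use D0 in auto)
    moreover have "continuous_on {a..b} (euler_lagrange \<epsilon> \<gamma>)"
      using smooth_on_imp_continuous_on[OF facts(6)] by (rule continuous_on_subset) simp
    ultimately have c2: "continuous_on {a..b} (\<lambda>t. euler_lagrange \<epsilon> \<gamma> t \<bullet> V t)"
      by (intro continuous_on_inner)
    show ?thesis
      using integral_diff[OF integrable_continuous_interval[OF c1] integrable_continuous_interval[OF c2]]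
      unfolding zero .
  qed
  ultimately have "integral {a..b} (\<lambda>t. frechet_derivative \<Phi> (at (0, t)) (1, 0))
    = - integral {a..b} (\<lambda>t. euler_lagrange \<epsilon> \<gamma> t \<bullet> V t)"
    by simp
  with L have "((\<lambda>s. integral {a..b} (\<lambda>t. \<Phi> (s, t))) has_real_derivative
    - integral {a..b} (\<lambda>t. euler_lagrange \<epsilon> \<gamma> t \<bullet> V t)) (at 0)"
    by simp
  then have "((\<lambda>s. finsler_length (zermelo \<epsilon>) a b (\<lambda>t. \<Gamma> (s, t))) has_real_derivative
    - integral {a..b} (\<lambda>t. euler_lagrange \<epsilon> \<gamma> t \<bullet> V t)) (at 0)"
    by (rule has_field_derivative_transform_within_open[OF _ I]) (simp add: len)
  then show ?thesis
    unfolding V_def .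
qed

subsection \<open>Geodesics and flow lines\<close>

text \<open>The curve \<open>\<gamma>\<close> together with its velocity \<open>y\<close> relative to the
  wind; both are carried along by the rotation.\<close>

definition navigation_pair :: "real \<Rightarrow> (real \<Rightarrow> real^3) \<Rightarrow> (real \<Rightarrow> real^3) \<Rightarrow> bool" where
  "navigation_pair \<epsilon> \<gamma> y \<longleftrightarrow> (\<forall>t. norm (\<gamma> t) = 1 \<and> norm (y t) = 1 \<and> \<gamma> t \<bullet> y t = 0 \<and>
     (\<gamma> has_vector_derivative y t + \<epsilon> *\<^sub>R cross3 (\<gamma> t) e1) (at t) \<and>
     (y has_vector_derivative - \<gamma> t + \<epsilon> *\<^sub>R cross3 (y t) e1) (at t))"

text \<open>This quantity is the momentum of the rotation about the fixed axis, which is a symmetry of the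
  equations.\<close>

lemma navigation_pair_conserved:
  assumes "navigation_pair \<epsilon> \<gamma> y"
  shows "cross3 (y t) (\<gamma> t) \<bullet> e1 = cross3 (y 0) (\<gamma> 0) \<bullet> e1"
proof -
  have d: "(\<gamma> has_vector_derivative y t + \<epsilon> *\<^sub>R cross3 (\<gamma> t) e1) (at t)"
    "(y has_vector_derivative - \<gamma> t + \<epsilon> *\<^sub>R cross3 (y t) e1) (at t)" for t
    using assms by (auto simp: navigation_pair_def)
  have "((\<lambda>t. cross3 (y t) (\<gamma> t) \<bullet> e1) has_real_derivative 0) (at t)" for t
  proof -
    have "(cross3 (y t) (y t + \<epsilon> *\<^sub>R cross3 (\<gamma> t) e1) + cross3 (- \<gamma> t + \<epsilon> *\<^sub>R cross3 (y t) e1) (\<gamma> t)) \<bullet> e1 = 0"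
      by (simp add: inner_vec_def sum_3 cross_components axis_def algebra_simps)
    then show ?thesis
      using bounded_linear.has_vector_derivative[OF bounded_linear_inner_left[of e1]
          bounded_bilinear.has_vector_derivative[OF bounded_bilinear_cross3 d(2)[of t] d(1)[of t]]]
      by (simp add: has_real_derivative_iff_has_vector_derivative)
  qed
  then show ?thesis
    by (rule DERIV_isconst_all[rule_format, of "\<lambda>t. cross3 (y t) (\<gamma> t) \<bullet> e1"])
qed

text \<open>Along such a curve the Euler--Lagrange field is normal to the sphere.\<close>

lemma navigation_pair_geodesic:
  assumes \<epsilon>: "0 \<le> \<epsilon>" "\<epsilon> < 1" and p: "navigation_pair \<epsilon> \<gamma> y"
  shows "finsler_geodesic (zermelo \<epsilon>) 1 \<gamma>"
proof -
  have n: "norm (\<gamma> t) = 1" "norm (y t) = 1" "\<gamma> t \<bullet> y t = 0"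
    and d\<gamma>: "(\<gamma> has_vector_derivative y t + \<epsilon> *\<^sub>R cross3 (\<gamma> t) e1) (at t)"
    and dy: "(y has_vector_derivative - \<gamma> t + \<epsilon> *\<^sub>R cross3 (y t) e1) (at t)" for t
    using p by (auto simp: navigation_pair_def)
  let ?A = "\<lambda>z::(real^3) \<times> (real^3). (snd z + \<epsilon> *\<^sub>R cross3 (fst z) e1, - fst z + \<epsilon> *\<^sub>R cross3 (snd z) e1)"
  have "linear ?A"
    by (auto simp: linear_iff cross_add_left cross_mult_left algebra_simps)
  then have "bounded_linear ?A"
    by (simp add: linear_conv_bounded_linear)
  moreover have "((\<lambda>t. (\<gamma> t, y t)) has_vector_derivative ?A (\<gamma> t, y t)) (at t)" for t
    using d\<gamma> dy by (simp add: has_vector_derivative_Pair)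
  ultimately have "smooth_on UNIV (\<lambda>t. (\<gamma> t, y t))"
    by (rule smooth_on_linear_ode)
  from smooth_on_fst[OF this] have \<gamma>: "smooth_on UNIV \<gamma>" by simp
  have v: "velocity \<gamma> t = y t + wind \<epsilon> (\<gamma> t)" for t
    unfolding velocity_def wind_def by (rule vector_derivative_at[OF d\<gamma>])
  have F: "zermelo \<epsilon> (\<gamma> t, velocity \<gamma> t) = 1" for t
    using n(2)[of t] by (intro zermelo_eqI wind_less_1[OF n(1) \<epsilon>]) (simp_all add: v norm_eq_1)
  have a: "airspeed \<epsilon> \<gamma> t = y t" for t
    by (simp add: airspeed_def v)
  define \<rho> where "\<rho> = 1 / (1 + \<epsilon> * (cross3 (y 0) (\<gamma> 0) \<bullet> e1))"
  have m: "momentum \<epsilon> \<gamma> t = \<rho> *\<^sub>R y t" for t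
  proof -
    have "y t \<bullet> wind \<epsilon> (\<gamma> t) = \<epsilon> * (cross3 (y t) (\<gamma> t) \<bullet> e1)"
      using cross_triple[of "y t" "\<gamma> t" e1] by (simp add: wind_def inner_commute)
    then show ?thesis
      unfolding momentum_def a navigation_pair_conserved[OF p, of t] \<rho>_def by simp
  qed
  have E: "euler_lagrange \<epsilon> \<gamma> t = - \<rho> *\<^sub>R \<gamma> t" for t
  proof -
    have "velocity (momentum \<epsilon> \<gamma>) t = \<rho> *\<^sub>R (- \<gamma> t + \<epsilon> *\<^sub>R cross3 (y t) e1)"
      unfolding velocity_def m [abs_def]
      by (rule vector_derivative_at[OF bounded_linear.has_vector_derivative[OF bounded_linear_scaleR_right dy]])
    then show ?thesis
      by (simp add: euler_lagrange_def m cross_mult_left algebra_simps)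
  qed
  show ?thesis
    unfolding finsler_geodesic_def
  proof (intro conjI allI impI; (elim conjE)?)
    show "range \<gamma> \<subseteq> S2" using n by (auto simp: S2_def)
    show "zermelo \<epsilon> (\<gamma> t, vector_derivative \<gamma> (at t)) = 1" for t
      using F by (simp add: velocity_def)
    fix a b \<delta> :: real and \<Gamma> :: "real \<times> real \<Rightarrow> real^3"
    assume ab: "a < b" "\<delta> > 0" and \<Gamma>: "smooth_on ({-\<delta><..<\<delta>} \<times> UNIV) \<Gamma>"
      "\<Gamma> ` ({-\<delta><..<\<delta>} \<times> UNIV) \<subseteq> S2" "\<forall>t. \<Gamma> (0, t) = \<gamma> t"
      "\<forall>s\<in>{-\<delta><..<\<delta>}. \<Gamma> (s, a) = \<gamma> a \<and> \<Gamma> (s, b) = \<gamma> b"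
    have V: "\<gamma> t \<bullet> frechet_derivative \<Gamma> (at (0, t)) (1, 0) = 0" for t
    proof -
      let ?V = "frechet_derivative \<Gamma> (at (0, t)) (1, 0)"
      have dV: "((\<lambda>s. \<Gamma> (s, t)) has_vector_derivative ?V) (at 0)"
        by (rule smooth_partial_derivative(1)[OF \<Gamma>(1)]) (use ab in simp)
      have 1: "((\<lambda>s. \<Gamma> (s, t) \<bullet> \<Gamma> (s, t)) has_vector_derivative \<gamma> t \<bullet> ?V + ?V \<bullet> \<gamma> t) (at 0)"
        using bounded_bilinear.has_vector_derivative[OF bounded_bilinear_inner dV dV] \<Gamma>(3) by simp
      have c: "((\<lambda>s::real. 1::real) has_vector_derivative 0) (at 0)"
        by (rule has_vector_derivative_const)
      have "\<Gamma> (s, t) \<bullet> \<Gamma> (s, t) = 1" if "s \<in> {-\<delta><..<\<delta>}" for s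
      proof -
        have "\<Gamma> (s, t) \<in> S2" using \<Gamma>(2) that by blast
        then show ?thesis by (simp add: S2_def norm_eq_1)
      qed
      then have "((\<lambda>s. \<Gamma> (s, t) \<bullet> \<Gamma> (s, t)) has_vector_derivative 0) (at 0)"
        by (intro has_vector_derivative_transform_within_open[OF c, of "{-\<delta><..<\<delta>}"])
          (use ab in auto)
      then have "\<gamma> t \<bullet> ?V + ?V \<bullet> \<gamma> t = 0"
        using 1 vector_derivative_unique_at by blast
      then show ?thesis by (simp add: inner_commute)
    qed
    have "((\<lambda>s. finsler_length (zermelo \<epsilon>) a b (\<lambda>t. \<Gamma> (s, t))) has_real_derivative
      - integral {a..b} (\<lambda>t. euler_lagrange \<epsilon> \<gamma> t \<bullet> frechet_derivative \<Gamma> (at (0, t)) (1, 0))) (at 0)"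
      by (rule first_variation[OF \<epsilon> \<gamma> n(1) F ab \<Gamma>(1,2)]) (use \<Gamma>(3,4) in auto)
    then show "((\<lambda>s. finsler_length (zermelo \<epsilon>) a b (\<lambda>t. \<Gamma> (s, t))) has_real_derivative 0) (at 0)"
      by (simp add: E V)
  qed (use \<gamma> in auto)
qed

text \<open>A single variation suffices: the tangential part of the Euler--Lagrange field, multiplied by
  \<open>(t - a) (b - t)\<close> to vanish at the end points. It is smooth because \<open>\<gamma>\<close> is, and it makes the
  first variation the integral of a square with positive weight.\<close>

lemma geodesic_euler_lagrange:
  assumes \<epsilon>: "0 \<le> \<epsilon>" "\<epsilon> < 1" and g: "finsler_geodesic (zermelo \<epsilon>) 1 \<gamma>"
  shows "euler_lagrange \<epsilon> \<gamma> t = (euler_lagrange \<epsilon> \<gamma> t \<bullet> \<gamma> t) *\<^sub>R \<gamma> t"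
proof -
  have \<gamma>: "smooth_on UNIV \<gamma>" and n: "\<And>t. norm (\<gamma> t) = 1"
    and F: "\<And>t. zermelo \<epsilon> (\<gamma> t, velocity \<gamma> t) = 1"
    using g by (auto simp: finsler_geodesic_def S2_def velocity_def image_subset_iff)
  note facts = unit_speed_facts[OF \<epsilon> \<gamma> n F]
  let ?E = "euler_lagrange \<epsilon> \<gamma>"
  define T where "T t = ?E t - (?E t \<bullet> \<gamma> t) *\<^sub>R \<gamma> t" for t
  have sT: "smooth_on UNIV T"
    unfolding T_def [abs_def] by (intro smooth_intros facts(6) \<gamma>)
  have T\<gamma>: "T t \<bullet> \<gamma> t = 0" for t
    using n[of t] by (simp add: T_def inner_diff_left norm_eq_1)
  define a b where "a = t - 1" and "b = t + 1"
  define \<eta> where "\<eta> \<tau> = ((\<tau> - a) * (b - \<tau>)) *\<^sub>R T \<tau>" for \<tau>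
  have s\<eta>: "smooth_on UNIV \<eta>"
    unfolding \<eta>_def [abs_def] by (intro smooth_intros sT open_UNIV)
  define B where "B z = \<gamma> (snd z) + fst z *\<^sub>R \<eta> (snd z)" for z :: "real \<times> real"
  define \<Gamma> where "\<Gamma> z = B z /\<^sub>R norm (B z)" for z
  have sB: "smooth_on UNIV B"
    unfolding B_def [abs_def]
    by (intro smooth_intros smooth_on_compose[OF \<gamma>] smooth_on_compose[OF s\<eta>] open_UNIV) auto
  have "B z \<bullet> \<gamma> (snd z) = 1" for z
    using n[of "snd z"] T\<gamma>[of "snd z"] by (simp add: B_def inner_add_left \<eta>_def norm_eq_1)
  then have B0: "B z \<noteq> 0" for z
    by (metis inner_zero_left zero_neq_one)
  have s\<Gamma>: "smooth_on ({-1<..<1} \<times> UNIV) \<Gamma>"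
  proof -
    have "smooth_on UNIV \<Gamma>"
      unfolding \<Gamma>_def [abs_def] using B0 by (intro smooth_intros sB) auto
    then show ?thesis
      by (rule smooth_on_subset) (auto intro!: open_Times)
  qed
  have \<Gamma>0: "\<Gamma> (0, \<tau>) = \<gamma> \<tau>" for \<tau>
    using n[of \<tau>] by (simp add: \<Gamma>_def B_def)
  have ends: "\<Gamma> (s, a) = \<gamma> a" "\<Gamma> (s, b) = \<gamma> b" for s
    using n by (simp_all add: \<Gamma>_def B_def \<eta>_def)
  have S2: "\<Gamma> ` ({-1<..<1} \<times> UNIV) \<subseteq> S2"
    using B0 by (auto simp: \<Gamma>_def S2_def)
  have ab: "a < b" by (simp add: a_def b_def)
  have V: "frechet_derivative \<Gamma> (at (0, \<tau>)) (1, 0) = \<eta> \<tau>" for \<tau>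
  proof -
    have d1: "((\<lambda>s. \<Gamma> (s, \<tau>)) has_vector_derivative frechet_derivative \<Gamma> (at (0, \<tau>)) (1, 0)) (at 0)"
      by (rule smooth_partial_derivative(1)[OF s\<Gamma>]) simp
    have dB: "((\<lambda>s. B (s, \<tau>)) has_vector_derivative \<eta> \<tau>) (at 0)"
      unfolding B_def by (auto intro!: derivative_eq_intros)
    have "((\<lambda>s. B (s, \<tau>) /\<^sub>R norm (B (s, \<tau>))) has_vector_derivative \<eta> \<tau> - (\<gamma> \<tau> \<bullet> \<eta> \<tau>) *\<^sub>R \<gamma> \<tau>) (at 0)"
      by (rule curve_compose_derivative[OF dB, of "\<lambda>q. q /\<^sub>R norm q"])
        (use normalize_has_derivative[OF n[of \<tau>]] in \<open>simp add: B_def\<close>)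
    moreover have "\<gamma> \<tau> \<bullet> \<eta> \<tau> = 0"
      using T\<gamma>[of \<tau>] by (simp add: \<eta>_def inner_commute)
    ultimately have "((\<lambda>s. \<Gamma> (s, \<tau>)) has_vector_derivative \<eta> \<tau>) (at 0)"
      by (simp add: \<Gamma>_def)
    then show ?thesis
      using d1 vector_derivative_unique_at by blast
  qed
  have "((\<lambda>s. finsler_length (zermelo \<epsilon>) a b (\<lambda>t. \<Gamma> (s, t))) has_real_derivative
      - integral {a..b} (\<lambda>t. ?E t \<bullet> \<eta> t)) (at 0)"
    using first_variation[OF \<epsilon> \<gamma> n F ab zero_less_one s\<Gamma> S2 \<Gamma>0] ends unfolding V by simp
  moreover have "((\<lambda>s. finsler_length (zermelo \<epsilon>) a b (\<lambda>t. \<Gamma> (s, t))) has_real_derivative 0) (at 0)"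
    using g ab s\<Gamma> S2 \<Gamma>0 ends zero_less_one unfolding finsler_geodesic_def by blast
  ultimately have "- integral {a..b} (\<lambda>t. ?E t \<bullet> \<eta> t) = 0"
    by (rule DERIV_unique)
  moreover have "?E \<tau> \<bullet> \<eta> \<tau> = (\<tau> - a) * (b - \<tau>) * (T \<tau> \<bullet> T \<tau>)" for \<tau>
  proof -
    have "T \<tau> \<bullet> T \<tau> = ?E \<tau> \<bullet> T \<tau>"
      using T\<gamma>[of \<tau>] by (subst T_def) (simp add: inner_diff_left inner_diff_right inner_commute)
    then show ?thesis by (simp add: \<eta>_def)
  qed
  ultimately have int: "integral {a..b} (\<lambda>\<tau>. (\<tau> - a) * (b - \<tau>) * (T \<tau> \<bullet> T \<tau>)) = 0"
    by simp
  have "continuous_on {a..b} T"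
    using smooth_on_imp_continuous_on[OF sT] by (rule continuous_on_subset) simp
  then have "continuous_on {a..b} (\<lambda>\<tau>. (\<tau> - a) * (b - \<tau>) * (T \<tau> \<bullet> T \<tau>))"
    by (intro continuous_intros)
  then have "\<forall>\<tau>\<in>{a..b}. (\<tau> - a) * (b - \<tau>) * (T \<tau> \<bullet> T \<tau>) = 0"
    using int ab by (subst (asm) integral_eq_0_iff) auto
  then have "T t \<bullet> T t = 0"
    by (auto simp: a_def b_def dest!: bspec[of _ _ t])
  then show ?thesis
    by (simp add: T_def)
qed

text \<open>The tangential Euler--Lagrange equation is decomposed along \<open>\<gamma>\<close> and the
  airspeed \<open>y\<close>.\<close>

lemma geodesic_navigation_pair:
  assumes \<epsilon>: "0 \<le> \<epsilon>" "\<epsilon> < 1" and g: "finsler_geodesic (zermelo \<epsilon>) 1 \<gamma>"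
  shows "navigation_pair \<epsilon> \<gamma> (airspeed \<epsilon> \<gamma>)"
proof -
  have \<gamma>: "smooth_on UNIV \<gamma>" and n: "\<And>t. norm (\<gamma> t) = 1"
    and F: "\<And>t. zermelo \<epsilon> (\<gamma> t, velocity \<gamma> t) = 1"
    using g by (auto simp: finsler_geodesic_def S2_def velocity_def image_subset_iff)
  note facts = unit_speed_facts[OF \<epsilon> \<gamma> n F]
  let ?y = "airspeed \<epsilon> \<gamma>"
  have d\<gamma>: "(\<gamma> has_vector_derivative ?y t + \<epsilon> *\<^sub>R cross3 (\<gamma> t) e1) (at t)" for t
    using velocity_smooth(2)[OF \<gamma>, of t] by (simp add: airspeed_def wind_def)
  have dy: "(?y has_vector_derivative velocity ?y t) (at t)" for t
    by (rule velocity_smooth(2)[OF facts(4)])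
  define \<rho> where "\<rho> t = 1 / (1 + ?y t \<bullet> wind \<epsilon> (\<gamma> t))" for t
  have s\<rho>: "smooth_on UNIV \<rho>"
    unfolding \<rho>_def [abs_def] using facts(3)
    by (intro smooth_intros facts(4) \<gamma> open_UNIV) (metis less_irrefl)
  have m: "momentum \<epsilon> \<gamma> = (\<lambda>t. \<rho> t *\<^sub>R ?y t)"
    by (simp add: momentum_def \<rho>_def fun_eq_iff)
  have "velocity ?y t = - \<gamma> t + \<epsilon> *\<^sub>R cross3 (?y t) e1" for t
  proof -
    let ?y' = "velocity ?y t" and ?r' = "velocity \<rho> t" and ?x = "\<gamma> t"
    have "velocity (momentum \<epsilon> \<gamma>) t = \<rho> t *\<^sub>R ?y' + ?r' *\<^sub>R ?y t"
      unfolding m velocity_def[of "\<lambda>t. \<rho> t *\<^sub>R ?y t"]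
      by (rule vector_derivative_at[OF bounded_bilinear.has_vector_derivative[OF bounded_bilinear_scaleR
              velocity_smooth(2)[OF s\<rho>] dy]])
    then obtain \<mu> where \<mu>: "\<rho> t *\<^sub>R ?y' + ?r' *\<^sub>R ?y t - (\<epsilon> * \<rho> t) *\<^sub>R cross3 (?y t) e1 = \<mu> *\<^sub>R ?x"
      using geodesic_euler_lagrange[OF \<epsilon> g, of t] by (auto simp: euler_lagrange_def m cross_mult_left)
    have yy: "?y t \<bullet> ?y' = 0"
    proof -
      have "((\<lambda>t. ?y t \<bullet> ?y t) has_vector_derivative ?y t \<bullet> ?y' + ?y' \<bullet> ?y t) (at t)"
        by (rule bounded_bilinear.has_vector_derivative[OF bounded_bilinear_inner dy dy])
      moreover have "((\<lambda>t. ?y t \<bullet> ?y t) has_vector_derivative 0) (at t)"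
        by (simp add: facts(1) has_vector_derivative_const)
      ultimately have "?y t \<bullet> ?y' + ?y' \<bullet> ?y t = 0"
        using vector_derivative_unique_at by blast
      then show ?thesis by (simp add: inner_commute)
    qed
    have yx: "?y' \<bullet> ?x = - (1 + ?y t \<bullet> wind \<epsilon> ?x)"
    proof -
      have "((\<lambda>t. ?y t \<bullet> \<gamma> t) has_vector_derivative ?y t \<bullet> (?y t + \<epsilon> *\<^sub>R cross3 ?x e1) + ?y' \<bullet> ?x) (at t)"
        by (rule bounded_bilinear.has_vector_derivative[OF bounded_bilinear_inner dy d\<gamma>])
      moreover have "((\<lambda>t. ?y t \<bullet> \<gamma> t) has_vector_derivative 0) (at t)"
        by (simp add: facts(2) has_vector_derivative_const)
      ultimately have "?y t \<bullet> (?y t + \<epsilon> *\<^sub>R cross3 ?x e1) + ?y' \<bullet> ?x = 0"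
        using vector_derivative_unique_at by blast
      then show ?thesis by (simp add: inner_add_right facts(1) wind_def)
    qed
    \<comment> \<open>the component along \<open>y\<close> shows that \<open>\<rho>\<close> is constant, the one along \<open>\<gamma>\<close> gives \<open>\<mu> = - \<rho>\<close>\<close>
    have "?r' = 0"
      using arg_cong[OF \<mu>, of "\<lambda>v. v \<bullet> ?y t"] yy facts(1,2)[of t]
      by (simp add: inner_diff_right inner_add_right inner_commute dot_cross_self)
    have tr: "cross3 (?y t) e1 \<bullet> ?x = - (?y t \<bullet> cross3 ?x e1)"
      by (simp add: inner_vec_def sum_3 cross_components algebra_simps)
    have \<rho>: "\<rho> t \<noteq> 0" "\<rho> t * (1 + ?y t \<bullet> wind \<epsilon> ?x) = 1"
      using facts(3)[of t] by (simp_all add: \<rho>_def)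
    have "\<mu> = \<rho> t * (?y' \<bullet> ?x) - \<epsilon> * \<rho> t * (cross3 (?y t) e1 \<bullet> ?x)"
      using arg_cong[OF \<mu>, of "\<lambda>v. v \<bullet> ?x"] n[of t] \<open>?r' = 0\<close>
      by (simp add: inner_diff_left inner_add_left norm_eq_1)
    also have "\<dots> = - \<rho> t"
      unfolding yx tr by (simp add: wind_def algebra_simps)
    finally have "\<rho> t *\<^sub>R ?y' = \<rho> t *\<^sub>R (- ?x + \<epsilon> *\<^sub>R cross3 (?y t) e1)"
      using \<mu> \<open>?r' = 0\<close> by (simp add: algebra_simps)
    then show ?thesis
      using \<rho>(1) by (simp only: scaleR_cancel_left) simp
  qed
  then show ?thesis
    unfolding navigation_pair_def using n facts(1,2) d\<gamma> dy by (simp add: norm_eq_1 inner_commute)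
qed

text \<open>The covector of a flow line is a positive constant times \<open>sin \<theta> y\<close>, where
  \<open>sin \<theta> = \<plusminus> 1\<close>; both signs give the same curves on the sphere.\<close>

lemma flow_lines_navigation_pairs:
  assumes \<epsilon>: "0 \<le> \<epsilon>" "\<epsilon> < 1" and \<theta>: "cos \<theta> = 0"
  shows "{fst \<circ> \<zeta> | \<zeta>. integral_curve (level (katok_ham \<theta> \<epsilon>) (1/2)) (katok_field \<theta> \<epsilon>) \<zeta>}
    = {\<gamma>. \<exists>y. navigation_pair \<epsilon> \<gamma> y}"
proof -
  let ?N = "level (katok_ham \<theta> \<epsilon>) (1/2)" and ?s = "sin \<theta>"
  have ss: "?s * ?s = 1"
    using sin_cos_squared_add[of \<theta>] \<theta> by (simp add: power2_eq_square)
  then have s1: "\<bar>?s\<bar> = 1"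
    by (simp add: abs_square_eq_1[symmetric] power2_eq_square)
  show ?thesis
  proof (intro equalityI subsetI)
    fix \<gamma> assume "\<gamma> \<in> {fst \<circ> \<zeta> | \<zeta>. integral_curve ?N (katok_field \<theta> \<epsilon>) \<zeta>}"
    then obtain \<zeta> where \<zeta>: "integral_curve ?N (katok_field \<theta> \<epsilon>) \<zeta>" and \<gamma>: "\<gamma> = fst \<circ> \<zeta>" by blast
    let ?r = "norm (snd (\<zeta> 0))"
    define y where "y t = (?s / ?r) *\<^sub>R snd (\<zeta> t)" for t
    have l: "\<zeta> t \<in> ?N" and d: "(\<zeta> has_vector_derivative katok_field \<theta> \<epsilon> (\<zeta> t)) (at t)" for t
      using \<zeta> by (auto simp: integral_curve_def)
    have r: "norm (snd (\<zeta> t)) = ?r" for t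
      by (rule katok_flow_norm[OF \<epsilon> \<zeta>])
    have r0: "?r > 0"
      using level_point(3)[OF \<epsilon> l] by simp
    have f: "katok_field \<theta> \<epsilon> (\<zeta> t) = (y t + \<epsilon> *\<^sub>R cross3 (\<gamma> t) e1,
        - (?s * ?r) *\<^sub>R \<gamma> t + \<epsilon> *\<^sub>R cross3 (snd (\<zeta> t)) e1)" for t
      unfolding katok_field_def r[of t] y_def \<gamma> \<theta> by (simp add: divide_inverse)
    have d1: "(\<gamma> has_vector_derivative y t + \<epsilon> *\<^sub>R cross3 (\<gamma> t) e1) (at t)" for t
      using bounded_linear.has_vector_derivative[OF bounded_linear_fst d[of t]] by (simp add: f \<gamma> o_def)
    have d2: "((\<lambda>t. snd (\<zeta> t)) has_vector_derivative - (?s * ?r) *\<^sub>R \<gamma> t + \<epsilon> *\<^sub>R cross3 (snd (\<zeta> t)) e1) (at t)" for t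
      using bounded_linear.has_vector_derivative[OF bounded_linear_snd d[of t]] by (simp add: f)
    have "(y has_vector_derivative (?s / ?r) *\<^sub>R (- (?s * ?r) *\<^sub>R \<gamma> t + \<epsilon> *\<^sub>R cross3 (snd (\<zeta> t)) e1)) (at t)" for t
      unfolding y_def [abs_def]
      by (rule bounded_linear.has_vector_derivative[OF bounded_linear_scaleR_right d2])
    moreover have "(?s / ?r) *\<^sub>R (- (?s * ?r) *\<^sub>R \<gamma> t + \<epsilon> *\<^sub>R cross3 (snd (\<zeta> t)) e1)
        = - \<gamma> t + \<epsilon> *\<^sub>R cross3 (y t) e1" for t
    proof -
      have "(?s / ?r) * - (?s * ?r) = -1"
        using r0 ss by (simp add: field_simps)
      then have "(?s / ?r) *\<^sub>R - (?s * ?r) *\<^sub>R \<gamma> t = - \<gamma> t"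
        unfolding scaleR_scaleR by simp
      then show ?thesis
        unfolding scaleR_add_right by (simp add: y_def cross_mult_left mult.commute)
    qed
    moreover have "norm (\<gamma> t) = 1" "norm (y t) = 1" "\<gamma> t \<bullet> y t = 0" for t
    proof -
      have "norm (y t) = \<bar>?s\<bar> / ?r * ?r"
        unfolding y_def norm_scaleR r[of t] by simp
      then show "norm (y t) = 1"
        using r0 s1 by simp
    qed (use level_point(1,2)[OF \<epsilon> l[of t]] in \<open>simp_all add: \<gamma> y_def\<close>)
    ultimately have "navigation_pair \<epsilon> \<gamma> y"
      unfolding navigation_pair_def using d1 by simp
    then show "\<gamma> \<in> {\<gamma>. \<exists>y. navigation_pair \<epsilon> \<gamma> y}" by blast
  next
    fix \<gamma> assume "\<gamma> \<in> {\<gamma>. \<exists>y. navigation_pair \<epsilon> \<gamma> y}"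
    then obtain y where p: "navigation_pair \<epsilon> \<gamma> y" by blast
    have n: "norm (\<gamma> t) = 1" "norm (y t) = 1" "\<gamma> t \<bullet> y t = 0"
      and d\<gamma>: "(\<gamma> has_vector_derivative y t + \<epsilon> *\<^sub>R cross3 (\<gamma> t) e1) (at t)"
      and dy: "(y has_vector_derivative - \<gamma> t + \<epsilon> *\<^sub>R cross3 (y t) e1) (at t)" for t
      using p by (auto simp: navigation_pair_def)
    have ns: "norm (?s *\<^sub>R y t) = 1" "\<gamma> t \<bullet> (?s *\<^sub>R y t) = 0" for t
      using n[of t] s1 by simp_all
    define \<rho> where "\<rho> = 1 / (1 + \<epsilon> * (cross3 (y 0) (\<gamma> 0) \<bullet> e1))"
    have fac: "1 + \<epsilon> * ((cos \<theta> *\<^sub>R \<gamma> t + ?s *\<^sub>R cross3 (?s *\<^sub>R y t) (\<gamma> t)) \<bullet> e1)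
        = 1 + \<epsilon> * (cross3 (y 0) (\<gamma> 0) \<bullet> e1)" for t
      using ss navigation_pair_conserved[OF p, of t] by (simp add: \<theta> cross_mult_left)
    have \<rho>: "\<rho> > 0"
      using frame_factor_pos[OF n(1)[of 0] ns[of 0] \<epsilon>, of \<theta>] unfolding fac \<rho>_def by simp
    define \<zeta> where "\<zeta> t = (\<gamma> t, \<rho> *\<^sub>R (?s *\<^sub>R y t))" for t
    have "\<zeta> t \<in> ?N" for t
      unfolding \<zeta>_def katok_level_iff[OF n(1) ns \<rho> \<epsilon>] fac using \<rho> by (simp add: \<rho>_def)
    moreover have "(\<zeta> has_vector_derivative katok_field \<theta> \<epsilon> (\<zeta> t)) (at t)" for t
    proof -
      have "(\<zeta> has_vector_derivative (y t + \<epsilon> *\<^sub>R cross3 (\<gamma> t) e1,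
          \<rho> *\<^sub>R (?s *\<^sub>R (- \<gamma> t + \<epsilon> *\<^sub>R cross3 (y t) e1)))) (at t)"
        unfolding \<zeta>_def [abs_def]
        by (intro has_vector_derivative_Pair d\<gamma> bounded_linear.has_vector_derivative[OF bounded_linear_scaleR_right] dy)
      moreover have "norm (snd (\<zeta> t)) = \<rho>"
        unfolding \<zeta>_def snd_conv norm_scaleR[of \<rho>] ns(1) using \<rho> by simp
      then have "katok_field \<theta> \<epsilon> (\<zeta> t) = (y t + \<epsilon> *\<^sub>R cross3 (\<gamma> t) e1,
          \<rho> *\<^sub>R (?s *\<^sub>R (- \<gamma> t + \<epsilon> *\<^sub>R cross3 (y t) e1)))"
        using \<rho> ss by (simp add: katok_field_def \<zeta>_def \<theta> cross_mult_left algebra_simps)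
      ultimately show ?thesis by simp
    qed
    ultimately have "integral_curve ?N (katok_field \<theta> \<epsilon>) \<zeta>"
      by (simp add: integral_curve_def)
    moreover have "\<gamma> = fst \<circ> \<zeta>"
      by (simp add: \<zeta>_def fun_eq_iff)
    ultimately show "\<gamma> \<in> {fst \<circ> \<zeta> | \<zeta>. integral_curve ?N (katok_field \<theta> \<epsilon>) \<zeta>}" by blast
  qed
qed

lemma katok_finsler_geodesic_flow:
  assumes \<epsilon>: "0 \<le> \<epsilon>" "\<epsilon> < 1" and \<theta>: "cos \<theta> = 0"
    and X: "\<And>z. z \<in> level (katok_ham \<theta> \<epsilon>) (1/2) \<Longrightarrow> X z = katok_field \<theta> \<epsilon> z"
  shows "is_finsler_geodesic_flow (level (katok_ham \<theta> \<epsilon>) (1/2)) X"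
proof -
  let ?N = "level (katok_ham \<theta> \<epsilon>) (1/2)"
  have ic: "integral_curve ?N X \<gamma> = integral_curve ?N (katok_field \<theta> \<epsilon>) \<gamma>" for \<gamma>
    by (rule integral_curve_cong) (rule X)
  have "{fst \<circ> \<zeta> | \<zeta>. integral_curve ?N X \<zeta>} = {\<gamma>. finsler_geodesic (zermelo \<epsilon>) 1 \<gamma>}"
    unfolding ic flow_lines_navigation_pairs[OF \<epsilon> \<theta>]
    using navigation_pair_geodesic[OF \<epsilon>] geodesic_navigation_pair[OF \<epsilon>] by blast
  then show ?thesis
    unfolding is_finsler_geodesic_flow_def using zermelo_finsler[OF \<epsilon>] zero_less_one by blast
qed

section \<open>The theorem\<close>

lemma katok_level_0: "level (katok_ham \<theta> 0) (1/2) = ST_cot"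
  unfolding katok_ham_0 by (auto simp: level_def kinetic_def Tcot_iff STcot_iff abs_square_eq_1 power2_eq_1_iff)

theorem theorem2p3:
  fixes \<alpha> :: "phase form1"
  assumes "connection_form \<alpha>"
  shows "\<exists>q. circle_of_unit_quaternions q \<and>
    (let \<psi> = (\<lambda>\<theta> u. qmult (q \<theta>) u);
         \<alpha>\<theta> = (\<lambda>\<theta>. pushforward S3 (\<psi> \<theta>) (alpha_form q_i))
     in
      (\<forall>\<theta>.
         form1_eq S3 (\<alpha>\<theta> \<theta>)
           (\<lambda>u u'. cos \<theta> * alpha_form q_i u u' + sin \<theta> * alpha_form q_j u u') \<and>
         contact_form S3 (\<alpha>\<theta> \<theta>) \<and>
         (\<forall>\<gamma>. integral_curve S3 (reeb_field S3 (\<alpha>\<theta> \<theta>)) \<gamma> \<longrightarrow> has_minimal_period \<gamma> (4 * pi)) \<and>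
         reeb_flow_doubly_covers S3 (\<alpha>\<theta> \<theta>) ST_cot (X_ham \<alpha> \<theta> kinetic)) \<and>
      (\<exists>\<alpha>i.
         smooth_form_family {0..<1} S3 \<alpha>i \<and>
         form1_eq S3 (\<alpha>i 0) (alpha_form q_i) \<and>
         (\<forall>\<epsilon>\<in>{0..<1}. contact_form S3 (\<alpha>i \<epsilon>)) \<and>
         (let \<alpha>\<theta>\<epsilon> = (\<lambda>\<theta> \<epsilon>. pushforward S3 (\<psi> \<theta>) (\<alpha>i \<epsilon>))
          in
           (\<forall>\<theta>. \<forall>\<epsilon>\<in>{0..<1}. contact_form S3 (\<alpha>\<theta>\<epsilon> \<theta> \<epsilon>) \<and>
              form1_eq S3 (\<alpha>\<theta>\<epsilon> (\<theta> + 2 * pi) \<epsilon>) (\<alpha>\<theta>\<epsilon> \<theta> \<epsilon>)) \<and>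
           (\<forall>\<theta>. \<exists>H c.
              perturbed_hamiltonian \<alpha> \<theta> H c \<and>
              (\<forall>\<epsilon>\<in>{0..<1}.
                 reeb_flow_doubly_covers S3 (\<alpha>\<theta>\<epsilon> \<theta> \<epsilon>) (level (H \<epsilon>) c) (X_ham \<alpha> \<theta> (H \<epsilon>))) \<and>
              (\<forall>\<epsilon>\<in>{0..<1}. \<epsilon> \<notin> \<rat> \<longrightarrow>
                 card (periodic_orbits (level (H \<epsilon>) c) (X_ham \<alpha> \<theta> (H \<epsilon>))) = 2) \<and>
              ((\<exists>n::int. \<theta> = pi / 2 + of_int n * pi) \<longrightarrow>
                 (\<exists>\<epsilon>0>0. \<forall>\<epsilon>\<in>{0..<1}. \<epsilon> < \<epsilon>0 \<longrightarrow>
                    is_finsler_geodesic_flow (level (H \<epsilon>) c) (X_ham \<alpha> \<theta> (H \<epsilon>))))))))"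
proof -
  let ?push = "\<lambda>\<theta> \<epsilon>. pushforward S3 (qmult (circ \<theta>)) (tilted_form e1 \<epsilon>)"
  have i0: "alpha_form q_i = tilted_form e1 0"
    by (simp add: tilted_form_0 q_i_pure)
  have X: "X_ham \<alpha> \<theta> (katok_ham \<theta> \<epsilon>) z = katok_field \<theta> \<epsilon> z"
    if "\<epsilon> \<in> {0..<1}" "z \<in> level (katok_ham \<theta> \<epsilon>) (1/2)" for \<theta> \<epsilon> z
    using ham_field_katok[OF assms _ _ that(2)] that(1) by simp
  have contact: "contact_form S3 (?push \<theta> \<epsilon>)" if "\<epsilon> \<in> {0..<1}" for \<theta> \<epsilon>
    using contact_form_cong[OF pushforward_circ tilted_contact_form[OF norm_axis_at]] that by simp
  have covers: "reeb_flow_doubly_covers S3 (?push \<theta> \<epsilon>) (level (katok_ham \<theta> \<epsilon>) (1/2))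
      (X_ham \<alpha> \<theta> (katok_ham \<theta> \<epsilon>))" if \<epsilon>: "\<epsilon> \<in> {0..<1}" for \<theta> \<epsilon>
    using tilted_reeb_flow_doubly_covers[OF _ _ pushforward_circ X[OF \<epsilon>]] \<epsilon> by simp
  have combination: "tilted_form (axis_at \<theta>) 0 = (\<lambda>u u'. cos \<theta> * alpha_form q_i u u' + sin \<theta> * alpha_form q_j u u')" for \<theta>
    unfolding tilted_form_0 q_i_pure q_j_pure alpha_form_pure axis_at_def
    by (simp add: pure_linear qmult_distribs inner_add_left fun_eq_iff algebra_simps)
  have round: "form1_eq S3 (?push \<theta> 0)
      (\<lambda>u u'. cos \<theta> * alpha_form q_i u u' + sin \<theta> * alpha_form q_j u u') \<and>
    contact_form S3 (?push \<theta> 0) \<and>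
    (\<forall>\<gamma>. integral_curve S3 (reeb_field S3 (?push \<theta> 0)) \<gamma> \<longrightarrow> has_minimal_period \<gamma> (4 * pi)) \<and>
    reeb_flow_doubly_covers S3 (?push \<theta> 0) ST_cot (X_ham \<alpha> \<theta> kinetic)" for \<theta>
  proof (intro conjI allI impI)
    show "form1_eq S3 (?push \<theta> 0)
      (\<lambda>u u'. cos \<theta> * alpha_form q_i u u' + sin \<theta> * alpha_form q_j u u')"
      unfolding combination[symmetric] by (rule pushforward_circ)
    show "contact_form S3 (?push \<theta> 0)"
      by (rule contact) simp
    show "has_minimal_period \<gamma> (4 * pi)" if "integral_curve S3 (reeb_field S3 (?push \<theta> 0)) \<gamma>" for \<gamma>
      using reeb_orbits_minimal_period[OF pushforward_circ norm_axis_at that] .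
    show "reeb_flow_doubly_covers S3 (?push \<theta> 0) ST_cot (X_ham \<alpha> \<theta> kinetic)"
      using covers[of 0 \<theta>] katok_level_0[of \<theta>] by (simp add: katok_ham_0)
  qed
  have family: "smooth_form_family {0..<1} S3 (tilted_form e1)"
    "form1_eq S3 (tilted_form e1 0) (tilted_form e1 0)"
    "\<forall>\<epsilon>\<in>{0..<1}. contact_form S3 (tilted_form e1 \<epsilon>)"
    using tilted_smooth_family tilted_contact_form[of e1] by (auto simp: form1_eq_def)
  have periodic: "form1_eq S3 (?push (\<theta> + 2 * pi) \<epsilon>) (?push \<theta> \<epsilon>)" for \<theta> \<epsilon>
  proof -
    have a: "axis_at (\<theta> + 2 * pi) = axis_at \<theta>"
      by (simp add: axis_at_def)
    show ?thesis
      by (rule form1_eq_trans[OF pushforward_circ[of "\<theta> + 2 * pi" \<epsilon>, unfolded a] form1_eq_sym[OF pushforward_circ]])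
  qed
  have perturbed: "perturbed_hamiltonian \<alpha> \<theta> (katok_ham \<theta>) (1/2)" for \<theta>
    unfolding perturbed_hamiltonian_def
  proof (intro conjI)
    show "smooth_map ({0..<1} \<times> T_cot_minus_zero) (\<lambda>(\<epsilon>, z). katok_ham \<theta> \<epsilon> z)"
      by (rule smooth_mapI[OF _ katok_ham_smooth(1)]) (auto simp: T_cot_minus_zero_def)
    show "level (katok_ham \<theta> 0) (1/2) = ST_cot"
      by (rule katok_level_0)
  qed (simp add: katok_ham_0)
  have orbits: "card (periodic_orbits (level (katok_ham \<theta> \<epsilon>) (1/2)) (X_ham \<alpha> \<theta> (katok_ham \<theta> \<epsilon>))) = 2"
    if \<epsilon>: "\<epsilon> \<in> {0..<1}" and "\<epsilon> \<notin> \<rat>" for \<theta> \<epsilon>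
    using two_periodic_orbits[OF _ _ that(2) X[OF \<epsilon>]] \<epsilon> by simp
  have finsler: "is_finsler_geodesic_flow (level (katok_ham \<theta> \<epsilon>) (1/2)) (X_ham \<alpha> \<theta> (katok_ham \<theta> \<epsilon>))"
    if \<theta>: "\<exists>n::int. \<theta> = pi / 2 + of_int n * pi" and \<epsilon>: "\<epsilon> \<in> {0..<1}" for \<theta> \<epsilon>
  proof -
    have "cos \<theta> = 0"
      using \<theta> by (auto simp: cos_add mult.commute[of _ pi])
    then show ?thesis
      using katok_finsler_geodesic_flow[OF _ _ _ X[OF \<epsilon>]] \<epsilon> by simp
  qed
  have deformed: "\<exists>H c. perturbed_hamiltonian \<alpha> \<theta> H c \<and>
      (\<forall>\<epsilon>\<in>{0..<1}. reeb_flow_doubly_covers S3 (?push \<theta> \<epsilon>) (level (H \<epsilon>) c) (X_ham \<alpha> \<theta> (H \<epsilon>))) \<and>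
      (\<forall>\<epsilon>\<in>{0..<1}. \<epsilon> \<notin> \<rat> \<longrightarrow>
         card (periodic_orbits (level (H \<epsilon>) c) (X_ham \<alpha> \<theta> (H \<epsilon>))) = 2) \<and>
      ((\<exists>n::int. \<theta> = pi / 2 + of_int n * pi) \<longrightarrow>
         (\<exists>\<epsilon>0>0. \<forall>\<epsilon>\<in>{0..<1}. \<epsilon> < \<epsilon>0 \<longrightarrow>
            is_finsler_geodesic_flow (level (H \<epsilon>) c) (X_ham \<alpha> \<theta> (H \<epsilon>))))" for \<theta>
  proof (rule exI[of _ "katok_ham \<theta>"], rule exI[of _ "1/2"], intro conjI ballI impI)
    show "\<exists>\<epsilon>0>0. \<forall>\<epsilon>\<in>{0..<1}. \<epsilon> < \<epsilon>0 \<longrightarrow>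
        is_finsler_geodesic_flow (level (katok_ham \<theta> \<epsilon>) (1/2)) (X_ham \<alpha> \<theta> (katok_ham \<theta> \<epsilon>))"
      if "\<exists>n::int. \<theta> = pi / 2 + of_int n * pi"
      using finsler[OF that] by (intro exI[of _ 1]) simp
  qed (use perturbed covers orbits in auto)
  show ?thesis
    unfolding Let_def i0
    by (rule exI[of _ circ], rule conjI, rule circle_of_unit_quaternions_circ, rule conjI,
        rule allI, rule round[unfolded i0], rule exI[of _ "tilted_form e1"],
        intro conjI allI ballI family deformed contact periodic)
qed

end
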